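(* Let $n \geq 2$, $N \geq 1$ and $k$ be integers with $2 \leq k \leq n$, and let $s \in (0,1]$ satisfy $s \geq \frac{k}{k+1}$. Let $\mathbb{B}^n$ denote the unit ball in $\mathbb{R}^n$. Then there exists no map $u \in W^{s,\frac{k}{s}}(\mathbb{B}^n,\mathbb{R}^N)$ which is a homeomorphism (onto its image) and satisfies \[ \operatorname{rank}(\nabla u) < k \quad \text{in distributional sense in } \mathbb{B}^n. \]
   Context: Sobolev spaces: for $s\in(0,1)$ and $p\in(1,\infty)$, $W^{s,p}(\Omega)$ is the fractional Sobolev space of $f\in L^p(\Omega)$ with finite Gagliardo seminorm \[ [f]_{W^{s,p}(\Omega)} := \left(\int_{\Omega} \int_{\Omega} \frac{|f(x)-f(y)|^{p}}{|x-y|^{n+sp}}\, dx\, dy\right)^{\frac{1}{p}}, \] with norm $\|f\|_{W^{s,p}}=\|f\|_{L^p}+[f]_{W^{s,p}}$. For $s=1$, $W^{1,p}$ is the usual first-order Sobolev space. Pullback: for a smooth map $g=(g^1,\ldots,g^N)$ from $\mathbb{B}^n$ to $\mathbb{R}^N$ and $1\le i_1<\ldots<i_k\le N$, \[ g^\ast(dp^{i_1} \wedge \ldots \wedge dp^{i_k}) = \sum_{\alpha_1,\ldots,\alpha_k=1}^n\partial_{\alpha_1} g^{i_1}\cdots \partial_{\alpha_k} g^{i_k}\ dx^{\alpha_1} \wedge \ldots \wedge dx^{\alpha_k}, \] a $k$-form whose components (coefficients with respect to $dx^{\alpha_1}\wedge\ldots\wedge dx^{\alpha_k}$, $\alpha_1<\ldots<\alpha_k$)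 are the $k\times k$ minors of $(\nabla g^{i_1},\ldots,\nabla g^{i_k})\in\mathbb{R}^{n\times k}$. Vanishing of the pullback in distributional sense: let $s\in(0,1]$, $p\in(1,\infty)$. A map $f\in W^{s,p}(\mathbb{B}^n,\mathbb{R}^N)$ satisfies $f^\ast(dp^{i_1}\wedge\ldots\wedge dp^{i_k})=0$ in ($W^{s,p}$-)distributional sense if for any $\varphi\in C_c^\infty(\mathbb{B}^n)$ and any $f_\varepsilon\in C^\infty(\overline{\mathbb{B}^n},\mathbb{R}^N)$ with $\|f_\varepsilon-f\|_{W^{s,p}}\to 0$ as $\varepsilon\to0$ one has \[ \lim_{\varepsilon\to0}\int_{\mathbb{B}^n} f_\varepsilon^\ast(dp^{i_1}\wedge\ldots\wedge dp^{i_k})\,\varphi=0, \] where, if $k<n$, the integral is understood componentwise, i.e. the limit is zero for each component of the $k$-form $f_\varepsilon^\ast(dp^{i_1}\wedge\ldots\wedge dp^{i_k})$ integrated against $\varphi\,dx$. Distributional rank: $f$ satisfies $\operatorname{rank}(\nabla f)<k$ in distributional sense if $f^\ast(dp^{i_1}\wedge\ldots\wedge dp^{i_k})=0$ in distributional sense for all $1\le i_1<\ldots<i_k\le N$. In the theorem this is used with $p=\frac{k}{s}$. *)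

theory Defs
  imports "HOL-Analysis.Analysis"
begin

section \<open>Smooth functions\<close>

definition partial :: "'n \<Rightarrow> (real^'n \<Rightarrow> 'b) \<Rightarrow> real^'n \<Rightarrow> 'b::real_normed_vector"
  where "partial \<alpha> f x = frechet_derivative f (at x) (axis \<alpha> 1)"

text \<open>Meant for open sets only, since all derivatives are unrestricted ones.\<close>

primrec Ck_on :: "nat \<Rightarrow> (real^'n) set \<Rightarrow> (real^'n \<Rightarrow> 'b::real_normed_vector) \<Rightarrow> bool"
  where
    "Ck_on 0 U f \<longleftrightarrow> continuous_on U f"
  | "Ck_on (Suc m) U f \<longleftrightarrow> (\<forall>x\<in>U. f differentiable (at x)) \<and> (\<forall>\<alpha>. Ck_on m U (partial \<alpha> f))"

definition smooth_on :: "(real^'n) set \<Rightarrow> (real^'n \<Rightarrow> 'b::real_normed_vector) \<Rightarrow> bool"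
  where "smooth_on U f \<longleftrightarrow> (\<forall>m. Ck_on m U f)"

text \<open>\<open>C\<^sup>\<infinity>\<close> up to the boundary: smooth in some open neighbourhood of the closure.\<close>

definition smooth_closure :: "(real^'n) set \<Rightarrow> (real^'n \<Rightarrow> 'b::real_normed_vector) set"
  where "smooth_closure \<Omega> = {f. \<exists>U. open U \<and> closure \<Omega> \<subseteq> U \<and> smooth_on U f}"

definition test_functions :: "(real^'n) set \<Rightarrow> (real^'n \<Rightarrow> real) set"
  where "test_functions \<Omega> =
    {\<phi>. smooth_on UNIV \<phi> \<and> compact (closure {x. \<phi> x \<noteq> 0}) \<and> closure {x. \<phi> x \<noteq> 0} \<subseteq> \<Omega>}"


section \<open>Sobolev spaces\<close>

text \<open>Norms and seminorms take values in \<open>ennreal\<close>; they are \<open>\<infinity>\<close> on functions outside the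
  respective space, so that smallness of a norm never holds by a junk value.\<close>

definition ennroot :: "real \<Rightarrow> ennreal \<Rightarrow> ennreal"
  where "ennroot p I = (if I = \<infinity> then \<infinity> else ennreal (enn2real I powr (1 / p)))"

definition Lp_norm :: "real \<Rightarrow> (real^'n) set \<Rightarrow> (real^'n \<Rightarrow> 'b::euclidean_space) \<Rightarrow> ennreal"
  where "Lp_norm p \<Omega> f = ennroot p (\<integral>\<^sup>+x. ennreal (norm (f x) powr p) \<partial>lebesgue_on \<Omega>)"

text \<open>On the diagonal the integrand is \<open>0 / 0 = 0\<close>, which does not affect the integral.\<close>

definition gagliardo_seminorm ::
    "real \<Rightarrow> real \<Rightarrow> (real^'n) set \<Rightarrow> (real^'n \<Rightarrow> 'b::euclidean_space) \<Rightarrow> ennreal"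
  where "gagliardo_seminorm s p \<Omega> f =
    ennroot p (\<integral>\<^sup>+y. (\<integral>\<^sup>+x. ennreal (norm (f x - f y) powr p / norm (x - y) powr (real CARD('n) + s * p))
      \<partial>lebesgue_on \<Omega>) \<partial>lebesgue_on \<Omega>)"

definition locally_integrable :: "(real^'n) set \<Rightarrow> (real^'n \<Rightarrow> 'b::euclidean_space) \<Rightarrow> bool"
  where "locally_integrable \<Omega> f \<longleftrightarrow> (\<forall>K. compact K \<and> K \<subseteq> \<Omega> \<longrightarrow> f absolutely_integrable_on K)"

definition weak_gradient ::
    "(real^'n) set \<Rightarrow> (real^'n \<Rightarrow> real^'m) \<Rightarrow> (real^'n \<Rightarrow> real^'n^'m) \<Rightarrow> bool"
  where "weak_gradient \<Omega> f G \<longleftrightarrow>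
    G \<in> borel_measurable (lebesgue_on \<Omega>) \<and> locally_integrable \<Omega> f \<and> locally_integrable \<Omega> G \<and>
    (\<forall>\<phi>\<in>test_functions \<Omega>. \<forall>\<alpha> j.
      (\<integral>x. f x $ j * partial \<alpha> \<phi> x \<partial>lebesgue_on \<Omega>) = - (\<integral>x. G x $ j $ \<alpha> * \<phi> x \<partial>lebesgue_on \<Omega>))"

text \<open>For \<open>s = 1\<close> this is the \<open>L\<^sup>p\<close> norm of the weak gradient. A weak gradient is unique up to null
  sets, so the infimum is over a single value, or is \<open>\<infinity>\<close> if there is no weak gradient.\<close>

definition sobolev_seminorm ::
    "real \<Rightarrow> real \<Rightarrow> (real^'n) set \<Rightarrow> (real^'n \<Rightarrow> real^'m) \<Rightarrow> ennreal"
  where "sobolev_seminorm s p \<Omega> f =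
    (if s = 1 then (INF G\<in>{G. weak_gradient \<Omega> f G}. Lp_norm p \<Omega> G) else gagliardo_seminorm s p \<Omega> f)"

definition sobolev_norm ::
    "real \<Rightarrow> real \<Rightarrow> (real^'n) set \<Rightarrow> (real^'n \<Rightarrow> real^'m) \<Rightarrow> ennreal"
  where "sobolev_norm s p \<Omega> f = Lp_norm p \<Omega> f + sobolev_seminorm s p \<Omega> f"

definition sobolev_space :: "real \<Rightarrow> real \<Rightarrow> (real^'n) set \<Rightarrow> (real^'n \<Rightarrow> real^'m) set"
  where "sobolev_space s p \<Omega> =
    {f \<in> borel_measurable (lebesgue_on \<Omega>). Lp_norm p \<Omega> f < \<infinity> \<and> sobolev_seminorm s p \<Omega> f < \<infinity>}"


section \<open>Pullback of \<open>k\<close>-forms and distributional rank\<close>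

text \<open>Multi-indices of length \<open>k\<close> are functions on \<open>{..<k}\<close>, i.e. numbered from 0; only their
  values there matter. Alternating \<open>k\<close>-covectors on \<open>\<real>\<^sup>n\<close> are functions of \<open>k\<close> vectors
  \<open>v 0, \<dots>, v (k - 1)\<close>.\<close>

definition wedge_dx :: "nat \<Rightarrow> (nat \<Rightarrow> 'n) \<Rightarrow> (nat \<Rightarrow> real^'n) \<Rightarrow> real"
  where "wedge_dx k \<alpha> v = (\<Sum>\<pi> | \<pi> permutes {..<k}. of_int (sign \<pi>) * (\<Prod>j<k. v (\<pi> j) $ \<alpha> j))"

text \<open>The form \<open>g\<^sup>*(dp\<^bsup>i 0\<^esup> \<and> \<dots> \<and> dp\<^bsup>i (k - 1)\<^esup>)\<close> at the point \<open>x\<close>.\<close>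

definition pullback ::
    "nat \<Rightarrow> (nat \<Rightarrow> 'm) \<Rightarrow> (real^'n \<Rightarrow> real^'m) \<Rightarrow> real^'n \<Rightarrow> (nat \<Rightarrow> real^'n) \<Rightarrow> real"
  where "pullback k i g x v =
    (\<Sum>\<alpha> \<in> {..<k} \<rightarrow>\<^sub>E UNIV. (\<Prod>j<k. partial (\<alpha> j) (\<lambda>z. g z $ i j) x) * wedge_dx k \<alpha> v)"

text \<open>The coefficient of a \<open>k\<close>-covector with respect to
  \<open>dx\<^bsup>\<beta> 0\<^esup> \<and> \<dots> \<and> dx\<^bsup>\<beta> (k - 1)\<^esup>\<close> (for increasing \<open>\<beta>\<close>) is its value on the corresponding
  standard basis vectors.\<close>

definition form_component :: "(nat \<Rightarrow> 'n) \<Rightarrow> ((nat \<Rightarrow> real^'n) \<Rightarrow> real) \<Rightarrow> real"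
  where "form_component \<beta> \<omega> = \<omega> (\<lambda>j. axis (\<beta> j) 1)"

text \<open>The components of the pullback are the \<open>k \<times> k\<close> minors of the gradient.\<close>

lemma form_component_pullback:
  "form_component \<beta> (pullback k i g x) =
    (\<Sum>\<pi> | \<pi> permutes {..<k}. of_int (sign \<pi>) * (\<Prod>j<k. partial (\<beta> (\<pi> j)) (\<lambda>z. g z $ i j) x))"
proof -
  let ?D = "\<lambda>j a. partial a (\<lambda>z. g z $ i j) x"
  let ?\<delta> = "\<lambda>\<pi> j a. axis (\<beta> (\<pi> j)) (1::real) $ a"
  have "form_component \<beta> (pullback k i g x) =
      (\<Sum>\<alpha> \<in> {..<k} \<rightarrow>\<^sub>E UNIV. \<Sum>\<pi> | \<pi> permutes {..<k}.
        of_int (sign \<pi>) * (\<Prod>j<k. ?D j (\<alpha> j) * ?\<delta> \<pi> j (\<alpha> j)))"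
    by (simp add: form_component_def pullback_def wedge_dx_def sum_distrib_left prod.distrib mult_ac)
  also have "\<dots> = (\<Sum>\<pi> | \<pi> permutes {..<k}. of_int (sign \<pi>) *
        (\<Sum>\<alpha> \<in> {..<k} \<rightarrow>\<^sub>E UNIV. \<Prod>j<k. ?D j (\<alpha> j) * ?\<delta> \<pi> j (\<alpha> j)))"
    by (subst sum.swap) (simp add: sum_distrib_left)
  also have "\<dots> = (\<Sum>\<pi> | \<pi> permutes {..<k}. of_int (sign \<pi>) *
        (\<Prod>j<k. \<Sum>a\<in>UNIV. ?D j a * ?\<delta> \<pi> j a))"
    by (subst prod_sum_PiE) auto
  also have "\<dots> = (\<Sum>\<pi> | \<pi> permutes {..<k}. of_int (sign \<pi>) * (\<Prod>j<k. ?D j (\<beta> (\<pi> j))))"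
    by (simp add: axis_def if_distrib sum.delta cong: if_cong)
  finally show ?thesis .
qed

definition pullback_vanishes ::
    "real \<Rightarrow> real \<Rightarrow> nat \<Rightarrow> (nat \<Rightarrow> 'm) \<Rightarrow> (real^('n::{finite,linorder}) \<Rightarrow> real^'m) \<Rightarrow> bool"
  where "pullback_vanishes s p k i f \<longleftrightarrow>
    (\<forall>\<phi> \<in> test_functions (ball 0 1). \<forall>F :: real \<Rightarrow> real^('n::{finite,linorder}) \<Rightarrow> real^'m.
      (\<forall>\<epsilon>>0. F \<epsilon> \<in> smooth_closure (ball 0 1)) \<and>
      ((\<lambda>\<epsilon>. sobolev_norm s p (ball 0 1) (\<lambda>x. F \<epsilon> x - f x)) \<longlongrightarrow> 0) (at_right 0) \<longrightarrow>
      (\<forall>\<beta>. strict_mono_on {..<k} \<beta> \<longrightarrow>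
        ((\<lambda>\<epsilon>. \<integral>x. form_component \<beta> (pullback k i (F \<epsilon>) x) * \<phi> x \<partial>lebesgue_on (ball 0 1)) \<longlongrightarrow> 0)
          (at_right 0)))"

definition rank_gradient_less ::
    "real \<Rightarrow> real \<Rightarrow> nat \<Rightarrow> (real^('n::{finite,linorder}) \<Rightarrow> real^('m::{finite,linorder})) \<Rightarrow> bool"
  where "rank_gradient_less s p k f \<longleftrightarrow>
    (\<forall>i. strict_mono_on {..<k} i \<longrightarrow> pullback_vanishes s p k i f)"

end

theory Submission
  imports Defs "HOL-Probability.Probability_Measure"
begin

text \<open>
  Suppose that \<open>u\<close> is such a homeomorphism. Let \<open>F\<^sub>t\<close> be the mollification of \<open>u\<close> at scale \<open>t\<close>, combined
  with a dilation by \<open>1 - t\<close> so that it only involves values of \<open>u\<close> in the ball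
  (\<open>smoothen\<close>). These maps are smooth, converge to \<open>u\<close> in the Sobolev norm
  (\<open>smoothen_tendsto_sobolev\<close>) and converge uniformly near the origin. By the first property the
  minors of \<open>F\<^sub>t\<close> tend to \<open>0\<close> when they are integrated against a fixed test function
  (\<open>minors_vanish\<close>).

  The topological information is used through polynomials. Since \<open>u\<close> has a continuous inverse on the compact
  image of a small ball, there are polynomials \<open>h\<^sub>j\<close> on \<open>\<real>\<^sup>N\<close> such that \<open>h\<^sub>j \<circ> u\<close>, and
  hence \<open>h\<^sub>j \<circ> F\<^sub>t\<close> for small \<open>t\<close>, is uniformly close to the \<open>j\<close>-th of \<open>k\<close> chosen coordinates. With a
  smooth step function \<open>B\<close> and a matching cut-off \<open>\<phi>\<close>, the integral of \<open>\<phi>\<close> against the minor of the functions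
  \<open>B \<circ> h\<^sub>j \<circ> F\<^sub>t\<close> is then exactly that of the coordinates themselves, a positive number
  (\<open>minors_of_near_projection\<close>). This replaces an argument with the mapping degree: minors are null Lagrangians,
  so a function may be exchanged for another one at the price of an integral that has a derivative of \<open>\<phi>\<close> in it,
  and this integrand is identically zero.

  By the chain rule the same integral is a sum of integrals of minors of \<open>F\<^sub>t\<close> against \<open>\<phi> \<cdot> H(F\<^sub>t)\<close>, with smooth
  \<open>H\<close>. So it suffices that these tend to \<open>0\<close> as well (\<open>weighted_minors_vanish\<close>), although the
  weight now moves with \<open>t\<close>. For a weight frozen at a scale \<open>t\<^sub>m\<close>, the minors of \<open>F\<^sub>t\<close> do give \<open>0\<close> in the limit
  \<open>t \<rightarrow> 0\<close>; hence one has to bound the change between the minors at scale \<open>t\<^sub>m\<close> and those at a finer scale,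
  uniformly in the latter.

  If \<open>s = 1\<close>, the gradients converge in \<open>L\<^sup>k\<close>, so the minors converge in \<open>L\<^sup>1\<close> (\<open>minors_cauchy_W1\<close>). If \<open>s < 1\<close>, one
  passes from one scale to the next (\<open>minors_cauchy_fractional\<close>). Integration by parts moves the derivative
  from the increment of \<open>F\<close> to the weight, which leaves \<open>k + 1\<close> oscillations of \<open>u\<close> but only \<open>k\<close> derivatives. By
  Young's inequality such a product is controlled by the integral of \<open>t\<^bsup>- n - k\<^esup> |u(x) - u(y)|\<^bsup>k + 1\<^esup>\<close> over pairs
  with \<open>|x - y| \<le> 2 t\<close>. Here \<open>u\<close> is bounded and \<open>p = k / s \<le> k + 1\<close>, which is the hypothesis \<open>s \<ge> k / (k + 1)\<close>, so
  that the power \<open>k + 1\<close> may be lowered to \<open>p\<close>; since \<open>n + k = n + s p\<close>, the result is the part of the Gagliardo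
  integral near the diagonal, and it tends to \<open>0\<close> (\<open>osc_energy_tendsto_0\<close>). The derivative on the weight is
  taken at the coarse scale, and this makes the sum over all finer scales a geometric series.
\<close>

section \<open>Calculus of smooth functions on the whole space\<close>

lemma partial_has_derivative:
  assumes "(f has_derivative f') (at x)"
  shows "partial a f x = f' (axis a 1)"
  using frechet_derivative_at[OF assms] by (simp add: partial_def)

lemma sum_axis_mult: "(\<Sum>c\<in>UNIV. axis a (1::real) $ c * g c) = g a"
proof -
  have "(\<Sum>c\<in>UNIV. axis a (1::real) $ c * g c) = (\<Sum>c\<in>UNIV. if c = a then g c else 0)"
    by (intro sum.cong) (auto simp: axis_def)
  then show ?thesis by simp
qed

lemma has_derivative_partials:
  fixes f :: "real^'n \<Rightarrow> real"
  assumes "f differentiable (at x)"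
  shows "(f has_derivative (\<lambda>h. \<Sum>a\<in>UNIV. h $ a * partial a f x)) (at x)"
proof -
  obtain f' where f': "(f has_derivative f') (at x)"
    using assms by (auto simp: differentiable_def)
  have lin: "linear f'" using f' by (rule has_derivative_linear)
  have "f' h = (\<Sum>a\<in>UNIV. h $ a * partial a f x)" for h
  proof -
    have "f' h = f' (\<Sum>a\<in>UNIV. h $ a *\<^sub>R axis a 1)"
      using basis_expansion[of h] by (simp add: scalar_mult_eq_scaleR)
    also have "\<dots> = (\<Sum>a\<in>UNIV. h $ a * f' (axis a 1))"
      by (simp add: linear_sum[OF lin] linear_scale[OF lin] o_def)
    finally show ?thesis by (simp add: partial_has_derivative[OF f'])
  qed
  then have "f' = (\<lambda>h. \<Sum>a\<in>UNIV. h $ a * partial a f x)" by auto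
  with f' show ?thesis by simp
qed

lemma partial_const: "partial a (\<lambda>x. c) = (\<lambda>x. 0)"
  by (rule ext, subst partial_has_derivative[OF has_derivative_const]) simp

lemma partial_component: "partial a (\<lambda>x::real^'n. x $ i) = (\<lambda>x. if a = i then 1 else 0)"
proof
  fix x :: "real^'n"
  have "((\<lambda>x. x $ i) has_derivative (\<lambda>h. h $ i)) (at x)"
    by (rule bounded_linear_imp_has_derivative) (rule bounded_linear_vec_nth)
  from partial_has_derivative[OF this, of a]
  show "partial a (\<lambda>x::real^'n. x $ i) x = (if a = i then 1 else 0)"
    by (simp add: axis_def)
qed

lemma partial_add:
  fixes f g :: "real^'n \<Rightarrow> real"
  assumes "f differentiable (at x)" "g differentiable (at x)"
  shows "partial a (\<lambda>x. f x + g x) x = partial a f x + partial a g x"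
  using partial_has_derivative[OF has_derivative_add[OF has_derivative_partials[OF assms(1)] has_derivative_partials[OF assms(2)]]]
  by (simp add: sum_axis_mult)

lemma partial_diff:
  fixes f g :: "real^'n \<Rightarrow> real"
  assumes "f differentiable (at x)" "g differentiable (at x)"
  shows "partial a (\<lambda>x. f x - g x) x = partial a f x - partial a g x"
  using partial_has_derivative[OF has_derivative_diff[OF has_derivative_partials[OF assms(1)] has_derivative_partials[OF assms(2)]]]
  by (simp add: sum_axis_mult)

lemma partial_mult:
  fixes f g :: "real^'n \<Rightarrow> real"
  assumes "f differentiable (at x)" "g differentiable (at x)"
  shows "partial a (\<lambda>x. f x * g x) x = f x * partial a g x + partial a f x * g x"
  using partial_has_derivative[OF has_derivative_mult[OF has_derivative_partials[OF assms(1)] has_derivative_partials[OF assms(2)]]]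
  by (simp add: sum_axis_mult)

lemma partial_cmult:
  fixes f :: "real^'n \<Rightarrow> real"
  assumes "f differentiable (at x)"
  shows "partial a (\<lambda>x. c * f x) x = c * partial a f x"
  using partial_mult[of "\<lambda>x. c", OF _ assms] by (simp add: partial_const)

lemma partial_real_compose:
  fixes f :: "real^'n \<Rightarrow> real"
  assumes "(b has_real_derivative b') (at (f x))" "f differentiable (at x)"
  shows "partial a (\<lambda>x. b (f x)) x = b' * partial a f x"
  using partial_has_derivative[OF has_derivative_compose[OF has_derivative_partials[OF assms(2)]
      assms(1)[unfolded has_field_derivative_def]]]
  by (simp add: sum_axis_mult)

lemma partial_compose:
  fixes g :: "real^'m \<Rightarrow> real" and F :: "real^'n \<Rightarrow> real^'m"
  assumes "g differentiable (at (F x))" "\<And>i. (\<lambda>x. F x $ i) differentiable (at x)"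
  shows "(\<lambda>x. g (F x)) differentiable (at x)"
    and "partial a (\<lambda>x. g (F x)) x = (\<Sum>i\<in>UNIV. partial i g (F x) * partial a (\<lambda>x. F x $ i) x)"
proof -
  let ?F' = "\<lambda>h. \<chi> i. \<Sum>a\<in>UNIV. h $ a * partial a (\<lambda>x. F x $ i) x"
  have F: "(F has_derivative ?F') (at x)"
    unfolding has_derivative_componentwise_within[of F]
    using has_derivative_partials[OF assms(2)]
    by (auto simp: Basis_vec_def inner_axis)
  have *: "((\<lambda>x. g (F x)) has_derivative (\<lambda>h. \<Sum>i\<in>UNIV. ?F' h $ i * partial i g (F x))) (at x)"
    by (rule has_derivative_compose[OF F has_derivative_partials[OF assms(1)]])
  then show "(\<lambda>x. g (F x)) differentiable (at x)" by (auto simp: differentiable_def)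
  show "partial a (\<lambda>x. g (F x)) x = (\<Sum>i\<in>UNIV. partial i g (F x) * partial a (\<lambda>x. F x $ i) x)"
    using partial_has_derivative[OF *]
    by (simp add: sum_axis_mult mult.commute)
qed

lemma Ck_on_Suc_imp: "Ck_on (Suc m) U f \<Longrightarrow> Ck_on m U f"
proof (induction m arbitrary: f)
  case 0
  then show ?case
    by (auto simp: continuous_at_imp_continuous_on differentiable_imp_continuous_within)
next
  case (Suc m)
  then show ?case by (auto simp del: Ck_on.simps(2) simp: Ck_on.simps(2)[of "Suc m"] Ck_on.simps(2)[of m])
qed

lemma Ck_on_differentiable: "Ck_on (Suc m) UNIV f \<Longrightarrow> f differentiable (at x)"
  by simp

lemma Ck_on_const: "Ck_on m UNIV (\<lambda>x. c)"
  by (induction m arbitrary: c) (auto simp: partial_const)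

lemma Ck_on_component: "Ck_on m UNIV (\<lambda>x::real^'n. x $ i)"
proof (cases m)
  case (Suc m')
  have "(\<lambda>x::real^'n. x $ i) differentiable (at x)" for x
    by (rule bounded_linear_imp_differentiable) (rule bounded_linear_vec_nth)
  with Suc show ?thesis by (simp add: partial_component Ck_on_const)
qed (auto intro: continuous_intros)

lemma Ck_on_add:
  fixes f g :: "real^'n \<Rightarrow> real"
  assumes "Ck_on m UNIV f" "Ck_on m UNIV g"
  shows "Ck_on m UNIV (\<lambda>x. f x + g x)"
  using assms
proof (induction m arbitrary: f g)
  case (Suc m)
  then have "partial a (\<lambda>x. f x + g x) = (\<lambda>x. partial a f x + partial a g x)" for a
    by (auto simp: partial_add)
  with Suc show ?case by (auto intro: differentiable_add)
qed (auto intro: continuous_intros)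

lemma Ck_on_mult:
  fixes f g :: "real^'n \<Rightarrow> real"
  assumes "Ck_on m UNIV f" "Ck_on m UNIV g"
  shows "Ck_on m UNIV (\<lambda>x. f x * g x)"
  using assms
proof (induction m arbitrary: f g)
  case (Suc m)
  then have *: "partial a (\<lambda>x. f x * g x) = (\<lambda>x. f x * partial a g x + partial a f x * g x)" for a
    by (auto simp: partial_mult)
  have "Ck_on m UNIV f" "Ck_on m UNIV g" using Suc.prems by (auto intro: Ck_on_Suc_imp)
  with Suc show ?case by (auto simp: * intro!: differentiable_mult Ck_on_add)
qed (auto intro: continuous_intros)

lemma Ck_on_sum:
  fixes f :: "'i \<Rightarrow> real^'n \<Rightarrow> real"
  assumes "\<And>i. i \<in> I \<Longrightarrow> Ck_on m UNIV (f i)"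
  shows "Ck_on m UNIV (\<lambda>x. \<Sum>i\<in>I. f i x)"
  using assms by (induction I rule: infinite_finite_induct) (auto intro: Ck_on_add Ck_on_const)

lemma Ck_on_prod:
  fixes f :: "'i \<Rightarrow> real^'n \<Rightarrow> real"
  assumes "\<And>i. i \<in> I \<Longrightarrow> Ck_on m UNIV (f i)"
  shows "Ck_on m UNIV (\<lambda>x. \<Prod>i\<in>I. f i x)"
  using assms by (induction I rule: infinite_finite_induct) (auto intro: Ck_on_mult Ck_on_const)

lemma Ck_on_compose:
  fixes g :: "real^'m \<Rightarrow> real" and F :: "real^'n \<Rightarrow> real^'m"
  assumes "Ck_on m UNIV g" "\<And>i. Ck_on m UNIV (\<lambda>x. F x $ i)"
  shows "Ck_on m UNIV (\<lambda>x. g (F x))"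
  using assms
proof (induction m arbitrary: g)
  case 0
  then have "continuous_on UNIV F" by (subst continuous_on_componentwise) (auto simp: Basis_vec_def inner_axis)
  with 0 show ?case using continuous_on_compose2[of UNIV g UNIV F] by auto
next
  case (Suc m)
  have *: "partial a (\<lambda>x. g (F x)) = (\<lambda>x. \<Sum>i\<in>UNIV. partial i g (F x) * partial a (\<lambda>x. F x $ i) x)" for a
    using Suc.prems by (intro ext partial_compose(2)) auto
  have F: "Ck_on m UNIV (\<lambda>x. F x $ i)" for i
    using Suc.prems(2) by (rule Ck_on_Suc_imp)
  have "Ck_on m UNIV (\<lambda>x. partial i g (F x))" for i
    by (rule Suc.IH[OF _ F]) (use Suc.prems(1) in simp)
  then have "Ck_on m UNIV (partial a (\<lambda>x. g (F x)))" for a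
    unfolding * by (rule Ck_on_sum[OF Ck_on_mult]) (use Suc.prems(2) in simp)
  then show ?case using Suc.prems by (auto intro: partial_compose(1))
qed

lemma Ck_on_polynomial:
  fixes h :: "real^'n \<Rightarrow> real"
  assumes "real_polynomial_function h"
  shows "Ck_on m UNIV h"
  using assms
proof (induction h rule: real_polynomial_function.induct)
  case (linear f)
  have fe: "f = (\<lambda>x. \<Sum>a\<in>UNIV. f (axis a 1) * x $ a)"
  proof
    fix x
    have lin: "linear f" using linear by (rule bounded_linear.linear)
    have "f x = f (\<Sum>a\<in>UNIV. x $ a *\<^sub>R axis a 1)"
      using basis_expansion[of x] by (simp add: scalar_mult_eq_scaleR)
    also have "\<dots> = (\<Sum>a\<in>UNIV. f (axis a 1) * x $ a)"
      by (simp add: linear_sum[OF lin] linear_scale[OF lin] o_def mult.commute)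
    finally show "f x = (\<Sum>a\<in>UNIV. f (axis a 1) * x $ a)" .
  qed
  have "Ck_on m UNIV (\<lambda>x. \<Sum>a\<in>UNIV. f (axis a 1) * x $ a)"
    by (rule Ck_on_sum) (rule Ck_on_mult[OF Ck_on_const Ck_on_component])
  with fe show ?case by metis
next
  case (const c)
  show ?case by (rule Ck_on_const)
next
  case (add f g)
  then show ?case by (intro Ck_on_add)
next
  case (mult f g)
  then show ?case by (intro Ck_on_mult)
qed

lemma smooth_on_differentiable: "smooth_on UNIV f \<Longrightarrow> f differentiable (at x)"
  unfolding smooth_on_def using Ck_on_differentiable by blast

lemma smooth_on_continuous: "smooth_on UNIV f \<Longrightarrow> continuous_on A f"
  unfolding smooth_on_def using continuous_on_subset[of UNIV f A] by (metis Ck_on.simps(1) top_greatest)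

lemma smooth_on_partial: "smooth_on UNIV f \<Longrightarrow> smooth_on UNIV (partial a f)"
  unfolding smooth_on_def using Ck_on.simps(2) by blast

lemma smooth_on_const: "smooth_on UNIV (\<lambda>x. c)"
  by (simp add: smooth_on_def Ck_on_const)

lemma smooth_on_component: "smooth_on UNIV (\<lambda>x::real^'n. x $ i)"
  by (simp add: smooth_on_def Ck_on_component)

lemma smooth_on_add:
  fixes f g :: "real^'n \<Rightarrow> real"
  shows "smooth_on UNIV f \<Longrightarrow> smooth_on UNIV g \<Longrightarrow> smooth_on UNIV (\<lambda>x. f x + g x)"
  by (simp add: smooth_on_def Ck_on_add)

lemma smooth_on_mult:
  fixes f g :: "real^'n \<Rightarrow> real"
  shows "smooth_on UNIV f \<Longrightarrow> smooth_on UNIV g \<Longrightarrow> smooth_on UNIV (\<lambda>x. f x * g x)"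
  by (simp add: smooth_on_def Ck_on_mult)

lemma smooth_on_diff:
  fixes f g :: "real^'n \<Rightarrow> real"
  assumes "smooth_on UNIV f" "smooth_on UNIV g"
  shows "smooth_on UNIV (\<lambda>x. f x - g x)"
  using smooth_on_add[OF assms(1) smooth_on_mult[OF smooth_on_const[of "-1"] assms(2)]] by simp

lemma smooth_on_sum:
  fixes f :: "'i \<Rightarrow> real^'n \<Rightarrow> real"
  shows "(\<And>i. i \<in> I \<Longrightarrow> smooth_on UNIV (f i)) \<Longrightarrow> smooth_on UNIV (\<lambda>x. \<Sum>i\<in>I. f i x)"
  by (simp add: smooth_on_def Ck_on_sum)

lemma smooth_on_prod:
  fixes f :: "'i \<Rightarrow> real^'n \<Rightarrow> real"
  shows "(\<And>i. i \<in> I \<Longrightarrow> smooth_on UNIV (f i)) \<Longrightarrow> smooth_on UNIV (\<lambda>x. \<Prod>i\<in>I. f i x)"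
  by (simp add: smooth_on_def Ck_on_prod)

lemma smooth_on_compose:
  fixes g :: "real^'m \<Rightarrow> real" and F :: "real^'n \<Rightarrow> real^'m"
  shows "smooth_on UNIV g \<Longrightarrow> (\<And>i. smooth_on UNIV (\<lambda>x. F x $ i)) \<Longrightarrow> smooth_on UNIV (\<lambda>x. g (F x))"
  by (simp add: smooth_on_def Ck_on_compose)

lemma smooth_on_vector:
  fixes F :: "real^'n \<Rightarrow> real^'m"
  assumes "\<And>i. smooth_on UNIV (\<lambda>x. F x $ i)"
  shows "smooth_on UNIV F"
proof -
  have "Ck_on m UNIV F" if "\<And>i. Ck_on m UNIV (\<lambda>x. F x $ i)" for m and F :: "real^'n \<Rightarrow> real^'m"
    using that
  proof (induction m arbitrary: F)
    case 0
    then have "continuous_on UNIV F" by (subst continuous_on_componentwise) (auto simp: Basis_vec_def inner_axis)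
    then show ?case by simp
  next
    case (Suc m)
    have d: "(F has_derivative (\<lambda>h. \<chi> i. \<Sum>a\<in>UNIV. h $ a * partial a (\<lambda>x. F x $ i) x)) (at x)" for x
      unfolding has_derivative_componentwise_within[of F]
      using has_derivative_partials[of "\<lambda>x. F x $ _" x] Suc.prems
      by (auto simp: Basis_vec_def inner_axis)
    have *: "partial a F x = (\<chi> i. partial a (\<lambda>x. F x $ i) x)" for a x
      using partial_has_derivative[OF d] by (simp add: sum_axis_mult)
    have "Ck_on m UNIV (partial a F)" for a
      using Suc.prems by (intro Suc.IH) (auto simp: *)
    then show ?case using d by (auto simp: differentiable_def)
  qed
  then show ?thesis using assms by (simp add: smooth_on_def)
qed

lemma has_real_derivative_along_line:
  fixes f :: "real^'n \<Rightarrow> real"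
  assumes "smooth_on UNIV f"
  shows "((\<lambda>s. f (y + s *\<^sub>R k)) has_real_derivative (\<Sum>a\<in>UNIV. k $ a * partial a f (y + s *\<^sub>R k))) (at s)"
proof -
  have "((\<lambda>s. y + s *\<^sub>R k) has_derivative (\<lambda>h. h *\<^sub>R k)) (at s)"
    by (auto intro!: derivative_eq_intros)
  note H = has_derivative_compose[OF this has_derivative_partials[OF smooth_on_differentiable[OF assms]]]
  have "(\<lambda>h. \<Sum>c\<in>UNIV. (h *\<^sub>R k) $ c * partial c f (y + s *\<^sub>R k))
      = (*) (\<Sum>a\<in>UNIV. k $ a * partial a f (y + s *\<^sub>R k))"
    by (simp add: fun_eq_iff mult.assoc sum_distrib_left[symmetric])
  then show ?thesis using H by (simp add: has_field_derivative_def)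
qed

text \<open>By the mean value theorem, applied twice, the second difference quotient with step \<open>h\<close> is a value of either mixed
  partial at a point within distance \<open>2 h\<close>. Let \<open>h\<close> tend to \<open>0\<close>.\<close>

lemma partial_commute:
  fixes f :: "real^'n \<Rightarrow> real"
  assumes "smooth_on UNIV f"
  shows "partial a (partial b f) x = partial b (partial a f) x"
proof (rule ccontr)
  have MV: "\<exists>p q. norm p < 2 * h \<and> h * h * partial b (partial a f) (x + p) =
      f (x + h *\<^sub>R axis a 1 + h *\<^sub>R axis b 1) - f (x + h *\<^sub>R axis a 1) - f (x + h *\<^sub>R axis b 1) + f x"
    if "h > 0" for h a b
  proof -
    let ?ea = "axis a (1::real) :: real^'n" and ?eb = "axis b (1::real) :: real^'n"
    have D: "((\<lambda>s. g (y + s *\<^sub>R axis c 1)) has_real_derivative partial c g (y + s *\<^sub>R axis c 1)) (at s)"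
      if "smooth_on UNIV g" for g :: "real^'n \<Rightarrow> real" and y s and c
      using has_real_derivative_along_line[OF that, of y "axis c 1" s] by (simp only: sum_axis_mult)
    define \<phi> where "\<phi> s = f ((x + h *\<^sub>R ?eb) + s *\<^sub>R ?ea) - f (x + s *\<^sub>R ?ea)" for s
    have "\<exists>\<xi>. 0 < \<xi> \<and> \<xi> < h \<and> \<phi> h - \<phi> 0 = (h - 0) * (partial a f ((x + h *\<^sub>R ?eb) + \<xi> *\<^sub>R ?ea) - partial a f (x + \<xi> *\<^sub>R ?ea))"
      unfolding \<phi>_def using \<open>h > 0\<close>
      by (intro MVT2) (auto intro!: derivative_eq_intros D assms)
    then obtain \<xi> where \<xi>: "0 < \<xi>" "\<xi> < h"
      "\<phi> h - \<phi> 0 = h * (partial a f ((x + h *\<^sub>R ?eb) + \<xi> *\<^sub>R ?ea) - partial a f (x + \<xi> *\<^sub>R ?ea))" by auto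
    have "\<exists>\<zeta>. 0 < \<zeta> \<and> \<zeta> < h \<and> partial a f ((x + \<xi> *\<^sub>R ?ea) + h *\<^sub>R ?eb) - partial a f ((x + \<xi> *\<^sub>R ?ea) + 0 *\<^sub>R ?eb)
        = (h - 0) * partial b (partial a f) ((x + \<xi> *\<^sub>R ?ea) + \<zeta> *\<^sub>R ?eb)"
      using \<open>h > 0\<close> by (intro MVT2) (auto intro!: D smooth_on_partial assms)
    then obtain \<zeta> where \<zeta>: "0 < \<zeta>" "\<zeta> < h"
      "partial a f (x + \<xi> *\<^sub>R ?ea + h *\<^sub>R ?eb) - partial a f (x + \<xi> *\<^sub>R ?ea)
        = h * partial b (partial a f) (x + (\<xi> *\<^sub>R ?ea + \<zeta> *\<^sub>R ?eb))" by (auto simp: add.assoc)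
    have "norm (\<xi> *\<^sub>R ?ea + \<zeta> *\<^sub>R ?eb) \<le> \<xi> + \<zeta>"
      by (rule order_trans[OF norm_triangle_ineq]) (use \<xi> \<zeta> in simp)
    also have "\<dots> < 2 * h" using \<xi> \<zeta> by simp
    finally have "norm (\<xi> *\<^sub>R ?ea + \<zeta> *\<^sub>R ?eb) < 2 * h" .
    moreover have "h * h * partial b (partial a f) (x + (\<xi> *\<^sub>R ?ea + \<zeta> *\<^sub>R ?eb)) = \<phi> h - \<phi> 0"
      using \<xi>(3) \<zeta>(3) by (simp add: algebra_simps)
    ultimately show ?thesis unfolding \<phi>_def by (intro exI[of _ "\<xi> *\<^sub>R ?ea + \<zeta> *\<^sub>R ?eb"]) (auto simp: algebra_simps)
  qed
  assume ne: "\<not> ?thesis"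
  define e where "e = \<bar>partial a (partial b f) x - partial b (partial a f) x\<bar> / 2"
  have "e > 0" using ne by (simp add: e_def)
  have "continuous (at x) (partial a (partial b f))" "continuous (at x) (partial b (partial a f))"
    using assms by (auto intro!: differentiable_imp_continuous_within smooth_on_differentiable smooth_on_partial)
  then obtain d1 d2 where d: "d1 > 0" "d2 > 0"
    "\<And>y. dist y x < d1 \<Longrightarrow> dist (partial a (partial b f) y) (partial a (partial b f) x) < e"
    "\<And>y. dist y x < d2 \<Longrightarrow> dist (partial b (partial a f) y) (partial b (partial a f) x) < e"
    using \<open>e > 0\<close> unfolding continuous_at_eps_delta by metis
  define h where "h = min d1 d2 / 2"
  have h: "h > 0" "2 * h \<le> d1" "2 * h \<le> d2" using d by (auto simp: h_def)
  obtain p where p: "norm p < 2 * h" "h * h * partial b (partial a f) (x + p) =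
      f (x + h *\<^sub>R axis a 1 + h *\<^sub>R axis b 1) - f (x + h *\<^sub>R axis a 1) - f (x + h *\<^sub>R axis b 1) + f x"
    using MV[OF h(1), of b a] by auto
  obtain q where q: "norm q < 2 * h" "h * h * partial a (partial b f) (x + q) =
      f (x + h *\<^sub>R axis b 1 + h *\<^sub>R axis a 1) - f (x + h *\<^sub>R axis b 1) - f (x + h *\<^sub>R axis a 1) + f x"
    using MV[OF h(1), of a b] by auto
  have "h * h * partial b (partial a f) (x + p) = h * h * partial a (partial b f) (x + q)"
  proof -
    have "x + h *\<^sub>R axis b 1 + h *\<^sub>R axis a 1 = x + h *\<^sub>R axis a 1 + h *\<^sub>R axis b 1"
      by (simp add: algebra_simps)
    from p(2) q(2)[unfolded this] show ?thesis by linarith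
  qed
  then have eq: "partial b (partial a f) (x + p) = partial a (partial b f) (x + q)" using h by simp
  have "dist (partial a (partial b f) (x + q)) (partial a (partial b f) x) < e"
       "dist (partial b (partial a f) (x + p)) (partial b (partial a f) x) < e"
    using d(3)[of "x+q"] d(4)[of "x+p"] p q h by (auto simp: dist_norm)
  then have "dist (partial a (partial b f) x) (partial b (partial a f) x) < e + e"
    using dist_triangle2[of "partial a (partial b f) x" "partial b (partial a f) x" "partial a (partial b f) (x + q)"]
    unfolding eq by (simp add: dist_commute)
  then show False unfolding e_def dist_real_def by (simp add: abs_minus_commute)
qed

section \<open>Cut-off functions\<close>

text \<open>The derivative is existentially quantified, so that a witness can be given in closed form in the closure
  properties.\<close>

primrec Ck_real :: "nat \<Rightarrow> (real \<Rightarrow> real) \<Rightarrow> bool"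
  where
    "Ck_real 0 f \<longleftrightarrow> continuous_on UNIV f"
  | "Ck_real (Suc m) f \<longleftrightarrow> (\<exists>f'. (\<forall>x. (f has_real_derivative f' x) (at x)) \<and> Ck_real m f')"

definition smooth_real :: "(real \<Rightarrow> real) \<Rightarrow> bool"
  where "smooth_real f \<longleftrightarrow> (\<forall>m. Ck_real m f)"

lemma Ck_real_Suc_imp: "Ck_real (Suc m) f \<Longrightarrow> Ck_real m f"
proof (induction m arbitrary: f)
  case 0
  then show ?case by (auto intro!: continuous_at_imp_continuous_on intro: DERIV_isCont)
next
  case (Suc m)
  then obtain f' where "\<forall>x. (f has_real_derivative f' x) (at x)" "Ck_real (Suc m) f'" by auto
  with Suc.IH[of f'] show ?case by auto
qed

lemma Ck_real_const: "Ck_real m (\<lambda>x. c)"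
  by (induction m arbitrary: c) (auto intro: exI[of _ "\<lambda>x. 0"])

lemma Ck_real_add: "Ck_real m f \<Longrightarrow> Ck_real m g \<Longrightarrow> Ck_real m (\<lambda>x. f x + g x)"
proof (induction m arbitrary: f g)
  case (Suc m)
  then obtain f' g' where "\<forall>x. (f has_real_derivative f' x) (at x)" "Ck_real m f'"
    "\<forall>x. (g has_real_derivative g' x) (at x)" "Ck_real m g'" by auto
  with Suc.IH[of f' g'] show ?case by (auto intro!: exI[of _ "\<lambda>x. f' x + g' x"] DERIV_add)
qed (auto intro: continuous_on_add)

lemma Ck_real_mult: "Ck_real m f \<Longrightarrow> Ck_real m g \<Longrightarrow> Ck_real m (\<lambda>x. f x * g x)"
proof (induction m arbitrary: f g)
  case (Suc m)
  then obtain f' g' where *: "\<forall>x. (f has_real_derivative f' x) (at x)" "Ck_real m f'"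
    "\<forall>x. (g has_real_derivative g' x) (at x)" "Ck_real m g'" by auto
  have "Ck_real m f" "Ck_real m g" using Suc.prems by (blast dest: Ck_real_Suc_imp)+
  then have "Ck_real m (\<lambda>x. f' x * g x + g' x * f x)"
    using * by (intro Ck_real_add Suc.IH) auto
  with * show ?case by (auto intro!: exI[of _ "\<lambda>x. f' x * g x + g' x * f x"] DERIV_mult)
qed (auto intro: continuous_on_mult)

lemma Ck_real_inverse: "Ck_real m f \<Longrightarrow> (\<And>x. f x \<noteq> 0) \<Longrightarrow> Ck_real m (\<lambda>x. inverse (f x))"
proof (induction m arbitrary: f)
  case (Suc m)
  then obtain f' where *: "\<forall>x. (f has_real_derivative f' x) (at x)" "Ck_real m f'" by auto
  have "Ck_real m f" using Suc.prems by (blast dest: Ck_real_Suc_imp)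
  then have i: "Ck_real m (\<lambda>x. inverse (f x))" using Suc by blast
  have "Ck_real m (\<lambda>x. (-1) * (inverse (f x) * f' x * inverse (f x)))"
    by (rule Ck_real_mult[OF Ck_real_const Ck_real_mult[OF Ck_real_mult[OF i *(2)] i]])
  moreover have "((\<lambda>x. inverse (f x)) has_real_derivative (-1) * (inverse (f x) * f' x * inverse (f x))) (at x)" for x
    using DERIV_inverse_fun[of f "f' x" x UNIV] * Suc.prems(2) by (simp add: power2_eq_square field_simps)
  ultimately show ?case by (auto intro!: exI[of _ "\<lambda>x. (-1) * (inverse (f x) * f' x * inverse (f x))"])
qed (auto intro: continuous_on_inverse)

lemma Ck_real_affine: "Ck_real m f \<Longrightarrow> Ck_real m (\<lambda>x. f (a * x + b))"
proof (induction m arbitrary: f)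
  case 0
  have "continuous_on UNIV (\<lambda>x. a * x + b)" by (intro continuous_intros)
  with 0 show ?case using continuous_on_compose2[of UNIV f UNIV "\<lambda>x. a * x + b"] by auto
next
  case (Suc m)
  then obtain f' where *: "\<forall>x. (f has_real_derivative f' x) (at x)" "Ck_real m f'" by auto
  have "((\<lambda>x. f (a * x + b)) has_real_derivative f' (a * x + b) * a) (at x)" for x
    by (rule DERIV_chain2[of f "f' (a * x + b)"]) (use * in \<open>auto intro!: derivative_eq_intros\<close>)
  moreover have "Ck_real m (\<lambda>x. f' (a * x + b) * a)"
    by (rule Ck_real_mult[OF Suc.IH[OF *(2)] Ck_real_const])
  ultimately show ?case by (auto intro!: exI[of _ "\<lambda>x. f' (a * x + b) * a"])
qed

lemma Ck_on_real_compose: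
  fixes f :: "real^'n \<Rightarrow> real"
  assumes "Ck_real m b" "Ck_on m UNIV f"
  shows "Ck_on m UNIV (\<lambda>x. b (f x))"
  using assms
proof (induction m arbitrary: b)
  case 0
  then show ?case using continuous_on_compose2[of UNIV b UNIV f] by auto
next
  case (Suc m)
  then obtain b' where b': "\<forall>x. (b has_real_derivative b' x) (at x)" "Ck_real m b'" by auto
  have d: "f differentiable (at x)" for x using Suc.prems(2) by simp
  have "partial a (\<lambda>x. b (f x)) = (\<lambda>x. b' (f x) * partial a f x)" for a
    using partial_real_compose[of b _ f] b' d by blast
  moreover have "Ck_on m UNIV (\<lambda>x. b' (f x))"
    by (rule Suc.IH[OF b'(2)]) (rule Ck_on_Suc_imp[OF Suc.prems(2)])
  ultimately have "Ck_on m UNIV (partial a (\<lambda>x. b (f x)))" for a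
    using Suc.prems(2) by (simp add: Ck_on_mult)
  moreover have "(\<lambda>x. b (f x)) differentiable (at x)" for x
    using has_derivative_compose[OF has_derivative_partials[OF d] b'(1)[rule_format, unfolded has_field_derivative_def]]
    by (auto simp: differentiable_def)
  ultimately show ?case by simp
qed

lemma smooth_on_real_compose:
  fixes f :: "real^'n \<Rightarrow> real"
  shows "smooth_real b \<Longrightarrow> smooth_on UNIV f \<Longrightarrow> smooth_on UNIV (\<lambda>x. b (f x))"
  by (simp add: smooth_on_def smooth_real_def Ck_on_real_compose)

lemma smooth_real_add: "smooth_real f \<Longrightarrow> smooth_real g \<Longrightarrow> smooth_real (\<lambda>x. f x + g x)"
  by (simp add: smooth_real_def Ck_real_add)

lemma smooth_real_mult: "smooth_real f \<Longrightarrow> smooth_real g \<Longrightarrow> smooth_real (\<lambda>x. f x * g x)"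
  by (simp add: smooth_real_def Ck_real_mult)

lemma smooth_real_inverse: "smooth_real f \<Longrightarrow> (\<And>x. f x \<noteq> 0) \<Longrightarrow> smooth_real (\<lambda>x. inverse (f x))"
  by (simp add: smooth_real_def Ck_real_inverse)

lemma smooth_real_affine: "smooth_real f \<Longrightarrow> smooth_real (\<lambda>x. f (a * x + b))"
  by (simp add: smooth_real_def Ck_real_affine)

text \<open>The polynomial is a parameter because the functions \<open>P(1/t) exp (- 1/t)\<close>, extended by \<open>0\<close>, form a class that is
  closed under differentiation.\<close>

definition flat_exp :: "real poly \<Rightarrow> real \<Rightarrow> real"
  where "flat_exp P t = (if t > 0 then poly P (1 / t) * exp (- (1 / t)) else 0)"

lemma flat_exp_tendsto_0: "(flat_exp P \<longlongrightarrow> 0) (at_right 0)"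
proof -
  have "((\<lambda>x. poly P x * exp (- x)) \<longlongrightarrow> 0) at_top"
  proof -
    have "((\<lambda>x::real. \<Sum>i\<le>degree P. coeff P i * (x ^ i / exp x)) \<longlongrightarrow> (\<Sum>i\<le>degree P. coeff P i * 0)) at_top"
      by (intro tendsto_intros tendsto_power_div_exp_0)
    moreover have "(\<lambda>x. poly P x * exp (- x)) = (\<lambda>x. \<Sum>i\<le>degree P. coeff P i * (x ^ i / exp x))"
      by (simp add: poly_altdef sum_distrib_right exp_minus divide_inverse mult.assoc)
    ultimately show ?thesis by simp
  qed
  from filterlim_compose[OF this filterlim_inverse_at_top_right]
  have "((\<lambda>t. poly P (inverse t) * exp (- inverse t)) \<longlongrightarrow> 0) (at_right 0)" .
  then show ?thesis
    by (rule Lim_transform_eventually)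
      (auto simp: eventually_at_right_less flat_exp_def inverse_eq_divide intro: eventually_mono[OF eventually_at_right_less])
qed

text \<open>At \<open>0\<close> the difference quotient is again a function of this class, with \<open>X P\<close> in place of \<open>P\<close>, and so it tends to
  \<open>0\<close>.\<close>

lemma flat_exp_deriv:
  "(flat_exp P has_real_derivative flat_exp ([:0, 0, 1:] * (P - pderiv P)) t) (at t)"
proof -
  consider "t < 0" | "t = 0" | "t > 0" by linarith
  then show ?thesis
  proof cases
    case 1
    have "((\<lambda>x. 0) has_real_derivative 0) (at t)" by simp
    moreover have "\<forall>\<^sub>F x in nhds t. flat_exp P x = 0"
      using eventually_nhds_in_open[of "{..<0}" t] 1
      by (auto simp: flat_exp_def elim!: eventually_mono)
    ultimately have "(flat_exp P has_real_derivative 0) (at t)"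
      by (subst DERIV_cong_ev[of t t "flat_exp P" "\<lambda>x. 0" 0 0]) auto
    with 1 show ?thesis by (simp add: flat_exp_def)
  next
    case 2
    have "((\<lambda>h. (flat_exp P (0 + h) - flat_exp P 0) / h) \<longlongrightarrow> 0) (at 0)"
    proof (rule filterlim_split_at)
      show "((\<lambda>h. (flat_exp P (0 + h) - flat_exp P 0) / h) \<longlongrightarrow> 0) (at_left 0)"
        by (rule Lim_transform_eventually[OF tendsto_const])
          (auto simp: eventually_at_filter flat_exp_def)
      show "((\<lambda>h. (flat_exp P (0 + h) - flat_exp P 0) / h) \<longlongrightarrow> 0) (at_right 0)"
        by (rule Lim_transform_eventually[OF flat_exp_tendsto_0[of "[:0, 1:] * P"]])
          (auto simp: flat_exp_def field_simps intro: eventually_mono[OF eventually_at_right_less])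
    qed
    then show ?thesis using 2 by (simp add: DERIV_def flat_exp_def)
  next
    case 3
    have "((\<lambda>x. poly P (1 / x) * exp (- (1 / x))) has_real_derivative
        flat_exp ([:0, 0, 1:] * (P - pderiv P)) t) (at t)"
      using 3 by (auto intro!: derivative_eq_intros DERIV_chain2[OF poly_DERIV]
          simp: flat_exp_def power2_eq_square field_simps)
    moreover have "\<forall>\<^sub>F x in nhds t. flat_exp P x = poly P (1 / x) * exp (- (1 / x))"
      using eventually_nhds_in_open[of "{0<..}" t] 3
      by (auto simp: flat_exp_def elim!: eventually_mono)
    ultimately show ?thesis
      by (subst DERIV_cong_ev[OF refl _ refl]) auto
  qed
qed

lemma smooth_flat_exp: "smooth_real (flat_exp P)"
proof -
  have "Ck_real m (flat_exp P)" for m P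
  proof (induction m arbitrary: P)
    case 0
    show ?case by (auto intro!: continuous_at_imp_continuous_on DERIV_isCont flat_exp_deriv)
  next
    case (Suc m)
    then show ?case using flat_exp_deriv by auto
  qed
  then show ?thesis by (simp add: smooth_real_def)
qed

text \<open>With \<open>e(t) = exp (- 1/t)\<close> for \<open>t > 0\<close> and \<open>e(t) = 0\<close> otherwise, take \<open>B(t) = e(1 + t) / (e(1 + t) + e(1 - t))\<close>. The
  denominator is positive since \<open>1 + t\<close> or \<open>1 - t\<close> is.\<close>

lemma smooth_step_exists:
  obtains B b :: "real \<Rightarrow> real" where
    "smooth_real B" "smooth_real b" "\<And>t. (B has_real_derivative b t) (at t)"
    "\<And>t. t \<le> -1 \<Longrightarrow> B t = 0" "\<And>t. 1 \<le> t \<Longrightarrow> B t = 1" "\<And>t. 0 \<le> B t"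
    "\<And>t. 1 \<le> \<bar>t\<bar> \<Longrightarrow> b t = 0" "\<And>t. 0 \<le> b t" "0 < b 0"
proof -
  define e where "e = flat_exp 1"
  define e' where "e' = flat_exp [:0, 0, 1:]"
  have de: "(e has_real_derivative e' t) (at t)" for t
    using flat_exp_deriv[of 1 t] by (simp add: e_def e'_def)
  have e0: "e t \<ge> 0" "e' t \<ge> 0" "t \<le> 0 \<Longrightarrow> e t = 0" "t \<le> 0 \<Longrightarrow> e' t = 0" for t
    by (auto simp: e_def e'_def flat_exp_def)
  have e1: "t > 0 \<Longrightarrow> e t > 0" "t > 0 \<Longrightarrow> e' t > 0" for t
    by (auto simp: e_def e'_def flat_exp_def)
  define M where "M t = e (1 + t) + e (1 - t)" for t
  have M: "M t > 0" for t
  proof (cases "t > -1")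
    case True then show ?thesis using e1(1)[of "1 + t"] e0(1)[of "1 - t"] by (simp add: M_def)
  next
    case False then show ?thesis using e1(1)[of "1 - t"] e0(1)[of "1 + t"] by (simp add: M_def)
  qed
  define B where "B t = e (1 + t) * inverse (M t)" for t
  define b where "b t = (e' (1 + t) * e (1 - t) + e (1 + t) * e' (1 - t)) * (inverse (M t) * inverse (M t))" for t
  have s: "smooth_real e" "smooth_real e'" by (simp_all add: e_def e'_def smooth_flat_exp)
  have s2: "smooth_real (\<lambda>t. f (1 + t))" "smooth_real (\<lambda>t. f (1 - t))" if "smooth_real f" for f
    using smooth_real_affine[OF that, of 1 1] smooth_real_affine[OF that, of "-1" 1] by (simp_all add: add.commute)
  have sM: "smooth_real (\<lambda>t. inverse (M t))"
    by (rule smooth_real_inverse) (use M s s2 in \<open>auto simp: M_def less_le intro!: smooth_real_add\<close>)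
  have "smooth_real B" unfolding B_def[abs_def] by (intro smooth_real_mult s2 s sM)
  moreover have "smooth_real b" unfolding b_def[abs_def]
    by (intro smooth_real_mult smooth_real_add s2 s sM)
  moreover have "(B has_real_derivative b t) (at t)" for t
  proof -
    have 1: "((\<lambda>t. e (1 + t)) has_real_derivative e' (1 + t)) (at t)"
      using DERIV_chain2[OF de, where g = "\<lambda>t. 1 + t" and x = t, OF DERIV_add[OF DERIV_const DERIV_ident]] by simp
    have 2: "((\<lambda>t. e (1 - t)) has_real_derivative - e' (1 - t)) (at t)"
      using DERIV_chain2[OF de, where g = "\<lambda>t. 1 - t" and x = t, OF DERIV_diff[OF DERIV_const DERIV_ident]] by simp
    have M0: "M t \<noteq> 0" using M[of t] by simp
    have "((\<lambda>t. e (1 + t) / M t) has_real_derivative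
        (e' (1 + t) * M t - e (1 + t) * (e' (1 + t) + - e' (1 - t))) / (M t * M t)) (at t)"
    proof (rule DERIV_divide)
      show "(M has_real_derivative e' (1 + t) + - e' (1 - t)) (at t)"
        unfolding M_def[abs_def] by (rule DERIV_add[OF 1 2])
    qed (use 1 M0 in auto)
    moreover have "(e' (1 + t) * M t - e (1 + t) * (e' (1 + t) + - e' (1 - t))) / (M t * M t) = b t"
      using M0 by (simp add: b_def divide_inverse) (simp add: M_def algebra_simps)
    ultimately show ?thesis by (simp add: B_def[abs_def] divide_inverse)
  qed
  moreover have "t \<le> -1 \<Longrightarrow> B t = 0" for t by (simp add: B_def e0)
  moreover have "1 \<le> t \<Longrightarrow> B t = 1" for t
    using M[of t] e0(3)[of "1 - t"] by (simp add: B_def M_def)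
  moreover have "0 \<le> B t" for t using M[of t] e0 by (simp add: B_def)
  moreover have "1 \<le> \<bar>t\<bar> \<Longrightarrow> b t = 0" for t
    using e0(3,4)[of "1 - t"] e0(3,4)[of "1 + t"] by (cases "t \<ge> 0") (auto simp: b_def)
  moreover have "0 \<le> b t" for t using M[of t] e0 by (simp add: b_def)
  moreover have "0 < b 0" using M[of 0] e1[of 1] by (simp add: b_def)
  ultimately show ?thesis using that by blast
qed

text \<open>The product of a rising and a falling step.\<close>

lemma smooth_plateau_exists:
  obtains P p :: "real \<Rightarrow> real" where
    "smooth_real P" "\<And>t. (P has_real_derivative p t) (at t)"
    "\<And>t. \<bar>t\<bar> \<le> 2 \<Longrightarrow> P t = 1" "\<And>t. 4 \<le> \<bar>t\<bar> \<Longrightarrow> P t = 0" "\<And>t. 0 \<le> P t"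
    "\<And>t. \<bar>t\<bar> \<le> 2 \<Longrightarrow> p t = 0" "\<And>t. 4 \<le> \<bar>t\<bar> \<Longrightarrow> p t = 0"
proof -
  obtain B b where B: "smooth_real B" "\<And>t. (B has_real_derivative b t) (at t)"
    "\<And>t. t \<le> -1 \<Longrightarrow> B t = 0" "\<And>t. 1 \<le> t \<Longrightarrow> B t = 1" "\<And>t. 0 \<le> B t"
    "\<And>t. 1 \<le> \<bar>t\<bar> \<Longrightarrow> b t = 0"
    by (rule smooth_step_exists) blast
  define P where "P t = B (1 * t + 3) * B ((-1) * t + 3)" for t
  define p where "p t = b (t + 3) * B (3 - t) - b (3 - t) * B (t + 3)" for t
  have "smooth_real P" unfolding P_def[abs_def] by (intro smooth_real_mult smooth_real_affine B)
  moreover have "(P has_real_derivative p t) (at t)" for t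
  proof -
    have 1: "((\<lambda>t. B (t + 3)) has_real_derivative b (t + 3)) (at t)"
      using DERIV_chain2[OF B(2), where g = "\<lambda>t. t + 3" and x = t, OF DERIV_add[OF DERIV_ident DERIV_const]] by simp
    have 2: "((\<lambda>t. B (3 - t)) has_real_derivative - b (3 - t)) (at t)"
      using DERIV_chain2[OF B(2), where g = "\<lambda>t. 3 - t" and x = t, OF DERIV_diff[OF DERIV_const DERIV_ident]] by simp
    show ?thesis using DERIV_mult[OF 1 2] by (simp add: P_def[abs_def] p_def)
  qed
  moreover have "\<bar>t\<bar> \<le> 2 \<Longrightarrow> P t = 1" "4 \<le> \<bar>t\<bar> \<Longrightarrow> P t = 0" "0 \<le> P t" for t
    using B(3)[of "t+3"] B(3)[of "3-t"] B(4)[of "t+3"] B(4)[of "3-t"] B(5) by (auto simp: P_def abs_if split: if_splits)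
  moreover have "\<bar>t\<bar> \<le> 2 \<Longrightarrow> p t = 0" for t
    using B(6)[of "t+3"] B(6)[of "3-t"] by (auto simp: p_def)
  moreover have "4 \<le> \<bar>t\<bar> \<Longrightarrow> p t = 0" for t
    using B(6)[of "t+3"] B(6)[of "3-t"] by (auto simp: p_def)
  ultimately show ?thesis using that by blast
qed

section \<open>Integration of compactly supported functions\<close>

definition zero_beyond :: "real \<Rightarrow> ('a::real_normed_vector \<Rightarrow> 'b::zero) \<Rightarrow> bool"
  where "zero_beyond R f \<longleftrightarrow> (\<forall>x. R < norm x \<longrightarrow> f x = 0)"

lemma zero_beyondD: "zero_beyond R f \<Longrightarrow> R < norm x \<Longrightarrow> f x = 0"
  by (simp add: zero_beyond_def)

lemma integrable_continuous_bounded_support: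
  fixes f :: "'a::euclidean_space \<Rightarrow> 'b::euclidean_space"
  assumes "continuous_on UNIV f" "zero_beyond R f"
  shows "integrable lborel f"
proof -
  have "integrable lborel (\<lambda>x. indicator (cball 0 R) x *\<^sub>R f x)"
    by (rule borel_integrable_compact) (auto intro: continuous_on_subset[OF assms(1)])
  moreover have "(\<lambda>x. indicator (cball 0 R) x *\<^sub>R f x) = f"
    using assms(2) by (auto simp: zero_beyond_def indicator_def fun_eq_iff not_le)
  ultimately show ?thesis by simp
qed

lemma bounded_continuous_bounded_support:
  fixes f :: "'a::euclidean_space \<Rightarrow> real"
  assumes "continuous_on UNIV f" "zero_beyond R f"
  obtains C where "C > 0" "\<And>x. \<bar>f x\<bar> \<le> C"
proof -
  have "bounded (f ` cball 0 R)"
    by (intro compact_imp_bounded compact_continuous_image continuous_on_subset[OF assms(1)]) auto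
  then obtain C where C: "C > 0" "\<And>x. x \<in> cball 0 R \<Longrightarrow> \<bar>f x\<bar> \<le> C"
    unfolding bounded_pos by auto
  have "\<bar>f x\<bar> \<le> C" for x
    using C zero_beyondD[OF assms(2), of x] by (cases "norm x \<le> R") auto
  with C(1) show ?thesis using that by blast
qed

lemma uniformly_continuous_bounded_support:
  fixes f :: "'a::euclidean_space \<Rightarrow> real"
  assumes "continuous_on UNIV f" "zero_beyond R f" "e > 0"
  obtains d where "d > 0" "\<And>x y. dist x y < d \<Longrightarrow> \<bar>f x - f y\<bar> < e"
proof -
  have "uniformly_continuous_on (cball 0 (R + 2)) f"
    by (intro compact_uniformly_continuous continuous_on_subset[OF assms(1)]) auto
  with \<open>e > 0\<close> obtain d where d: "d > 0"
    "\<And>x y. x \<in> cball 0 (R + 2) \<Longrightarrow> y \<in> cball 0 (R + 2) \<Longrightarrow> dist x y < d \<Longrightarrow> dist (f x) (f y) < e"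
    unfolding uniformly_continuous_on_def by (metis dist_commute)
  have "\<bar>f x - f y\<bar> < e" if "dist x y < min d 1" for x y
  proof (cases "norm x \<le> R + 1 \<or> norm y \<le> R + 1")
    case True
    have "norm x \<le> norm y + dist x y" "norm y \<le> norm x + dist x y"
      using norm_triangle_sub[of x y] norm_triangle_sub[of y x] by (auto simp: dist_norm norm_minus_commute)
    with True that have "x \<in> cball 0 (R + 2)" "y \<in> cball 0 (R + 2)" by auto
    with d(2)[of x y] that show ?thesis by (auto simp: dist_real_def)
  next
    case False
    with assms show ?thesis by (auto simp: zero_beyond_def)
  qed
  with d(1) show ?thesis using that[of "min d 1"] by auto
qed

lemma integral_pos_of_continuous:
  fixes f :: "'a::euclidean_space \<Rightarrow> real"
  assumes "continuous_on UNIV f" "zero_beyond R f" "\<And>x. 0 \<le> f x" "0 < f a"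
  shows "0 < integral\<^sup>L lborel f"
proof (rule ccontr)
  have int: "integrable lborel f"
    using assms(1,2) by (rule integrable_continuous_bounded_support)
  assume "\<not> ?thesis"
  moreover have "0 \<le> integral\<^sup>L lborel f" using assms(3) by simp
  ultimately have "integral\<^sup>L lborel f = 0" by simp
  then have "AE x in lborel. f x = 0"
    using integral_nonneg_eq_0_iff_AE[OF int] assms(3) by simp
  moreover have "open {x. f x > 0}" using assms(1) by (intro open_Collect_less continuous_intros) auto
  ultimately have "{x. f x > 0} \<in> null_sets lborel"
    by (subst AE_iff_null_sets) (auto elim!: eventually_mono)
  then have "{x. f x > 0} = {}"
    using \<open>open {x. f x > 0}\<close> open_not_negligible negligible_iff_null_sets null_sets_completionI by blast
  with assms(4) show False by auto
qed

lemma zero_beyond_partial: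
  fixes f :: "real^'n \<Rightarrow> real"
  assumes "zero_beyond R f"
  shows "zero_beyond R (partial a f)"
  unfolding zero_beyond_def
proof (intro allI impI)
  fix x :: "real^'n" assume x: "R < norm x"
  have "open {x :: real^'n. R < norm x}" by (intro open_Collect_less continuous_intros)
  then have "(f has_derivative (\<lambda>h. 0)) (at x)"
    using x assms by (intro has_derivative_transform_within_open[OF has_derivative_const[of 0]])
      (auto simp: zero_beyond_def)
  from partial_has_derivative[OF this] show "partial a f x = 0" .
qed

text \<open>By translation invariance every difference quotient has integral \<open>0\<close>; the quotients are bounded by the mean value
  theorem and live on a common ball, so that dominated convergence applies.\<close>

lemma integral_partial_eq_0:
  fixes f :: "real^'n \<Rightarrow> real"
  assumes f: "smooth_on UNIV f" and R: "zero_beyond R f"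
  shows "(\<integral>x. partial a f x \<partial>lborel) = 0"
proof -
  let ?e = "axis a (1::real) :: real^'n"
  note zero = zero_beyond_partial[OF R]
  have cp: "continuous_on UNIV (partial a f)" by (intro smooth_on_continuous smooth_on_partial f)
  obtain C where C: "C > 0" "\<And>x. \<bar>partial a f x\<bar> \<le> C"
    using bounded_continuous_bounded_support[OF cp zero] by blast
  have D: "((\<lambda>s. f (y + s *\<^sub>R ?e)) has_real_derivative partial a f (y + s *\<^sub>R ?e)) (at s)" for y s
    using has_real_derivative_along_line[OF f, of y ?e s] by (simp only: sum_axis_mult)
  define h where "h j = inverse (real (Suc j))" for j
  have h: "h j > 0" "h j \<le> 1" for j by (auto simp: h_def field_simps)
  have hlim: "h \<longlonglongrightarrow> 0" unfolding h_def by (rule LIMSEQ_inverse_real_of_nat)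
  define g where "g j x = (f (x + h j *\<^sub>R ?e) - f x) / h j" for j x
  have fint: "integrable lborel f"
    by (rule integrable_continuous_bounded_support[OF smooth_on_continuous[OF f] R])
  have shift: "integrable lborel (\<lambda>x. f (x + v))" "(\<integral>x. f (x + v) \<partial>lborel) = integral\<^sup>L lborel f" for v
  proof -
    have fm: "f \<in> borel_measurable borel" using smooth_on_continuous[OF f] by (rule borel_measurable_continuous_onI)
    show "(\<integral>x. f (x + v) \<partial>lborel) = integral\<^sup>L lborel f"
      using integral_distr[of "(+) v" lborel borel f] fm by (simp add: lborel_distr_plus add.commute)
    show "integrable lborel (\<lambda>x. f (x + v))"
      using integrable_distr_eq[of "(+) v" lborel borel f] fm fint by (simp add: lborel_distr_plus add.commute)
  qed
  have g0: "integral\<^sup>L lborel (g j) = 0" for j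
    unfolding g_def by (simp add: shift fint)
  have glim: "(\<lambda>j. g j x) \<longlonglongrightarrow> partial a f x" for x
  proof -
    have "((\<lambda>t. (f (x + t *\<^sub>R ?e) - f x) / t) \<longlongrightarrow> partial a f x) (at 0)"
      using D[of x 0] by (simp add: DERIV_def)
    moreover have "filterlim h (at 0) sequentially"
      using hlim h by (intro filterlim_atI) (auto simp: less_imp_neq[symmetric])
    ultimately show ?thesis unfolding g_def by (rule filterlim_compose)
  qed
  have gb: "norm (g j x) \<le> C * indicator (cball 0 (R + 1)) x" for j x
  proof (cases "norm x \<le> R + 1")
    case True
    have "\<exists>z. 0 < z \<and> z < h j \<and> f (x + h j *\<^sub>R ?e) - f (x + 0 *\<^sub>R ?e) = (h j - 0) * partial a f (x + z *\<^sub>R ?e)"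
      by (rule MVT2) (use h D in auto)
    then obtain z where "g j x = partial a f (x + z *\<^sub>R ?e)" using h[of j] by (auto simp: g_def)
    then show ?thesis using C(2) True by simp
  next
    case False
    have "norm x \<le> norm (x + h j *\<^sub>R ?e) + h j"
      using norm_triangle_ineq4[of "x + h j *\<^sub>R ?e" "h j *\<^sub>R ?e"] h[of j] by simp
    then have "R < norm (x + h j *\<^sub>R ?e)" "R < norm x" using False h[of j] by linarith+
    then show ?thesis using R False by (simp add: g_def zero_beyond_def)
  qed
  have "(\<lambda>j. integral\<^sup>L lborel (g j)) \<longlonglongrightarrow> (\<integral>x. partial a f x \<partial>lborel)"
  proof (rule integral_dominated_convergence[where w = "\<lambda>x. C * indicator (cball 0 (R + 1)) x"])
    show "partial a f \<in> borel_measurable lborel" using cp by (simp add: borel_measurable_continuous_onI)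
    show "g j \<in> borel_measurable lborel" for j
      unfolding g_def using shift(1)[of "h j *\<^sub>R ?e"] fint by auto
    show "integrable lborel (\<lambda>x::real^'n. C * indicator (cball 0 (R + 1)) x)"
      by (intro integrable_mult_right integrable_real_indicator) (use emeasure_bounded_finite[OF bounded_cball, of "0::real^'n" "R + 1"] in auto)
  qed (use glim gb in auto)
  with g0 show ?thesis by (simp add: LIMSEQ_const_iff)
qed

section \<open>Convolution with a smooth kernel\<close>

text \<open>The dilation allows to smooth a function that is only given on the unit ball: for \<open>c < 1\<close> and a kernel that vanishes
  outside of the ball of radius \<open>1 - c\<close>, only values in the unit ball contribute as long as \<open>x\<close> is in it.\<close>

definition dconv :: "(real^'n \<Rightarrow> real) \<Rightarrow> real \<Rightarrow> (real^'n \<Rightarrow> real) \<Rightarrow> real^'n \<Rightarrow> real"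
  where "dconv \<kappa> c v x = (\<integral>y. \<kappa> (y - c *\<^sub>R x) * v y \<partial>lborel)"

lemma integrable_dconv:
  fixes \<kappa> v :: "real^'n \<Rightarrow> real"
  assumes \<kappa>: "continuous_on UNIV \<kappa>" "zero_beyond R \<kappa>" and v: "integrable lborel v"
  shows "integrable lborel (\<lambda>y. \<kappa> (y - z) * v y)"
proof -
  obtain C where C: "C > 0" "\<And>x. \<bar>\<kappa> x\<bar> \<le> C" using bounded_continuous_bounded_support[OF \<kappa>] by blast
  have [measurable]: "\<kappa> \<in> borel_measurable borel" using \<kappa>(1) by (rule borel_measurable_continuous_onI)
  have [measurable]: "v \<in> borel_measurable borel" using v by auto
  show ?thesis
    by (rule Bochner_Integration.integrable_bound[OF integrable_mult_right[OF v, of C]])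
      (use C in \<open>auto simp: abs_mult intro!: mult_right_mono\<close>)
qed

text \<open>The partial derivatives are uniformly continuous, so that the first-order remainder is small uniformly in \<open>w\<close>. This is
  what makes differentiation under the integral sign work for a merely integrable \<open>v\<close>.\<close>

lemma smooth_uniform_linearization:
  fixes \<kappa> :: "real^'n \<Rightarrow> real"
  assumes \<kappa>: "smooth_on UNIV \<kappa>" "zero_beyond R \<kappa>" and "e > 0"
  obtains d where "d > 0"
    "\<And>w k. norm k < d \<Longrightarrow> \<bar>\<kappa> (w + k) - \<kappa> w - (\<Sum>a\<in>UNIV. k $ a * partial a \<kappa> w)\<bar> \<le> e * norm k"
proof -
  let ?e = "e / real CARD('n)"
  have "?e > 0" using \<open>e > 0\<close> by simp
  have "\<exists>d>0. \<forall>x y. dist x y < d \<longrightarrow> \<bar>partial a \<kappa> x - partial a \<kappa> y\<bar> < ?e" for a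
    using uniformly_continuous_bounded_support[OF smooth_on_continuous[OF smooth_on_partial[OF \<kappa>(1)]]
        zero_beyond_partial[OF \<kappa>(2)] \<open>?e > 0\<close>] by metis
  then obtain D where D: "\<And>a. D a > 0" "\<And>a x y. dist x y < D a \<Longrightarrow> \<bar>partial a \<kappa> x - partial a \<kappa> y\<bar> < ?e"
    by metis
  define d where "d = Min (range D)"
  have "d > 0" "\<And>a. d \<le> D a" using D by (auto simp: d_def)
  have "\<bar>\<kappa> (w + k) - \<kappa> w - (\<Sum>a\<in>UNIV. k $ a * partial a \<kappa> w)\<bar> \<le> e * norm k" if k: "norm k < d" for w k
  proof -
    have "((\<lambda>s. \<kappa> (w + s *\<^sub>R k)) has_real_derivative (\<Sum>a\<in>UNIV. k $ a * partial a \<kappa> (w + s *\<^sub>R k))) (at s)" for s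
      by (rule has_real_derivative_along_line[OF \<kappa>(1)])
    then have "\<exists>z. 0 < z \<and> z < 1 \<and> \<kappa> (w + 1 *\<^sub>R k) - \<kappa> (w + 0 *\<^sub>R k)
        = (1 - 0) * (\<Sum>a\<in>UNIV. k $ a * partial a \<kappa> (w + z *\<^sub>R k))"
      by (intro MVT2) auto
    then obtain z where z: "0 < z" "z < 1" "\<kappa> (w + k) - \<kappa> w = (\<Sum>a\<in>UNIV. k $ a * partial a \<kappa> (w + z *\<^sub>R k))"
      by auto
    have "\<bar>\<kappa> (w + k) - \<kappa> w - (\<Sum>a\<in>UNIV. k $ a * partial a \<kappa> w)\<bar>
        = \<bar>\<Sum>a\<in>UNIV. k $ a * (partial a \<kappa> (w + z *\<^sub>R k) - partial a \<kappa> w)\<bar>"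
      by (simp add: z(3) sum_subtractf right_diff_distrib)
    also have "\<dots> \<le> (\<Sum>a\<in>UNIV. \<bar>k $ a\<bar> * \<bar>partial a \<kappa> (w + z *\<^sub>R k) - partial a \<kappa> w\<bar>)"
      by (rule order_trans[OF sum_abs]) (simp add: abs_mult)
    also have "\<dots> \<le> (\<Sum>a\<in>(UNIV::'n set). norm k * ?e)"
    proof (intro sum_mono mult_mono)
      fix a
      have "dist (w + z *\<^sub>R k) w = z * norm k" using z by (simp add: dist_norm)
      also have "\<dots> \<le> norm k" using z by (simp add: mult_left_le_one_le)
      also have "\<dots> < D a" using k \<open>d \<le> D a\<close> by linarith
      finally show "\<bar>partial a \<kappa> (w + z *\<^sub>R k) - partial a \<kappa> w\<bar> \<le> ?e" using D(2) by (simp add: less_imp_le)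
    qed (auto simp: component_le_norm_cart)
    also have "\<dots> = e * norm k" by simp
    finally show ?thesis .
  qed
  with \<open>d > 0\<close> show ?thesis using that by blast
qed

lemma dconv_has_derivative:
  fixes \<kappa> :: "real^'n \<Rightarrow> real"
  assumes \<kappa>: "smooth_on UNIV \<kappa>" "zero_beyond R \<kappa>" and v: "integrable lborel v"
  shows "(dconv \<kappa> c v has_derivative (\<lambda>h. \<Sum>a\<in>UNIV. h $ a * (- c * dconv (partial a \<kappa>) c v x))) (at x)"
    (is "(_ has_derivative ?D) _")
  unfolding has_derivative_at_alt
proof (intro conjI allI impI)
  show "bounded_linear ?D"
    by (intro bounded_linear_sum bounded_linear_mult_const bounded_linear_vec_nth)
  fix e :: real assume "e > 0"
  define V where "V = (\<integral>y. \<bar>v y\<bar> \<partial>lborel)"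
  have "V \<ge> 0" by (simp add: V_def)
  define e' where "e' = e / ((\<bar>c\<bar> + 1) * (V + 1))"
  have "e' > 0" using \<open>e > 0\<close> \<open>V \<ge> 0\<close> by (simp add: e'_def)
  from smooth_uniform_linearization[OF \<kappa> this] obtain d where d: "d > 0"
    "\<And>w k. norm k < d \<Longrightarrow> \<bar>\<kappa> (w + k) - \<kappa> w - (\<Sum>a\<in>UNIV. k $ a * partial a \<kappa> w)\<bar> \<le> e' * norm k" by metis
  have c\<kappa>: "continuous_on UNIV \<kappa>" "\<And>a. continuous_on UNIV (partial a \<kappa>)"
    using \<kappa>(1) by (auto intro: smooth_on_continuous smooth_on_partial)
  note zero = zero_beyond_partial[OF \<kappa>(2)]
  have i0: "integrable lborel (\<lambda>w. \<kappa> (w - z) * v w)" for z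
    by (rule integrable_dconv[OF c\<kappa>(1) \<kappa>(2) v])
  have i1: "integrable lborel (\<lambda>w. partial a \<kappa> (w - z) * v w)" for z a
    by (rule integrable_dconv[OF c\<kappa>(2) zero v])
  show "\<exists>d>0. \<forall>y. norm (y - x) < d \<longrightarrow>
      norm (dconv \<kappa> c v y - dconv \<kappa> c v x - ?D (y - x)) \<le> e * norm (y - x)"
  proof (intro exI[of _ "d / (\<bar>c\<bar> + 1)"] conjI allI impI)
    show "0 < d / (\<bar>c\<bar> + 1)" using d(1) by simp
    fix y assume y: "norm (y - x) < d / (\<bar>c\<bar> + 1)"
    define k where "k = (- c) *\<^sub>R (y - x)"
    have nk: "norm k \<le> (\<bar>c\<bar> + 1) * norm (y - x)" by (simp add: k_def mult_right_mono)
    also have "\<dots> < d" using y by (simp add: field_simps)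
    finally have kd: "norm k < d" .
    define E where "E w = (\<kappa> ((w - c *\<^sub>R x) + k) - \<kappa> (w - c *\<^sub>R x)
        - (\<Sum>a\<in>UNIV. k $ a * partial a \<kappa> (w - c *\<^sub>R x))) * v w" for w
    have shift: "(w - c *\<^sub>R x) + k = w - c *\<^sub>R y" for w
      by (simp add: k_def algebra_simps)
    have E: "E w = \<kappa> (w - c *\<^sub>R y) * v w - \<kappa> (w - c *\<^sub>R x) * v w
        - (\<Sum>a\<in>UNIV. k $ a * (partial a \<kappa> (w - c *\<^sub>R x) * v w))" for w
      unfolding E_def shift by (simp add: left_diff_distrib sum_distrib_right mult.assoc)
    have Eint: "integrable lborel E"
      unfolding E by (intro Bochner_Integration.integrable_diff Bochner_Integration.integrable_sum integrable_mult_right i0 i1)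
    have "dconv \<kappa> c v y - dconv \<kappa> c v x - ?D (y - x) = integral\<^sup>L lborel E"
      unfolding E dconv_def
      by (subst Bochner_Integration.integral_diff Bochner_Integration.integral_sum;
          (intro Bochner_Integration.integrable_diff Bochner_Integration.integrable_sum integrable_mult_right i0 i1)?)+
        (simp add: k_def mult.assoc mult.left_commute)
    also have "norm \<dots> \<le> (\<integral>w. (e' * norm k) * \<bar>v w\<bar> \<partial>lborel)"
    proof (rule Bochner_Integration.integral_norm_bound_integral[OF Eint])
      show "integrable lborel (\<lambda>w. (e' * norm k) * \<bar>v w\<bar>)" using v by simp
      show "norm (E w) \<le> e' * norm k * \<bar>v w\<bar>" for w
        unfolding E_def real_norm_def abs_mult by (intro mult_right_mono d(2) kd) simp
    qed
    also have "\<dots> = e' * norm k * V" by (simp add: V_def)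
    also have "\<dots> \<le> e' * ((\<bar>c\<bar> + 1) * norm (y - x)) * (V + 1)"
      using nk \<open>e' > 0\<close> \<open>V \<ge> 0\<close> by (intro mult_mono) auto
    also have "\<dots> = (e' * ((\<bar>c\<bar> + 1) * (V + 1))) * norm (y - x)" by (simp only: ac_simps)
    also have "e' * ((\<bar>c\<bar> + 1) * (V + 1)) = e" using \<open>V \<ge> 0\<close> by (simp add: e'_def)
    finally show "norm (dconv \<kappa> c v y - dconv \<kappa> c v x - ?D (y - x)) \<le> e * norm (y - x)" .
  qed
qed

lemma partial_dconv:
  fixes \<kappa> :: "real^'n \<Rightarrow> real"
  assumes "smooth_on UNIV \<kappa>" "zero_beyond R \<kappa>" "integrable lborel v"
  shows "partial a (dconv \<kappa> c v) x = - c * dconv (partial a \<kappa>) c v x"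
  using partial_has_derivative[OF dconv_has_derivative[OF assms]] by (simp only: sum_axis_mult)

text \<open>Every derivative of the convolution is, up to a constant, a convolution with a derivative of the kernel.\<close>

lemma smooth_dconv:
  fixes \<kappa> :: "real^'n \<Rightarrow> real"
  assumes "smooth_on UNIV \<kappa>" "zero_beyond R \<kappa>" and v: "integrable lborel v"
  shows "smooth_on UNIV (dconv \<kappa> c v)"
proof -
  have "Ck_on m UNIV (dconv \<kappa> c v)" for m
    using assms(1,2)
  proof (induction m arbitrary: \<kappa>)
    case 0
    then show ?case
      by (auto intro!: continuous_at_imp_continuous_on has_derivative_continuous dconv_has_derivative v)
  next
    case (Suc m)
    have "partial a (dconv \<kappa> c v) = (\<lambda>x. - c * dconv (partial a \<kappa>) c v x)" for a
      using partial_dconv[OF Suc.prems v] by blast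
    moreover have "Ck_on m UNIV (dconv (partial a \<kappa>) c v)" for a
      by (rule Suc.IH[OF smooth_on_partial[OF Suc.prems(1)] zero_beyond_partial[OF Suc.prems(2)]])
    ultimately have "Ck_on m UNIV (partial a (dconv \<kappa> c v))" for a
      by (metis Ck_on_mult[OF Ck_on_const])
    moreover have "dconv \<kappa> c v differentiable (at x)" for x
      using dconv_has_derivative[OF Suc.prems v] unfolding differentiable_def by blast
    ultimately show ?case by simp
  qed
  then show ?thesis by (simp add: smooth_on_def)
qed

section \<open>Jacobian minors as null Lagrangians\<close>

text \<open>The determinant of the leading \<open>k \<times> k\<close> block. The size is a number and not a type, hence a matrix is a
  function of two indices.\<close>

definition minor :: "nat \<Rightarrow> (nat \<Rightarrow> nat \<Rightarrow> real) \<Rightarrow> real"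
  where "minor k A = (\<Sum>\<pi> | \<pi> permutes {..<k}. of_int (sign \<pi>) * (\<Prod>j<k. A j (\<pi> j)))"

lemma minor_cong:
  assumes "\<And>j a. j < k \<Longrightarrow> a < k \<Longrightarrow> A j a = B j a"
  shows "minor k A = minor k B"
  unfolding minor_def
proof (rule sum.cong[OF refl])
  fix \<pi> assume "\<pi> \<in> {\<pi>. \<pi> permutes {..<k}}"
  then have "\<pi> j < k" if "j < k" for j using that permutes_in_image[of \<pi> "{..<k}" j] by simp
  then show "of_int (sign \<pi>) * (\<Prod>j<k. A j (\<pi> j)) = of_int (sign \<pi>) * (\<Prod>j<k. B j (\<pi> j))"
    using assms by simp
qed

lemma minor_row:
  assumes "l < k"
  shows "minor k (A(l := r)) = (\<Sum>\<pi> | \<pi> permutes {..<k}. of_int (sign \<pi>) * (r (\<pi> l) * (\<Prod>j\<in>{..<k} - {l}. A j (\<pi> j))))"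
  unfolding minor_def
proof (rule sum.cong[OF refl])
  fix \<pi>
  have "(\<Prod>j<k. (A(l := r)) j (\<pi> j)) = (A(l := r)) l (\<pi> l) * (\<Prod>j\<in>{..<k} - {l}. (A(l := r)) j (\<pi> j))"
    using assms by (intro prod.remove) auto
  also have "\<dots> = r (\<pi> l) * (\<Prod>j\<in>{..<k} - {l}. A j (\<pi> j))" by simp
  finally show "of_int (sign \<pi>) * (\<Prod>j<k. (A(l := r)) j (\<pi> j))
      = of_int (sign \<pi>) * (r (\<pi> l) * (\<Prod>j\<in>{..<k} - {l}. A j (\<pi> j)))" by simp
qed

lemma minor_row_linear:
  assumes "l < k"
  shows "minor k (A(l := (\<lambda>a. c * r a + d * s a))) = c * minor k (A(l := r)) + d * minor k (A(l := s))"
  unfolding minor_row[OF assms] by (simp add: sum_distrib_left sum.distrib algebra_simps)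

lemma minor_row_diff:
  assumes "l < k"
  shows "minor k (A(l := (\<lambda>a. r a - s a))) = minor k (A(l := r)) - minor k (A(l := s))"
  using minor_row_linear[OF assms, of A 1 r "-1" s] by simp

lemma minor_zero_row:
  assumes "l < k" "\<And>a. a < k \<Longrightarrow> A l a = 0"
  shows "minor k A = 0"
proof -
  have "minor k A = minor k (A(l := (\<lambda>a. 0 * A l a + 0 * A l a)))"
    by (rule minor_cong) (use assms in auto)
  also have "\<dots> = 0" unfolding minor_row_linear[OF assms(1)] by simp
  finally show ?thesis .
qed

lemma minor_bound:
  assumes "\<And>j a. j < k \<Longrightarrow> a < k \<Longrightarrow> \<bar>A j a\<bar> \<le> M j"
  shows "\<bar>minor k A\<bar> \<le> fact k * (\<Prod>j<k. M j)"
proof -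
  have "\<bar>minor k A\<bar> \<le> (\<Sum>\<pi> | \<pi> permutes {..<k}. \<bar>of_int (sign \<pi>) * (\<Prod>j<k. A j (\<pi> j))\<bar>)"
    unfolding minor_def by (rule sum_abs)
  also have "\<dots> \<le> (\<Sum>\<pi> | \<pi> permutes {..<k}. (\<Prod>j<k. M j))"
  proof (rule sum_mono)
    fix \<pi> assume "\<pi> \<in> {\<pi>. \<pi> permutes {..<k}}"
    then have "\<pi> j < k" if "j < k" for j using that permutes_in_image[of \<pi> "{..<k}" j] by simp
    then have "(\<Prod>j<k. \<bar>A j (\<pi> j)\<bar>) \<le> (\<Prod>j<k. M j)" using assms by (intro prod_mono) auto
    moreover have "\<bar>of_int (sign \<pi>) :: real\<bar> = 1" by (simp add: sign_def)
    ultimately show "\<bar>of_int (sign \<pi>) * (\<Prod>j<k. A j (\<pi> j))\<bar> \<le> (\<Prod>j<k. M j)"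
      by (simp add: abs_mult abs_prod)
  qed
  also have "\<dots> = fact k * (\<Prod>j<k. M j)" using card_permutations[of "{..<k}" k] by simp
  finally show ?thesis .
qed

lemma minor_permute_rows:
  assumes "\<sigma> permutes {..<k}"
  shows "minor k (\<lambda>j. A (\<sigma> j)) = of_int (sign \<sigma>) * minor k A"
proof -
  have "minor k (\<lambda>j. A (\<sigma> j)) = (\<Sum>\<pi> | \<pi> permutes {..<k}. of_int (sign (\<pi> \<circ> \<sigma>)) * (\<Prod>j<k. A (\<sigma> j) ((\<pi> \<circ> \<sigma>) j)))"
    unfolding minor_def
    using sum_permutations_compose_right[OF assms, of "\<lambda>\<pi>. of_int (sign \<pi>) * (\<Prod>j<k. A (\<sigma> j) (\<pi> j))"]
    by simp
  also have "\<dots> = (\<Sum>\<pi> | \<pi> permutes {..<k}. of_int (sign \<sigma>) * (of_int (sign \<pi>) * (\<Prod>j<k. A j (\<pi> j))))"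
  proof (rule sum.cong[OF refl])
    fix \<pi> assume "\<pi> \<in> {\<pi>. \<pi> permutes {..<k}}"
    then have "sign (\<pi> \<circ> \<sigma>) = sign \<pi> * sign \<sigma>"
      using assms by (intro sign_compose permutation_permutes[THEN iffD2]) auto
    moreover have "(\<Prod>j<k. A (\<sigma> j) ((\<pi> \<circ> \<sigma>) j)) = (\<Prod>j<k. A j (\<pi> j))"
      using prod.permute[OF assms, of "\<lambda>j. A j (\<pi> j)"] by (simp add: o_def)
    ultimately show "of_int (sign (\<pi> \<circ> \<sigma>)) * (\<Prod>j<k. A (\<sigma> j) ((\<pi> \<circ> \<sigma>) j))
        = of_int (sign \<sigma>) * (of_int (sign \<pi>) * (\<Prod>j<k. A j (\<pi> j)))" by simp
  qed
  finally show ?thesis by (simp add: minor_def sum_distrib_left)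
qed

lemma minor_repeated_row:
  assumes "l < k" "m < k" "l \<noteq> m" "A l = A m"
  shows "minor k A = 0"
proof -
  have "(\<lambda>j. A (Transposition.transpose l m j)) = A" using assms(4) by (auto simp: Transposition.transpose_def fun_eq_iff)
  then have "minor k A = - minor k A"
    using minor_permute_rows[OF permutes_swap_id[of l "{..<k}" m], of A] assms
    by (simp add: sign_swap_id)
  then show ?thesis by simp
qed

lemma minor_expand_rows:
  fixes V :: "'i::finite \<Rightarrow> nat \<Rightarrow> real"
  shows "minor k (\<lambda>j a. \<Sum>i\<in>UNIV. c j i * V i a)
    = (\<Sum>f\<in>{..<k} \<rightarrow>\<^sub>E UNIV. (\<Prod>j<k. c j (f j)) * minor k (\<lambda>j. V (f j)))"
proof -
  have "minor k (\<lambda>j a. \<Sum>i\<in>UNIV. c j i * V i a)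
      = (\<Sum>\<pi> | \<pi> permutes {..<k}. of_int (sign \<pi>) * (\<Sum>f\<in>{..<k} \<rightarrow>\<^sub>E UNIV. \<Prod>j<k. c j (f j) * V (f j) (\<pi> j)))"
    unfolding minor_def by (subst prod_sum_PiE) auto
  also have "\<dots> = (\<Sum>\<pi> | \<pi> permutes {..<k}. (\<Sum>f\<in>{..<k} \<rightarrow>\<^sub>E UNIV.
      (\<Prod>j<k. c j (f j)) * (of_int (sign \<pi>) * (\<Prod>j<k. V (f j) (\<pi> j)))))"
    by (simp add: sum_distrib_left prod.distrib algebra_simps)
  also have "\<dots> = (\<Sum>f\<in>{..<k} \<rightarrow>\<^sub>E UNIV. (\<Prod>j<k. c j (f j)) * minor k (\<lambda>j. V (f j)))"
    unfolding minor_def by (subst sum.swap) (simp add: sum_distrib_left)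
  finally show ?thesis .
qed

text \<open>The rows of \<open>A\<close> are replaced by those of \<open>B\<close> one at a time.\<close>

lemma minor_diff_telescope:
  "minor k A - minor k B
    = (\<Sum>l<k. minor k ((\<lambda>j. if j < l then B j else A j)(l := (\<lambda>a. A l a - B l a))))"
proof -
  define T where "T l = minor k (\<lambda>j. if j < l then B j else A j)" for l
  have "minor k ((\<lambda>j. if j < l then B j else A j)(l := (\<lambda>a. A l a - B l a))) = T l - T (Suc l)"
    if "l < k" for l
  proof -
    have "(\<lambda>j. if j < l then B j else A j)(l := A l) = (\<lambda>j. if j < l then B j else A j)"
      "(\<lambda>j. if j < l then B j else A j)(l := B l) = (\<lambda>j. if j < Suc l then B j else A j)"
      by (auto simp: fun_eq_iff less_Suc_eq)
    then show ?thesis unfolding T_def minor_row_diff[OF that] by simp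
  qed
  then have "(\<Sum>l<k. minor k ((\<lambda>j. if j < l then B j else A j)(l := (\<lambda>a. A l a - B l a)))) = T 0 - T k"
    by (simp add: sum_lessThan_telescope')
  moreover have "T 0 = minor k A" "T k = minor k B"
    unfolding T_def by (auto intro: minor_cong)
  ultimately show ?thesis by simp
qed

definition jac :: "nat \<Rightarrow> (nat \<Rightarrow> 'n) \<Rightarrow> (nat \<Rightarrow> real^'n \<Rightarrow> real) \<Rightarrow> real^'n \<Rightarrow> real"
  where "jac k \<beta> f x = minor k (\<lambda>j a. partial (\<beta> a) (f j) x)"

lemma form_component_pullback_jac:
  "form_component \<beta> (pullback k i g x) = jac k \<beta> (\<lambda>j z. g z $ i j) x"
  unfolding form_component_pullback jac_def minor_def ..

lemma smooth_jac:
  assumes "\<And>j. smooth_on UNIV (f j)"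
  shows "smooth_on UNIV (jac k \<beta> f)"
  unfolding jac_def[abs_def] minor_def
  by (intro smooth_on_sum smooth_on_mult smooth_on_const smooth_on_prod smooth_on_partial assms)

lemma jac_upd: "jac k \<beta> (f(l := g)) x = minor k ((\<lambda>j a. partial (\<beta> a) (f j) x)(l := (\<lambda>a. partial (\<beta> a) g x)))"
  unfolding jac_def by (rule arg_cong[where f = "minor k"]) auto

lemma partial_prod:
  fixes g :: "'i \<Rightarrow> real^'n \<Rightarrow> real"
  assumes "finite J" "\<And>j. j \<in> J \<Longrightarrow> smooth_on UNIV (g j)"
  shows "partial a (\<lambda>x. \<Prod>j\<in>J. g j x) x = (\<Sum>m\<in>J. partial a (g m) x * (\<Prod>j\<in>J - {m}. g j x))"
  using assms
proof (induction J)
  case empty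
  then show ?case by (simp add: partial_const)
next
  case (insert i J)
  have s: "smooth_on UNIV (g i)" "smooth_on UNIV (\<lambda>x. \<Prod>j\<in>J. g j x)"
    using insert by (auto intro: smooth_on_prod)
  have e: "(\<Prod>j\<in>insert i J - {m}. g j x) = g i x * (\<Prod>j\<in>J - {m}. g j x)" if "m \<in> J" for m
  proof -
    have "insert i J - {m} = insert i (J - {m})" using that insert by auto
    then show ?thesis using insert by simp
  qed
  have "partial a (\<lambda>x. \<Prod>j\<in>insert i J. g j x) x = partial a (\<lambda>x. g i x * (\<Prod>j\<in>J. g j x)) x"
    using insert by simp
  also have "\<dots> = g i x * (\<Sum>m\<in>J. partial a (g m) x * (\<Prod>j\<in>J - {m}. g j x)) + partial a (g i) x * (\<Prod>j\<in>J. g j x)"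
    using s insert by (simp add: partial_mult smooth_on_differentiable)
  also have "\<dots> = (\<Sum>m\<in>insert i J. partial a (g m) x * (\<Prod>j\<in>insert i J - {m}. g j x))"
    using insert by (simp add: e sum_distrib_left algebra_simps cong: sum.cong)
  finally show ?case .
qed

text \<open>Let the \<open>l\<close>-th row be the gradient of \<open>\<Phi>\<close>. Moving the derivative from \<open>\<Phi>\<close> to the product of the other entries
  produces terms with a second derivative of some \<open>f m\<close>. Composition of \<open>\<pi>\<close> with the transposition of \<open>l\<close> and \<open>m\<close>
  changes the sign of such a term and otherwise preserves it, because mixed partials commute. So these terms cancel.\<close>

lemma jac_divergence_form:
  fixes f :: "nat \<Rightarrow> real^'n \<Rightarrow> real"
  assumes f: "\<And>j. smooth_on UNIV (f j)" and \<Phi>: "smooth_on UNIV \<Phi>" and "l < k"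
  shows "jac k \<beta> (f(l := \<Phi>)) x = (\<Sum>\<pi> | \<pi> permutes {..<k}. of_int (sign \<pi>) *
    partial (\<beta> (\<pi> l)) (\<lambda>x. \<Phi> x * (\<Prod>j\<in>{..<k} - {l}. partial (\<beta> (\<pi> j)) (f j) x)) x)"
proof -
  let ?J = "{..<k} - {l}"
  let ?P = "{\<pi>. \<pi> permutes {..<k}}"
  have s: "smooth_on UNIV (partial a (f j))" for a j by (rule smooth_on_partial[OF f])
  define S where "S m \<pi> = partial (\<beta> (\<pi> l)) (partial (\<beta> (\<pi> m)) (f m)) x
      * (\<Prod>j\<in>?J - {m}. partial (\<beta> (\<pi> j)) (f j) x)" for m \<pi>
  have S0: "(\<Sum>\<pi>\<in>?P. of_int (sign \<pi>) * S m \<pi>) = 0" if m: "m \<in> ?J" for m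
  proof -
    let ?t = "Transposition.transpose l m"
    have t: "?t permutes {..<k}" using m \<open>l < k\<close> by (intro permutes_swap_id) auto
    have "(\<Sum>\<pi>\<in>?P. of_int (sign \<pi>) * S m \<pi>) = (\<Sum>\<pi>\<in>?P. of_int (sign (\<pi> \<circ> ?t)) * S m (\<pi> \<circ> ?t))"
      using sum_permutations_compose_right[OF t, of "\<lambda>\<pi>. of_int (sign \<pi>) * S m \<pi>"] by simp
    also have "\<dots> = (\<Sum>\<pi>\<in>?P. - (of_int (sign \<pi>) * S m \<pi>))"
    proof (rule sum.cong[OF refl])
      fix \<pi> assume "\<pi> \<in> ?P"
      then have "sign (\<pi> \<circ> ?t) = sign \<pi> * sign ?t"
        using t by (intro sign_compose permutation_permutes[THEN iffD2]) auto
      then have "sign (\<pi> \<circ> ?t) = - sign \<pi>" using m by (simp add: sign_swap_id)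
      moreover have "S m (\<pi> \<circ> ?t) = S m \<pi>"
      proof -
        have "(\<Prod>j\<in>?J - {m}. partial (\<beta> ((\<pi> \<circ> ?t) j)) (f j) x) = (\<Prod>j\<in>?J - {m}. partial (\<beta> (\<pi> j)) (f j) x)"
          by (rule prod.cong[OF refl]) (auto simp: Transposition.transpose_def)
        then show ?thesis unfolding S_def
          by (simp add: partial_commute[OF f, of "\<beta> (\<pi> m)"])
      qed
      ultimately show "of_int (sign (\<pi> \<circ> ?t)) * S m (\<pi> \<circ> ?t) = - (of_int (sign \<pi>) * S m \<pi>)" by simp
    qed
    finally show ?thesis by (simp add: sum_negf)
  qed
  have "partial (\<beta> (\<pi> l)) (\<lambda>x. \<Phi> x * (\<Prod>j\<in>?J. partial (\<beta> (\<pi> j)) (f j) x)) x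
      = \<Phi> x * (\<Sum>m\<in>?J. S m \<pi>) + partial (\<beta> (\<pi> l)) \<Phi> x * (\<Prod>j\<in>?J. partial (\<beta> (\<pi> j)) (f j) x)" for \<pi>
    unfolding S_def
    by (subst partial_mult) (auto intro!: smooth_on_differentiable smooth_on_prod s \<Phi> simp: partial_prod s)
  then have "(\<Sum>\<pi>\<in>?P. of_int (sign \<pi>) * partial (\<beta> (\<pi> l)) (\<lambda>x. \<Phi> x * (\<Prod>j\<in>?J. partial (\<beta> (\<pi> j)) (f j) x)) x)
      = \<Phi> x * (\<Sum>m\<in>?J. \<Sum>\<pi>\<in>?P. of_int (sign \<pi>) * S m \<pi>)
        + (\<Sum>\<pi>\<in>?P. of_int (sign \<pi>) * (partial (\<beta> (\<pi> l)) \<Phi> x * (\<Prod>j\<in>?J. partial (\<beta> (\<pi> j)) (f j) x)))"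
    by (subst sum.swap) (simp add: sum.distrib sum_distrib_left algebra_simps)
  then show ?thesis using S0 by (simp add: jac_upd minor_row[OF \<open>l < k\<close>])
qed

lemma integral_jac_eq_0:
  fixes f :: "nat \<Rightarrow> real^'n \<Rightarrow> real"
  assumes f: "\<And>j. smooth_on UNIV (f j)" and \<Phi>: "smooth_on UNIV \<Phi>" "zero_beyond R \<Phi>" and "l < k"
  shows "(\<integral>x. jac k \<beta> (f(l := \<Phi>)) x \<partial>lborel) = 0"
proof -
  let ?g = "\<lambda>\<pi> x. \<Phi> x * (\<Prod>j\<in>{..<k} - {l}. partial (\<beta> (\<pi> j)) (f j) x)"
  have s: "smooth_on UNIV (?g \<pi>)" for \<pi>
    by (intro smooth_on_mult smooth_on_prod smooth_on_partial f \<Phi>)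
  have z: "zero_beyond R (?g \<pi>)" for \<pi> using \<Phi>(2) by (simp add: zero_beyond_def)
  have i: "integrable lborel (partial a (?g \<pi>))" for a \<pi>
    by (rule integrable_continuous_bounded_support[OF smooth_on_continuous[OF smooth_on_partial[OF s]] zero_beyond_partial[OF z]])
  show ?thesis
    unfolding jac_divergence_form[OF f \<Phi>(1) \<open>l < k\<close>]
    by (subst Bochner_Integration.integral_sum) (auto intro!: integrable_mult_right i simp: integral_partial_eq_0[OF s z])
qed

text \<open>The minor with the row of \<open>\<phi> D\<close> has integral \<open>0\<close>, and the product rule splits it.\<close>

lemma integral_jac_by_parts:
  fixes f :: "nat \<Rightarrow> real^'n \<Rightarrow> real"
  assumes f: "\<And>j. smooth_on UNIV (f j)" and \<phi>: "smooth_on UNIV \<phi>" "zero_beyond R \<phi>"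
    and D: "smooth_on UNIV D" and "l < k"
  shows "(\<integral>x. \<phi> x * jac k \<beta> (f(l := D)) x \<partial>lborel) = - (\<integral>x. D x * jac k \<beta> (f(l := \<phi>)) x \<partial>lborel)"
proof -
  have upd: "smooth_on UNIV (jac k \<beta> (f(l := g)))" if "smooth_on UNIV g" for g
    by (rule smooth_jac) (use f that in auto)
  have z: "zero_beyond R (jac k \<beta> (f(l := \<phi>)))"
    unfolding zero_beyond_def jac_upd
    using zero_beyond_partial[OF \<phi>(2)] \<open>l < k\<close> by (auto intro!: minor_zero_row[of l] simp: zero_beyond_def)
  have e: "jac k \<beta> (f(l := (\<lambda>x. \<phi> x * D x))) x = \<phi> x * jac k \<beta> (f(l := D)) x + D x * jac k \<beta> (f(l := \<phi>)) x" for x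
    unfolding jac_upd using \<open>l < k\<close> \<phi> D
    by (simp add: partial_mult smooth_on_differentiable mult.commute[of _ "D x"] minor_row_linear)
  have i: "integrable lborel (\<lambda>x. \<phi> x * jac k \<beta> (f(l := D)) x)" "integrable lborel (\<lambda>x. D x * jac k \<beta> (f(l := \<phi>)) x)"
    using z \<phi>(2) by (auto intro!: integrable_continuous_bounded_support[of _ R] smooth_on_continuous smooth_on_mult upd \<phi>(1) D
        simp: zero_beyond_def)
  have "(\<integral>x. jac k \<beta> (f(l := (\<lambda>x. \<phi> x * D x))) x \<partial>lborel) = 0"
    by (rule integral_jac_eq_0[of f _ R]) (use assms in \<open>auto intro!: smooth_on_mult simp: zero_beyond_def\<close>)
  then show ?thesis using i by (simp add: e)
qed

section \<open>The standard mollifier\<close>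

lemma exists_large_component:
  fixes x :: "real^'n"
  assumes "c < norm x"
  obtains a where "c / real CARD('n) \<le> \<bar>x $ a\<bar>"
proof -
  have "\<exists>a. c / real CARD('n) \<le> \<bar>x $ a\<bar>"
  proof (rule ccontr)
    assume "\<not> ?thesis"
    then have "(\<Sum>a\<in>UNIV. \<bar>x $ a\<bar>) \<le> (\<Sum>a\<in>(UNIV::'n set). c / real CARD('n))"
      by (intro sum_mono) (auto simp: not_le less_imp_le)
    also have "\<dots> = c" by simp
    finally show False using assms norm_le_l1_cart[of x] by simp
  qed
  then show ?thesis using that by blast
qed

text \<open>A product of one-dimensional bumps in the coordinates, scaled to live in a small cube and normalised.\<close>

lemma mollifier_exists:
  obtains \<eta> :: "real^'n \<Rightarrow> real" where "smooth_on UNIV \<eta>" "\<And>z. 0 \<le> \<eta> z" "zero_beyond (1/2) \<eta>"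
    "integral\<^sup>L lborel \<eta> = 1"
proof -
  obtain B b :: "real \<Rightarrow> real" where b: "smooth_real b" "\<And>t. 1 \<le> \<bar>t\<bar> \<Longrightarrow> b t = 0" "\<And>t. 0 \<le> b t" "0 < b 0"
    by (rule smooth_step_exists) blast
  let ?c = "2 * real CARD('n)"
  define f where "f z = (\<Prod>a\<in>UNIV. b (?c * z $ a))" for z :: "real^'n"
  have s: "smooth_on UNIV f" unfolding f_def[abs_def]
    by (intro smooth_on_prod smooth_on_real_compose[OF b(1)] smooth_on_mult smooth_on_const smooth_on_component)
  have z: "zero_beyond (1/2) f"
    unfolding zero_beyond_def
  proof (intro allI impI)
    fix x :: "real^'n" assume x: "1/2 < norm x"
    obtain a where "(1/2) / real CARD('n) \<le> \<bar>x $ a\<bar>" by (rule exists_large_component[OF x])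
    then have "1 \<le> \<bar>?c * x $ a\<bar>" by (simp add: abs_mult field_simps)
    then show "f x = 0" unfolding f_def using b(2) by (intro prod_zero) auto
  qed
  have pos: "integral\<^sup>L lborel f > 0"
    by (rule integral_pos_of_continuous[OF smooth_on_continuous[OF s] z, of 0])
      (auto simp: f_def intro!: prod_nonneg b zero_less_power)
  show ?thesis
  proof (rule that)
    show "smooth_on UNIV (\<lambda>z. inverse (integral\<^sup>L lborel f) * f z)"
      by (intro smooth_on_mult smooth_on_const s)
    show "zero_beyond (1/2) (\<lambda>z. inverse (integral\<^sup>L lborel f) * f z)"
      using z by (simp add: zero_beyond_def)
    show "0 \<le> inverse (integral\<^sup>L lborel f) * f z" for z
      using pos by (auto simp: f_def intro!: mult_nonneg_nonneg prod_nonneg b)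
    show "(\<integral>z. inverse (integral\<^sup>L lborel f) * f z \<partial>lborel) = 1" using pos by simp
  qed
qed

definition mollifier :: "real^'n \<Rightarrow> real"
  where "mollifier = (SOME \<eta>. smooth_on UNIV \<eta> \<and> (\<forall>z. 0 \<le> \<eta> z) \<and> zero_beyond (1/2) \<eta> \<and> integral\<^sup>L lborel \<eta> = 1)"

lemma mollifier:
  fixes z :: "real^'n"
  shows smooth_mollifier: "smooth_on UNIV (mollifier :: real^'n \<Rightarrow> real)"
    and mollifier_nonneg: "0 \<le> mollifier z"
    and zero_beyond_mollifier: "zero_beyond (1/2) (mollifier :: real^'n \<Rightarrow> real)"
    and integral_mollifier: "integral\<^sup>L lborel (mollifier :: real^'n \<Rightarrow> real) = 1"
proof -
  have "\<exists>\<eta>::real^'n \<Rightarrow> real. smooth_on UNIV \<eta> \<and> (\<forall>z. 0 \<le> \<eta> z) \<and> zero_beyond (1/2) \<eta> \<and> integral\<^sup>L lborel \<eta> = 1"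
    by (rule mollifier_exists) blast
  from someI_ex[OF this, folded mollifier_def]
  have *: "smooth_on UNIV (mollifier :: real^'n \<Rightarrow> real) \<and> (\<forall>z::real^'n. 0 \<le> mollifier z) \<and>
    zero_beyond (1/2) (mollifier :: real^'n \<Rightarrow> real) \<and> integral\<^sup>L lborel (mollifier :: real^'n \<Rightarrow> real) = 1" .
  show "smooth_on UNIV (mollifier :: real^'n \<Rightarrow> real)" "zero_beyond (1/2) (mollifier :: real^'n \<Rightarrow> real)"
    "integral\<^sup>L lborel (mollifier :: real^'n \<Rightarrow> real) = 1" using * by auto
  show "0 \<le> mollifier z" using * by blast
qed

lemma measurable_mollifier [measurable]: "mollifier \<in> borel_measurable borel"
  by (intro borel_measurable_continuous_onI smooth_on_continuous smooth_mollifier)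

lemma integrable_mollifier: "integrable lborel (mollifier :: real^'n \<Rightarrow> real)"
  by (rule integrable_continuous_bounded_support[OF smooth_on_continuous[OF smooth_mollifier] zero_beyond_mollifier])

text \<open>Mollification is averaging with respect to this probability measure, which makes Jensen's inequality available.\<close>

definition moll :: "(real^'n) measure"
  where "moll = density lborel (\<lambda>z. ennreal (mollifier z))"

lemma sets_moll [simp, measurable_cong]: "sets moll = sets borel" by (simp add: moll_def)

lemma space_moll [simp]: "space moll = UNIV" by (simp add: moll_def)

lemma prob_space_moll: "prob_space (moll :: (real^'n) measure)"
proof
  have "emeasure (moll :: (real^'n) measure) (space moll) = (\<integral>\<^sup>+z. ennreal (mollifier (z :: real^'n)) \<partial>lborel)"
    by (simp add: moll_def emeasure_density)
  also have "\<dots> = 1"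
    using nn_integral_eq_integral[OF integrable_mollifier] by (simp add: mollifier_nonneg integral_mollifier)
  finally show "emeasure (moll :: (real^'n) measure) (space moll) = 1" .
qed

interpretation moll: prob_space "moll :: (real^'n) measure" by (rule prob_space_moll)

lemma AE_moll: "AE z in moll. norm z \<le> 1/2"
proof -
  have "AE z in lborel. 0 < ennreal (mollifier z) \<longrightarrow> norm z \<le> 1/2"
    using zero_beyond_mollifier by (auto simp: zero_beyond_def not_le[symmetric] intro!: AE_I2)
  then show ?thesis unfolding moll_def by (subst AE_density) auto
qed

section \<open>Mollification in Lebesgue spaces\<close>

lemma powr_add_le:
  fixes a b p :: real
  assumes "0 \<le> a" "0 \<le> b" "0 \<le> p"
  shows "(a + b) powr p \<le> 2 powr p * (a powr p + b powr p)"
proof -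
  have "(a + b) powr p \<le> (2 * max a b) powr p" using assms by (intro powr_mono2) auto
  also have "\<dots> = 2 powr p * max a b powr p" using assms by (simp add: powr_mult)
  also have "max a b powr p \<le> a powr p + b powr p" by (auto simp: max_def)
  finally show ?thesis by simp
qed

lemma ennreal_norm_add_powr_le:
  assumes "0 \<le> p"
  shows "ennreal (norm (x + y) powr p) \<le> ennreal (2 powr p) * (ennreal (norm x powr p) + ennreal (norm y powr p))"
proof -
  have "norm (x + y) powr p \<le> (norm x + norm y) powr p"
    using assms by (intro powr_mono2 norm_triangle_ineq) auto
  also have "\<dots> \<le> 2 powr p * (norm x powr p + norm y powr p)" using assms by (intro powr_add_le) auto
  finally show ?thesis by (simp add: ennreal_mult[symmetric] ennreal_plus[symmetric] del: ennreal_plus)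
qed

lemma le_one_add_powr:
  fixes r p :: real
  assumes "0 \<le> r" "1 \<le> p"
  shows "r \<le> 1 + r powr p"
proof (cases "r \<le> 1")
  case True
  then show ?thesis by (smt (verit) powr_ge_zero)
next
  case False
  then have "r powr 1 \<le> r powr p" using assms by (intro powr_mono) auto
  then show ?thesis using False by (smt (verit) powr_one)
qed

text \<open>Jensen's inequality. With \<open>m\<close> the mean of the norm of \<open>f\<close>, Young's inequality gives
  \<open>|f| m\<^bsup>p - 1\<^esup> \<le> |f|\<^sup>p / p + (1 - 1 / p) m\<^sup>p\<close>; integrate.\<close>

lemma (in prob_space) norm_integral_powr_le:
  fixes f :: "'a \<Rightarrow> 'b::euclidean_space"
  assumes p: "1 < p" and [measurable]: "f \<in> borel_measurable M"
  shows "ennreal (norm (\<integral>x. f x \<partial>M) powr p) \<le> (\<integral>\<^sup>+x. ennreal (norm (f x) powr p) \<partial>M)"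
proof (cases "(\<integral>\<^sup>+x. ennreal (norm (f x) powr p) \<partial>M) = \<infinity>")
  case False
  then have ip: "integrable M (\<lambda>x. norm (f x) powr p)"
    by (intro integrableI_nonneg) (auto simp: less_top)
  have le: "norm (f x) \<le> 1 + norm (f x) powr p" for x
    using le_one_add_powr[of "norm (f x)" p] p by simp
  have i: "integrable M (\<lambda>x. norm (f x))"
    by (rule Bochner_Integration.integrable_bound[OF Bochner_Integration.integrable_add[OF integrable_const[of 1] ip]])
      (use le in auto)
  define m where "m = (\<integral>x. norm (f x) \<partial>M)"
  have m0: "m \<ge> 0" by (simp add: m_def)
  let ?q = "p / (p - 1)"
  have q: "?q > 1" "1/p + 1/?q = 1" using p by (auto simp: field_simps)
  have "m powr p \<le> (\<integral>x. norm (f x) powr p \<partial>M)"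
  proof (cases "m = 0")
    case True
    then show ?thesis by simp
  next
    case False
    have Y: "norm (f x) * m powr (p - 1) \<le> norm (f x) powr p / p + m powr p / ?q" for x
    proof -
      have "norm (f x) * m powr (p - 1) \<le> norm (f x) powr p / p + (m powr (p - 1)) powr ?q / ?q"
        by (rule Youngs_inequality) (use p q in auto)
      also have "(m powr (p - 1)) powr ?q = m powr p" using p by (simp add: powr_powr)
      finally show ?thesis .
    qed
    have "(\<integral>x. norm (f x) * m powr (p - 1) \<partial>M) \<le> (\<integral>x. norm (f x) powr p / p + m powr p / ?q \<partial>M)"
      by (rule integral_mono) (use i ip Y in auto)
    also have "\<dots> = (\<integral>x. norm (f x) powr p \<partial>M) / p + m powr p / ?q"
      using ip by (simp add: prob_space)
    also have "(\<integral>x. norm (f x) * m powr (p - 1) \<partial>M) = m * m powr (p - 1)"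
      using i by (simp add: m_def)
    also have "m * m powr (p - 1) = m powr p"
      using False m0 by (simp add: powr_mult_base)
    finally have "m powr p * (1 - 1/?q) \<le> (\<integral>x. norm (f x) powr p \<partial>M) / p"
      by (simp add: right_diff_distrib)
    also have "1 - 1/?q = 1/p" using q(2) by linarith
    finally show ?thesis using p by (simp add: field_simps)
  qed
  moreover have "norm (\<integral>x. f x \<partial>M) powr p \<le> m powr p"
    unfolding m_def using p by (intro powr_mono2 integral_norm_bound) auto
  ultimately have "ennreal (norm (\<integral>x. f x \<partial>M) powr p) \<le> ennreal (\<integral>x. norm (f x) powr p \<partial>M)"
    by (intro ennreal_leI) linarith
  also have "\<dots> = (\<integral>\<^sup>+x. ennreal (norm (f x) powr p) \<partial>M)"
    using ip by (intro nn_integral_eq_integral[symmetric]) auto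
  finally show ?thesis .
qed simp

lemma nn_integral_affine:
  fixes f :: "'a::euclidean_space \<Rightarrow> ennreal"
  assumes [measurable]: "f \<in> borel_measurable borel" and "c > 0"
  shows "(\<integral>\<^sup>+x. f x \<partial>lborel) = ennreal (c ^ DIM('a)) * (\<integral>\<^sup>+x. f (b + c *\<^sub>R x) \<partial>lborel)"
proof -
  have "(\<integral>\<^sup>+x. f x \<partial>lborel) = (\<integral>\<^sup>+x. f x \<partial>density (distr lborel borel (\<lambda>x. b + c *\<^sub>R x)) (\<lambda>_. \<bar>c\<bar>^DIM('a)))"
    using lborel_affine[of c b] \<open>c > 0\<close> by simp
  also have "\<dots> = (\<integral>\<^sup>+x. ennreal (c ^ DIM('a)) * f (b + c *\<^sub>R x) \<partial>lborel)"
    using \<open>c > 0\<close> by (subst nn_integral_density) (auto simp: nn_integral_distr)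
  finally show ?thesis by (simp add: nn_integral_cmult)
qed

lemma continuous_truncation:
  fixes g :: "'a::topological_space \<Rightarrow> 'b::real_normed_vector"
  assumes "M > 0" "continuous_on S g"
  shows "continuous_on S (\<lambda>x. (M / max M (norm (g x))) *\<^sub>R g x)"
  using assms by (intro continuous_intros) (auto simp: max_def)

text \<open>First truncate \<open>w\<close> at a high level \<open>M\<close>. A measurable function is almost everywhere a limit of continuous functions;
  truncating these at the same level keeps them continuous and makes dominated convergence applicable on the bounded
  set.\<close>

lemma Lp_approx_continuous:
  fixes w :: "'a::euclidean_space \<Rightarrow> 'b::euclidean_space"
  assumes [measurable]: "w \<in> borel_measurable borel" "\<Omega> \<in> sets borel" and "bounded \<Omega>" and p: "0 < p"
    and fin: "(\<integral>\<^sup>+x. indicator \<Omega> x * ennreal (norm (w x) powr p) \<partial>lborel) < \<infinity>" and "0 < e"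
  obtains g where "continuous_on UNIV g"
    "(\<integral>\<^sup>+x. indicator \<Omega> x * ennreal (norm (w x - g x) powr p) \<partial>lborel) < ennreal e"
proof -
  define T where "T M y = (M / max M (norm y)) *\<^sub>R y" for M and y :: 'b
  have T_id: "T M y = y" if "norm y \<le> M" "M > 0" for M y using that by (simp add: T_def max_def)
  have T_le: "norm (T M y) \<le> M" if "M > 0" for M y
    using that by (auto simp: T_def max_def field_simps)
  have T_le': "norm (y - T M y) \<le> norm y" if "M > 0" for M y
  proof -
    have "y - T M y = (1 - M / max M (norm y)) *\<^sub>R y" by (simp add: T_def scaleR_left_diff_distrib)
    moreover have "0 \<le> 1 - M / max M (norm y)" "1 - M / max M (norm y) \<le> 1" using that by (auto simp: max_def divide_le_eq)
    ultimately show ?thesis by (simp add: mult_left_le_one_le)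
  qed
  have T_cont: "continuous_on UNIV (T M)" if "M > 0" for M
    unfolding T_def by (rule continuous_truncation[OF that continuous_on_id])
  have [measurable]: "T M \<in> borel_measurable borel" if "M > 0" for M
    using T_cont[OF that] by (rule borel_measurable_continuous_onI)
  let ?e = "e / (2 powr p * 2)"
  have e: "?e > 0" using \<open>0 < e\<close> by simp
  have Tm: "(\<lambda>x. T (real (Suc n)) (w x)) \<in> borel_measurable borel" for n by measurable
  have "(\<lambda>n. \<integral>\<^sup>+x. indicator \<Omega> x * ennreal (norm (w x - T (real (Suc n)) (w x)) powr p) \<partial>lborel)
      \<longlonglongrightarrow> integral\<^sup>N lborel (\<lambda>x::'a. 0)"
  proof (rule nn_integral_dominated_convergence[where w = "\<lambda>x. indicator \<Omega> x * ennreal (norm (w x) powr p)"])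
    show "AE x in lborel. indicator \<Omega> x * ennreal (norm (w x - T (real (Suc n)) (w x)) powr p)
        \<le> indicator \<Omega> x * ennreal (norm (w x) powr p)" for n
      using T_le'[of "real (Suc n)"] p by (intro AE_I2 mult_left_mono ennreal_leI powr_mono2) auto
    show "AE x in lborel. (\<lambda>n. indicator \<Omega> x * ennreal (norm (w x - T (real (Suc n)) (w x)) powr p)) \<longlonglongrightarrow> 0"
    proof (rule AE_I2, rule tendsto_eventually)
      fix x
      obtain N where "norm (w x) \<le> real N" using real_arch_simple by blast
      then have "T (real (Suc n)) (w x) = w x" if "n \<ge> N" for n using that by (intro T_id) auto
      then show "\<forall>\<^sub>F n in sequentially. indicator \<Omega> x * ennreal (norm (w x - T (real (Suc n)) (w x)) powr p) = 0"
        by (intro eventually_sequentiallyI[of N]) simp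
    qed
  qed (use fin Tm in auto)
  then have "\<forall>\<^sub>F n in sequentially. (\<integral>\<^sup>+x. indicator \<Omega> x * ennreal (norm (w x - T (real (Suc n)) (w x)) powr p) \<partial>lborel) < ennreal ?e"
    using e by (intro order_tendstoD(2)) auto
  then obtain N where "(\<integral>\<^sup>+x. indicator \<Omega> x * ennreal (norm (w x - T (real (Suc N)) (w x)) powr p) \<partial>lborel) < ennreal ?e"
    unfolding eventually_sequentially by blast
  then obtain M where M: "M > 0" "(\<integral>\<^sup>+x. indicator \<Omega> x * ennreal (norm (w x - T M (w x)) powr p) \<partial>lborel) < ennreal ?e"
    by (metis of_nat_0_less_iff zero_less_Suc)
  have "w measurable_on UNIV"
    by (rule lebesgue_measurable_imp_measurable_on) (auto simp: measurable_completion)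
  then obtain N G where N: "negligible N" "\<And>n. continuous_on UNIV (G n)" "\<And>x. x \<notin> N \<Longrightarrow> (\<lambda>n. G n x) \<longlonglongrightarrow> w x"
    unfolding measurable_on_def by auto
  have [measurable]: "G n \<in> borel_measurable borel" for n
    using N(2) by (rule borel_measurable_continuous_onI)
  have TGm: "(\<lambda>x. T M (G n x)) \<in> borel_measurable borel" "(\<lambda>x. T M (w x)) \<in> borel_measurable borel" for n
    using M(1) by measurable
  have "N \<in> null_sets lebesgue" using N(1) by (simp add: negligible_iff_null_sets)
  then have "AE x in lebesgue. x \<notin> N" by (rule AE_not_in)
  then have aeN: "AE x in lborel. x \<notin> N" by (simp add: AE_completion_iff)
  have "(\<lambda>n. \<integral>\<^sup>+x. indicator \<Omega> x * ennreal (norm (T M (w x) - T M (G n x)) powr p) \<partial>lborel)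
      \<longlonglongrightarrow> integral\<^sup>N lborel (\<lambda>x::'a. 0)"
  proof (rule nn_integral_dominated_convergence[where w = "\<lambda>x. ennreal ((2 * M) powr p) * indicator \<Omega> x"])
    show "AE x in lborel. indicator \<Omega> x * ennreal (norm (T M (w x) - T M (G n x)) powr p)
        \<le> ennreal ((2 * M) powr p) * indicator \<Omega> x" for n
    proof (rule AE_I2)
      fix x
      have "norm (T M (w x) - T M (G n x)) \<le> 2 * M"
        using norm_triangle_ineq4[of "T M (w x)" "T M (G n x)"] T_le[OF M(1), of "w x"] T_le[OF M(1), of "G n x"] by linarith
      then have "ennreal (norm (T M (w x) - T M (G n x)) powr p) \<le> ennreal ((2 * M) powr p)"
        using p by (intro ennreal_leI powr_mono2) auto
      then show "indicator \<Omega> x * ennreal (norm (T M (w x) - T M (G n x)) powr p) \<le> ennreal ((2 * M) powr p) * indicator \<Omega> x"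
        by (auto simp: indicator_def)
    qed
    show "AE x in lborel. (\<lambda>n. indicator \<Omega> x * ennreal (norm (T M (w x) - T M (G n x)) powr p)) \<longlonglongrightarrow> 0"
      using aeN
    proof (rule eventually_mono)
      fix x assume "x \<notin> N"
      then have "(\<lambda>n. T M (G n x)) \<longlonglongrightarrow> T M (w x)"
        using T_cont[OF M(1)] N(3) continuous_on_tendsto_compose by fastforce
      then have "(\<lambda>n. T M (w x) - T M (G n x)) \<longlonglongrightarrow> 0"
        using tendsto_diff[OF tendsto_const, of "\<lambda>n. T M (G n x)" "T M (w x)" sequentially "T M (w x)"] by simp
      then have "(\<lambda>n. norm (T M (w x) - T M (G n x)) powr p) \<longlonglongrightarrow> 0"
        using p by (intro tendsto_zero_powrI[of _ _ _ p]) (auto intro: tendsto_norm_zero)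
      then have "(\<lambda>n. ennreal (norm (T M (w x) - T M (G n x)) powr p)) \<longlonglongrightarrow> 0"
        by (simp add: ennreal_tendsto_0_iff)
      then show "(\<lambda>n. indicator \<Omega> x * ennreal (norm (T M (w x) - T M (G n x)) powr p)) \<longlonglongrightarrow> 0"
        by (cases "x \<in> \<Omega>") auto
    qed
    show "(\<integral>\<^sup>+x. ennreal ((2 * M) powr p) * indicator \<Omega> x \<partial>lborel) < \<infinity>"
      using emeasure_bounded_finite[OF \<open>bounded \<Omega>\<close>] by (simp add: nn_integral_cmult_indicator ennreal_mult_less_top)
  qed (use TGm in auto)
  then have "\<forall>\<^sub>F n in sequentially. (\<integral>\<^sup>+x. indicator \<Omega> x * ennreal (norm (T M (w x) - T M (G n x)) powr p) \<partial>lborel) < ennreal ?e"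
    using e by (intro order_tendstoD(2)) auto
  then obtain n where n: "(\<integral>\<^sup>+x. indicator \<Omega> x * ennreal (norm (T M (w x) - T M (G n x)) powr p) \<partial>lborel) < ennreal ?e"
    by (auto simp: eventually_sequentially)
  show ?thesis
  proof (rule that)
    show "continuous_on UNIV (\<lambda>x. T M (G n x))"
      by (rule continuous_on_compose2[OF T_cont[OF M(1)] N(2)]) auto
    have "(\<integral>\<^sup>+x. indicator \<Omega> x * ennreal (norm (w x - T M (G n x)) powr p) \<partial>lborel)
      \<le> (\<integral>\<^sup>+x. ennreal (2 powr p) * (indicator \<Omega> x * ennreal (norm (w x - T M (w x)) powr p)
          + indicator \<Omega> x * ennreal (norm (T M (w x) - T M (G n x)) powr p)) \<partial>lborel)"
    proof (rule nn_integral_mono)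
      fix x
      show "indicator \<Omega> x * ennreal (norm (w x - T M (G n x)) powr p)
        \<le> ennreal (2 powr p) * (indicator \<Omega> x * ennreal (norm (w x - T M (w x)) powr p)
          + indicator \<Omega> x * ennreal (norm (T M (w x) - T M (G n x)) powr p))"
        using ennreal_norm_add_powr_le[of p "w x - T M (w x)" "T M (w x) - T M (G n x)"] p
        by (cases "x \<in> \<Omega>") auto
    qed
    also have "\<dots> = ennreal (2 powr p) * ((\<integral>\<^sup>+x. indicator \<Omega> x * ennreal (norm (w x - T M (w x)) powr p) \<partial>lborel)
          + (\<integral>\<^sup>+x. indicator \<Omega> x * ennreal (norm (T M (w x) - T M (G n x)) powr p) \<partial>lborel))"
      using TGm by (simp add: nn_integral_cmult nn_integral_add)
    also have "\<dots> < ennreal (2 powr p) * (ennreal ?e + ennreal ?e)"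
      by (intro ennreal_mult_strict_left_mono add_strict_mono M(2) n) auto
    also have "\<dots> = ennreal e"
      using \<open>0 < e\<close> by (simp add: ennreal_mult[symmetric] ennreal_plus[symmetric] del: ennreal_plus)
    finally show "(\<integral>\<^sup>+x. indicator \<Omega> x * ennreal (norm (w x - T M (G n x)) powr p) \<partial>lborel) < ennreal e" .
  qed
qed


lemma nn_integral_moll_lborel_swap:
  fixes h :: "real^'n \<Rightarrow> 'e::euclidean_space \<Rightarrow> ennreal"
  assumes [measurable]: "(\<lambda>(z, \<xi>). h z \<xi>) \<in> borel_measurable (borel \<Otimes>\<^sub>M borel)"
  shows "(\<integral>\<^sup>+\<xi>. (\<integral>\<^sup>+z. h z \<xi> \<partial>moll) \<partial>lborel) = (\<integral>\<^sup>+z. (\<integral>\<^sup>+\<xi>. h z \<xi> \<partial>lborel) \<partial>moll)"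
proof -
  interpret pair_sigma_finite "moll :: (real^'n) measure" "lborel :: 'e measure"
    unfolding pair_sigma_finite_def using moll.sigma_finite_measure_axioms sigma_finite_lborel by blast
  show ?thesis by (rule Fubini') measurable
qed

text \<open>The point to which averaging at scale \<open>t\<close> moves \<open>\<xi>\<close>. For \<open>L = id\<close> these are the points that enter a mollification
  combined with a dilation; for \<open>L z = (z, z)\<close> both entries of a pair are moved in parallel, which
  covers difference quotients.\<close>

definition slide :: "('n::real_normed_vector \<Rightarrow> 'e::real_normed_vector) \<Rightarrow> real \<Rightarrow> 'n \<Rightarrow> 'e \<Rightarrow> 'e"
  where "slide L t z \<xi> = (1 - t) *\<^sub>R \<xi> + t *\<^sub>R L z"

text \<open>Approximate \<open>w\<close> in \<open>L\<^sup>p\<close> by a continuous \<open>g\<close>. The averages of \<open>w - g\<close> are as small as \<open>w - g\<close> itself, by Jensen's inequality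
  and the change of variables \<open>\<xi> \<mapsto> slide L t z \<xi>\<close>, and the averages of \<open>g\<close> converge uniformly. The factor \<open>c t\<close> accounts for the power of
  \<open>1 - t\<close> that a dilation produces in a derivative or in a difference quotient.\<close>

lemma mollify_tendsto_Lp:
  fixes w :: "'e::euclidean_space \<Rightarrow> 'b::euclidean_space" and L :: "real^'n \<Rightarrow> 'e"
  assumes w [measurable]: "w \<in> borel_measurable borel" and "open \<Omega>" "bounded \<Omega>" and L: "bounded_linear L"
    and p: "1 < p" and fin: "(\<integral>\<^sup>+x. indicator \<Omega> x * ennreal (norm (w x) powr p) \<partial>lborel) < \<infinity>"
    and inside: "\<And>t z \<xi>. 0 < t \<Longrightarrow> t < 1 \<Longrightarrow> norm z \<le> 1/2 \<Longrightarrow> \<xi> \<in> \<Omega> \<Longrightarrow> slide L t z \<xi> \<in> \<Omega>"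
    and int: "\<And>t \<xi>. 0 < t \<Longrightarrow> t \<le> 1/2 \<Longrightarrow> \<xi> \<in> \<Omega> \<Longrightarrow> integrable moll (\<lambda>z. w (slide L t z \<xi>))"
    and c: "(c \<longlongrightarrow> 1) (at_right 0)"
  shows "((\<lambda>t. \<integral>\<^sup>+\<xi>. indicator \<Omega> \<xi> * ennreal (norm (c t *\<^sub>R (\<integral>z. w (slide L t z \<xi>) \<partial>moll) - w \<xi>) powr p) \<partial>lborel)
    \<longlongrightarrow> 0) (at_right 0)"
proof (rule tendsto_zero_ennreal)
  fix r :: real assume "0 < r"
  have [measurable]: "\<Omega> \<in> sets borel" using \<open>open \<Omega>\<close> by simp
  have [measurable]: "L \<in> borel_measurable borel"
    by (intro borel_measurable_continuous_onI linear_continuous_on L)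
  have [measurable]: "slide L t z \<in> borel_measurable borel" for t z unfolding slide_def by measurable
  define C where "C = 2 powr p"
  have C: "C > 0" by (simp add: C_def)
  define D where "D = (2::real) ^ DIM('e)"
  \<comment> \<open>chosen for the last bound of this proof, \<open>C * C * (2 powr p * D + 2) * e\<close>\<close>
  define e where "e = r / (2 * (C * C * (2 powr p * D + 2)))"
  have D: "D > 0" by (simp add: D_def)
  have "C * C * (2 powr p * D + 2) > 0" using C D by (intro mult_pos_pos add_pos_pos) auto
  then have e: "e > 0" using \<open>0 < r\<close> by (simp add: e_def)
  obtain g where g: "continuous_on UNIV g"
    "(\<integral>\<^sup>+x. indicator \<Omega> x * ennreal (norm (w x - g x) powr p) \<partial>lborel) < ennreal e"
    using Lp_approx_continuous[of w \<Omega> p e] fin p e \<open>bounded \<Omega>\<close> by auto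
  have [measurable]: "g \<in> borel_measurable borel" using g(1) by (rule borel_measurable_continuous_onI)
  let ?d = "\<lambda>x. indicator \<Omega> x * ennreal (norm (w x - g x) powr p)"
  define V where "V = measure lborel \<Omega>"
  have V: "emeasure lborel \<Omega> = ennreal V"
    unfolding V_def using emeasure_bounded_finite[OF \<open>bounded \<Omega>\<close>] by (intro emeasure_eq_ennreal_measure) auto
  have V0: "V \<ge> 0" by (simp add: V_def)
  define e2 where "e2 = (e / (V + 1)) powr (1 / p)"
  have e2: "e2 > 0" "e2 powr p = e / (V + 1)" using e V0 p by (auto simp: e2_def powr_powr)
  obtain R where R: "R > 0" "\<And>x. x \<in> \<Omega> \<Longrightarrow> norm x \<le> R" using \<open>bounded \<Omega>\<close> by (auto simp: bounded_pos)
  have "bounded (g ` cball 0 R)"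
    by (intro compact_imp_bounded compact_continuous_image continuous_on_subset[OF g(1)]) auto
  then obtain G where G: "G > 0" "\<And>x. norm x \<le> R \<Longrightarrow> norm (g x) \<le> G" by (auto simp: bounded_pos)
  have "uniformly_continuous_on (cball 0 R) g"
    by (intro compact_uniformly_continuous continuous_on_subset[OF g(1)]) auto
  then obtain d where d: "d > 0" "\<And>x y. norm x \<le> R \<Longrightarrow> norm y \<le> R \<Longrightarrow> dist x y < d \<Longrightarrow> dist (g x) (g y) < e2 / 2"
    unfolding uniformly_continuous_on_def using half_gt_zero[OF e2(1)] by (metis dist_commute mem_cball_0)
  obtain K where K: "K > 0" "\<And>x. norm (L x) \<le> norm x * K" using bounded_linear.pos_bounded[OF L] by blast
  define t0 where "t0 = min (1/2) (d / (2 * (R + K)))"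
  have t0: "t0 > 0" using d(1) R(1) K(1) by (simp add: t0_def)
  have "\<forall>\<^sub>F t in at_right (0::real). 0 < t" by (rule eventually_at_right_less)
  moreover have "\<forall>\<^sub>F t in at_right 0. t < t0" using t0 by (intro eventually_at_rightI[of 0 t0]) auto
  moreover have "\<forall>\<^sub>F t in at_right 0. dist (c t) 1 < min 1 (e2 / (2 * G))"
    using c e2(1) G(1) by (intro tendstoD) auto
  ultimately show "\<forall>\<^sub>F t in at_right 0. (\<integral>\<^sup>+\<xi>. indicator \<Omega> \<xi> *
      ennreal (norm (c t *\<^sub>R (\<integral>z. w (slide L t z \<xi>) \<partial>moll) - w \<xi>) powr p) \<partial>lborel) < ennreal r"
  proof eventually_elim
    case (elim t)
    have t: "0 < t" "t < 1" "t \<le> 1/2" "t * (R + K) < d"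
    proof -
      show "0 < t" "t < 1" "t \<le> 1/2" using elim by (auto simp: t0_def)
      have "t < d / (R + K)"
        using elim d(1) R(1) K(1) by (auto simp: t0_def field_simps)
      then show "t * (R + K) < d" using R(1) K(1) by (simp add: field_simps)
    qed
    have ct: "\<bar>c t\<bar> \<le> 2" "\<bar>c t - 1\<bar> * G \<le> e2 / 2"
      using elim G(1) by (auto simp: dist_real_def field_simps)
    have unif: "norm (c t *\<^sub>R g (slide L t z \<xi>) - g \<xi>) \<le> e2" if "norm z \<le> 1/2" "\<xi> \<in> \<Omega>" for z \<xi>
    proof -
      have in\<Omega>: "slide L t z \<xi> \<in> \<Omega>" using inside t that by blast
      have "slide L t z \<xi> - \<xi> = t *\<^sub>R (L z - \<xi>)" by (simp add: slide_def algebra_simps)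
      then have "dist (slide L t z \<xi>) \<xi> = t * norm (L z - \<xi>)" using t by (simp add: dist_norm)
      also have "norm (L z - \<xi>) \<le> K + R"
      proof -
        have "norm (L z) \<le> 1 * K" using that K(1) by (intro order_trans[OF K(2)] mult_right_mono) auto
        then show ?thesis using norm_triangle_ineq4[of "L z" \<xi>] R(2)[OF that(2)] by simp
      qed
      finally have "dist (slide L t z \<xi>) \<xi> < d" using t by (simp add: add.commute mult_left_mono)
      then have "norm (g (slide L t z \<xi>) - g \<xi>) \<le> e2 / 2"
        using d(2)[OF R(2)[OF in\<Omega>] R(2)[OF that(2)]] by (simp add: dist_norm)
      moreover have "norm ((c t - 1) *\<^sub>R g (slide L t z \<xi>)) \<le> e2 / 2"
        using G(2)[OF R(2)[OF in\<Omega>]] ct(2) mult_left_mono[of "norm (g (slide L t z \<xi>))" G "\<bar>c t - 1\<bar>"] by simp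
      moreover have eq: "c t *\<^sub>R g (slide L t z \<xi>) - g \<xi> = (c t - 1) *\<^sub>R g (slide L t z \<xi>) + (g (slide L t z \<xi>) - g \<xi>)"
        by (simp add: algebra_simps)
      ultimately show ?thesis unfolding eq
        using norm_triangle_ineq[of "(c t - 1) *\<^sub>R g (slide L t z \<xi>)" "g (slide L t z \<xi>) - g \<xi>"] by linarith
    qed
    have point: "indicator \<Omega> \<xi> * ennreal (norm (c t *\<^sub>R w (slide L t z \<xi>) - w \<xi>) powr p)
        \<le> ennreal (C * C) * (ennreal (2 powr p) * ?d (slide L t z \<xi>) + ennreal (e / (V + 1)) * indicator \<Omega> \<xi> + ?d \<xi>)"
      if z: "norm z \<le> 1/2" for z \<xi>
    proof (cases "\<xi> \<in> \<Omega>")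
      case True
      let ?s = "slide L t z \<xi>"
      have in\<Omega>: "?s \<in> \<Omega>" using inside t z True by blast
      have "c t *\<^sub>R w ?s - w \<xi> = c t *\<^sub>R (w ?s - g ?s) + ((c t *\<^sub>R g ?s - g \<xi>) + (g \<xi> - w \<xi>))"
        by (simp add: algebra_simps)
      then have "ennreal (norm (c t *\<^sub>R w ?s - w \<xi>) powr p) \<le> ennreal C * (ennreal (norm (c t *\<^sub>R (w ?s - g ?s)) powr p)
          + ennreal (norm ((c t *\<^sub>R g ?s - g \<xi>) + (g \<xi> - w \<xi>)) powr p))"
        unfolding C_def using p by (simp only: ennreal_norm_add_powr_le)
      also have "\<dots> \<le> ennreal C * (ennreal C * (ennreal (2 powr p) * ennreal (norm (w ?s - g ?s) powr p))
          + ennreal C * (ennreal (e / (V + 1)) + ennreal (norm (w \<xi> - g \<xi>) powr p)))"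
      proof (intro mult_left_mono add_mono)
        have "norm (c t *\<^sub>R (w ?s - g ?s)) powr p \<le> (2 * norm (w ?s - g ?s)) powr p"
          using ct p by (intro powr_mono2) (auto intro: mult_right_mono)
        also have "\<dots> = 2 powr p * norm (w ?s - g ?s) powr p" by (simp add: powr_mult)
        also have "\<dots> \<le> C * (2 powr p * norm (w ?s - g ?s) powr p)"
          using mult_right_mono[of 1 C "2 powr p * norm (w ?s - g ?s) powr p"] p
          by (simp add: C_def ge_one_powr_ge_zero)
        finally show "ennreal (norm (c t *\<^sub>R (w ?s - g ?s)) powr p)
            \<le> ennreal C * (ennreal (2 powr p) * ennreal (norm (w ?s - g ?s) powr p))"
          using C by (simp add: ennreal_mult[symmetric] ennreal_leI)
        have "norm (c t *\<^sub>R g ?s - g \<xi>) powr p \<le> e2 powr p"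
          using unif[OF z True] p by (intro powr_mono2) auto
        then have "ennreal (norm (c t *\<^sub>R g ?s - g \<xi>) powr p) \<le> ennreal (e / (V + 1))"
          by (simp add: e2(2) ennreal_leI)
        then show "ennreal (norm ((c t *\<^sub>R g ?s - g \<xi>) + (g \<xi> - w \<xi>)) powr p)
            \<le> ennreal C * (ennreal (e / (V + 1)) + ennreal (norm (w \<xi> - g \<xi>) powr p))"
          unfolding C_def using ennreal_norm_add_powr_le[of p "c t *\<^sub>R g ?s - g \<xi>" "g \<xi> - w \<xi>"] p
          by (auto simp: norm_minus_commute[of "g \<xi>" "w \<xi>"] intro!: mult_left_mono add_mono elim!: order_trans)
      qed auto
      finally show ?thesis using True in\<Omega> C by (simp add: ennreal_mult algebra_simps)
    qed simp
    have meas_s: "(\<lambda>(z, \<xi>). slide L t z \<xi>) \<in> borel_measurable (borel \<Otimes>\<^sub>M borel)"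
      unfolding slide_def by measurable
    have [measurable]: "(\<lambda>x. slide L t (fst x) (snd x)) \<in> borel_measurable (borel \<Otimes>\<^sub>M borel)"
      using meas_s by (simp add: case_prod_unfold)
    have "(\<integral>\<^sup>+\<xi>. indicator \<Omega> \<xi> * ennreal (norm (c t *\<^sub>R (\<integral>z. w (slide L t z \<xi>) \<partial>moll) - w \<xi>) powr p) \<partial>lborel)
      \<le> (\<integral>\<^sup>+\<xi>. (\<integral>\<^sup>+z. indicator \<Omega> \<xi> * ennreal (norm (c t *\<^sub>R w (slide L t z \<xi>) - w \<xi>) powr p) \<partial>moll) \<partial>lborel)"
    proof (rule nn_integral_mono)
      fix \<xi>
      show "indicator \<Omega> \<xi> * ennreal (norm (c t *\<^sub>R (\<integral>z. w (slide L t z \<xi>) \<partial>moll) - w \<xi>) powr p)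
        \<le> (\<integral>\<^sup>+z. indicator \<Omega> \<xi> * ennreal (norm (c t *\<^sub>R w (slide L t z \<xi>) - w \<xi>) powr p) \<partial>moll)"
      proof (cases "\<xi> \<in> \<Omega>")
        case True
        have i: "integrable moll (\<lambda>z. w (slide L t z \<xi>))" using int t True by blast
        have "c t *\<^sub>R (\<integral>z. w (slide L t z \<xi>) \<partial>moll) - w \<xi> = (\<integral>z. c t *\<^sub>R w (slide L t z \<xi>) - w \<xi> \<partial>moll)"
          using i by (subst Bochner_Integration.integral_diff) (auto simp: moll.prob_space[unfolded space_moll])
        moreover have "(\<lambda>z. c t *\<^sub>R w (slide L t z \<xi>) - w \<xi>) \<in> borel_measurable moll"
          using borel_measurable_integrable[OF i] by auto
        ultimately show ?thesis
          using True moll.norm_integral_powr_le[OF p, of "\<lambda>z. c t *\<^sub>R w (slide L t z \<xi>) - w \<xi>"] by simp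
      qed simp
    qed
    also have "\<dots> = (\<integral>\<^sup>+z. (\<integral>\<^sup>+\<xi>. indicator \<Omega> \<xi> * ennreal (norm (c t *\<^sub>R w (slide L t z \<xi>) - w \<xi>) powr p) \<partial>lborel) \<partial>moll)"
      by (rule nn_integral_moll_lborel_swap) (simp add: case_prod_unfold)
    also have "\<dots> \<le> (\<integral>\<^sup>+z. ennreal (C * C * (2 powr p * D + 2) * e) \<partial>(moll :: (real^'n) measure))"
    proof (rule nn_integral_mono_AE)
      show "AE z in moll. (\<integral>\<^sup>+\<xi>. indicator \<Omega> \<xi> * ennreal (norm (c t *\<^sub>R w (slide L t z \<xi>) - w \<xi>) powr p) \<partial>lborel)
          \<le> ennreal (C * C * (2 powr p * D + 2) * e)"
        using AE_moll
      proof (rule eventually_mono)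
        fix z :: "real^'n" assume z: "norm z \<le> 1/2"
        have aff: "(\<integral>\<^sup>+\<xi>. ?d (slide L t z \<xi>) \<partial>lborel) \<le> ennreal (D * e)"
        proof -
          have "ennreal ((1 - t) ^ DIM('e)) * (\<integral>\<^sup>+\<xi>. ?d (slide L t z \<xi>) \<partial>lborel) = (\<integral>\<^sup>+\<xi>. ?d \<xi> \<partial>lborel)"
            using nn_integral_affine[of ?d "1 - t" "t *\<^sub>R L z"] t by (simp add: slide_def add.commute)
          also have "\<dots> \<le> ennreal e" using g(2) by simp
          finally have 1: "ennreal ((1 - t) ^ DIM('e)) * (\<integral>\<^sup>+\<xi>. ?d (slide L t z \<xi>) \<partial>lborel) \<le> ennreal e" .
          have "1 \<le> D * (1 - t) ^ DIM('e)"
            unfolding D_def power_mult_distrib[symmetric] using t by (intro one_le_power) auto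
          then have "1 * (\<integral>\<^sup>+\<xi>. ?d (slide L t z \<xi>) \<partial>lborel) \<le> ennreal (D * (1 - t) ^ DIM('e)) * (\<integral>\<^sup>+\<xi>. ?d (slide L t z \<xi>) \<partial>lborel)"
            by (intro mult_right_mono) (auto simp: ennreal_1[symmetric] simp del: ennreal_1 intro!: ennreal_leI)
          also have "\<dots> = ennreal D * (ennreal ((1 - t) ^ DIM('e)) * (\<integral>\<^sup>+\<xi>. ?d (slide L t z \<xi>) \<partial>lborel))"
            using D t by (simp add: ennreal_mult mult.assoc)
          also have "\<dots> \<le> ennreal D * ennreal e" using 1 by (rule mult_left_mono) simp
          also have "\<dots> = ennreal (D * e)" using D e by (simp add: ennreal_mult)
          finally show ?thesis by simp
        qed
        have "(\<integral>\<^sup>+\<xi>. indicator \<Omega> \<xi> * ennreal (norm (c t *\<^sub>R w (slide L t z \<xi>) - w \<xi>) powr p) \<partial>lborel)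
          \<le> (\<integral>\<^sup>+\<xi>. ennreal (C * C) * (ennreal (2 powr p) * ?d (slide L t z \<xi>) + ennreal (e / (V + 1)) * indicator \<Omega> \<xi> + ?d \<xi>) \<partial>lborel)"
          by (rule nn_integral_mono) (rule point[OF z])
        also have "\<dots> = ennreal (C * C) * (ennreal (2 powr p) * (\<integral>\<^sup>+\<xi>. ?d (slide L t z \<xi>) \<partial>lborel)
            + ennreal (e / (V + 1)) * ennreal V + (\<integral>\<^sup>+\<xi>. ?d \<xi> \<partial>lborel))"
          by (simp add: nn_integral_cmult nn_integral_add V)
        also have "\<dots> \<le> ennreal (C * C) * (ennreal (2 powr p) * ennreal (D * e) + ennreal e + ennreal e)"
        proof (intro mult_left_mono add_mono aff)
          show "ennreal (e / (V + 1)) * ennreal V \<le> ennreal e"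
            using e V0 by (simp add: ennreal_mult[symmetric] field_simps ennreal_leI)
        qed (use g(2) in auto)
        also have "\<dots> = ennreal (C * C * (2 powr p * D + 2) * e)"
          using C D e by (simp add: ennreal_mult[symmetric] ennreal_plus[symmetric] algebra_simps del: ennreal_plus)
        finally show "(\<integral>\<^sup>+\<xi>. indicator \<Omega> \<xi> * ennreal (norm (c t *\<^sub>R w (slide L t z \<xi>) - w \<xi>) powr p) \<partial>lborel)
          \<le> ennreal (C * C * (2 powr p * D + 2) * e)" .
      qed
    qed
    also have "\<dots> = ennreal (C * C * (2 powr p * D + 2) * e)"
      by (simp add: moll.emeasure_space_1[unfolded space_moll])
    also have "C * C * (2 powr p * D + 2) * e = r / 2"
    proof -
      have "Q * (r / (2 * Q)) = r / 2" if "Q > 0" for Q :: real using that by simp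
      moreover have "C * C * (2 powr p * D + 2) > 0" using C D by (intro mult_pos_pos add_pos_pos) auto
      ultimately show ?thesis unfolding e_def by blast
    qed
    also have "ennreal (r / 2) < ennreal r" using \<open>0 < r\<close> by (simp add: ennreal_less_iff)
    finally show ?case .
  qed
qed

section \<open>Smooth approximation in fractional Sobolev spaces\<close>

definition scaled_mollifier :: "real \<Rightarrow> real^'n \<Rightarrow> real"
  where "scaled_mollifier t w = (1 / t ^ CARD('n)) * mollifier ((1 / t) *\<^sub>R w)"

lemma smooth_scaled_mollifier: "smooth_on UNIV (scaled_mollifier t :: real^'n \<Rightarrow> real)"
  unfolding scaled_mollifier_def
proof (intro smooth_on_mult smooth_on_const smooth_on_compose[OF smooth_mollifier])
  show "smooth_on UNIV (\<lambda>x :: real^'n. ((1 / t) *\<^sub>R x) $ i)" for i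
    using smooth_on_mult[OF smooth_on_const[of "1 / t"] smooth_on_component[of i]] by simp
qed

lemma zero_beyond_scaled_mollifier:
  assumes "t > 0"
  shows "zero_beyond (t/2) (scaled_mollifier t :: real^'n \<Rightarrow> real)"
  unfolding zero_beyond_def
proof (intro allI impI)
  fix x :: "real^'n" assume "t / 2 < norm x"
  then have "1/2 < norm ((1 / t) *\<^sub>R x)" using assms by (simp add: field_simps)
  then show "scaled_mollifier t x = 0"
    using zero_beyondD[OF zero_beyond_mollifier] unfolding scaled_mollifier_def by (metis mult_zero_right)
qed

lemma lborel_integral_affine:
  fixes f :: "'a::euclidean_space \<Rightarrow> real"
  assumes [measurable]: "f \<in> borel_measurable borel" and "c > 0"
  shows "(\<integral>x. f x \<partial>lborel) = (\<integral>x. c ^ DIM('a) * f (b + c *\<^sub>R x) \<partial>lborel)"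
    and "integrable lborel f \<longleftrightarrow> integrable lborel (\<lambda>x. c ^ DIM('a) * f (b + c *\<^sub>R x))"
proof -
  have e: "lborel = density (distr lborel borel (\<lambda>x. b + c *\<^sub>R x)) (\<lambda>_. ennreal (c^DIM('a)))"
    using lborel_affine[of c b] \<open>c > 0\<close> by simp
  have "(\<integral>x. f x \<partial>lborel) = (\<integral>x. f x \<partial>density (distr lborel borel (\<lambda>x. b + c *\<^sub>R x)) (\<lambda>_. ennreal (c^DIM('a))))"
    by (subst (1) e) simp
  also have "\<dots> = (\<integral>x. c ^ DIM('a) * f (b + c *\<^sub>R x) \<partial>lborel)"
    using \<open>c > 0\<close> by (subst integral_density) (auto simp: integral_distr)
  finally show "(\<integral>x. f x \<partial>lborel) = (\<integral>x. c ^ DIM('a) * f (b + c *\<^sub>R x) \<partial>lborel)" .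
  have "integrable lborel f \<longleftrightarrow> integrable (density (distr lborel borel (\<lambda>x. b + c *\<^sub>R x)) (\<lambda>_. ennreal (c^DIM('a)))) f"
    by (subst (1) e) simp
  also have "\<dots> \<longleftrightarrow> integrable lborel (\<lambda>x. c ^ DIM('a) * f (b + c *\<^sub>R x))"
    using \<open>c > 0\<close> by (subst integrable_density) (auto simp: integrable_distr_eq)
  finally show "integrable lborel f \<longleftrightarrow> integrable lborel (\<lambda>x. c ^ DIM('a) * f (b + c *\<^sub>R x))" .
qed

abbreviation shift_ball :: "real \<Rightarrow> real^'n \<Rightarrow> real^'n \<Rightarrow> real^'n"
  where "shift_ball \<equiv> slide (\<lambda>z. z)"

text \<open>Substitute \<open>y = (1 - t) x + t z\<close>.\<close>

lemma dconv_scaled_mollifier: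
  fixes v :: "real^'n \<Rightarrow> real"
  assumes "t > 0" and v: "integrable lborel v"
  shows "dconv (scaled_mollifier t) (1 - t) v x = (\<integral>z. v (shift_ball t z x) \<partial>moll)"
    and "integrable moll (\<lambda>z. v (shift_ball t z x))"
proof -
  let ?f = "\<lambda>y. scaled_mollifier t (y - (1 - t) *\<^sub>R x) * v y"
  have [measurable]: "v \<in> borel_measurable borel" using v by auto
  have [measurable]: "shift_ball t z \<in> borel_measurable borel" "(\<lambda>z. shift_ball t z x) \<in> borel_measurable borel" for z
    unfolding slide_def by measurable
  have [measurable]: "scaled_mollifier t \<in> borel_measurable borel"
    by (intro borel_measurable_continuous_onI smooth_on_continuous smooth_scaled_mollifier)
  have i: "integrable lborel ?f"
    by (rule integrable_dconv[OF smooth_on_continuous[OF smooth_scaled_mollifier] zero_beyond_scaled_mollifier[OF \<open>t > 0\<close>] v])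
  have e: "t ^ DIM(real^'n) * ?f ((1 - t) *\<^sub>R x + t *\<^sub>R z) = mollifier z * v (shift_ball t z x)" for z
    using \<open>t > 0\<close> by (simp add: scaled_mollifier_def slide_def)
  have d: "(moll :: (real^'n) measure) = density lborel (\<lambda>z. ennreal (mollifier z))" by (rule moll_def)
  show "integrable moll (\<lambda>z. v (shift_ball t z x))"
    using i lborel_integral_affine(2)[of ?f t "(1 - t) *\<^sub>R x"] \<open>t > 0\<close>
    unfolding d e by (subst integrable_density) (auto simp: mollifier_nonneg)
  show "dconv (scaled_mollifier t) (1 - t) v x = (\<integral>z. v (shift_ball t z x) \<partial>moll)"
    using lborel_integral_affine(1)[of ?f t "(1 - t) *\<^sub>R x"] \<open>t > 0\<close>
    unfolding d e dconv_def by (subst integral_density) (auto simp: mollifier_nonneg)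
qed

lemma integrable_vec_nth: "integrable M (f :: _ \<Rightarrow> ('b::euclidean_space)^'m) \<Longrightarrow> integrable M (\<lambda>x. f x $ i)"
  by (rule integrable_bounded_linear[OF bounded_linear_vec_nth])

lemma bounded_linear_axis: "bounded_linear (axis i :: 'b::euclidean_space \<Rightarrow> 'b^'m)"
  unfolding linear_conv_bounded_linear[symmetric]
  by (rule linearI) (auto simp: axis_def vec_eq_iff)

lemma integrable_vecI:
  fixes f :: "'a \<Rightarrow> ('b::euclidean_space)^'m"
  assumes "\<And>i. integrable M (\<lambda>x. f x $ i)"
  shows "integrable M f"
proof -
  have "integrable M (\<lambda>x. \<Sum>i\<in>UNIV. axis i (f x $ i))"
    by (intro Bochner_Integration.integrable_sum integrable_bounded_linear[OF bounded_linear_axis] assms)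
  moreover have "(\<Sum>i\<in>UNIV. axis i (y $ i)) = y" for y :: "'b^'m"
    by (simp add: vec_eq_iff axis_def if_distrib sum.delta cong: if_cong)
  ultimately show ?thesis by simp
qed

definition smoothen :: "real \<Rightarrow> (real^'n \<Rightarrow> real^'m) \<Rightarrow> real^'n \<Rightarrow> real^'m"
  where "smoothen t v x = (\<chi> i. dconv (scaled_mollifier t) (1 - t) (\<lambda>y. v y $ i) x)"

lemma smooth_smoothen_component:
  fixes v :: "real^'n \<Rightarrow> real^'m"
  assumes "t > 0" "integrable lborel v"
  shows "smooth_on UNIV (\<lambda>x. smoothen t v x $ i)"
  unfolding smoothen_def vec_lambda_beta
  by (rule smooth_dconv[OF smooth_scaled_mollifier zero_beyond_scaled_mollifier[OF assms(1)] integrable_vec_nth[OF assms(2)]])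

lemma smooth_smoothen:
  fixes v :: "real^'n \<Rightarrow> real^'m"
  assumes "t > 0" "integrable lborel v"
  shows "smooth_on UNIV (smoothen t v)"
  using smooth_on_vector smooth_smoothen_component[OF assms] by blast

lemma smoothen_eq_average:
  fixes v :: "real^'n \<Rightarrow> real^'m"
  assumes "t > 0" "integrable lborel v"
  shows "smoothen t v x = (\<integral>z. v (shift_ball t z x) \<partial>moll)"
    and "integrable moll (\<lambda>z. v (shift_ball t z x))"
proof -
  have 1: "integrable moll (\<lambda>z. v (shift_ball t z x) $ i)" for i
    using dconv_scaled_mollifier(2)[OF assms(1) integrable_vec_nth[OF assms(2)]] .
  then show i: "integrable moll (\<lambda>z. v (shift_ball t z x))" by (rule integrable_vecI)
  have "(\<integral>z. v (shift_ball t z x) \<partial>moll) $ j = smoothen t v x $ j" for j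
    unfolding smoothen_def using dconv_scaled_mollifier(1)[OF assms(1) integrable_vec_nth[OF assms(2), of j], of x]
      integral_bounded_linear[OF bounded_linear_vec_nth i, of j] by simp
  then show "smoothen t v x = (\<integral>z. v (shift_ball t z x) \<partial>moll)" by (simp add: vec_eq_iff)
qed

lemma nn_integral_lebesgue_on:
  assumes "\<Omega> \<in> sets borel"
  shows "(\<integral>\<^sup>+x. f x \<partial>lebesgue_on \<Omega>) = (\<integral>\<^sup>+x. indicator \<Omega> x * f x \<partial>lborel)"
  using assms by (subst nn_integral_restrict_space) (auto simp: nn_integral_completion mult.commute)

lemma ennroot_tendsto_0:
  assumes "p > 0" "(I \<longlongrightarrow> 0) F"
  shows "((\<lambda>t. ennroot p (I t)) \<longlongrightarrow> 0) F"
proof (rule tendsto_zero_ennreal)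
  fix r :: real assume "r > 0"
  then have "\<forall>\<^sub>F t in F. I t < ennreal (r powr p)"
    using assms(2) by (intro order_tendstoD(2)) auto
  then show "\<forall>\<^sub>F t in F. ennroot p (I t) < ennreal r"
  proof (rule eventually_mono)
    fix t assume t: "I t < ennreal (r powr p)"
    then have fin: "I t \<noteq> \<infinity>" by auto
    then have "enn2real (I t) < r powr p"
      using t \<open>r > 0\<close> by (cases "I t") (auto simp: ennreal_less_iff)
    then have "enn2real (I t) powr (1 / p) < (r powr p) powr (1 / p)"
      using \<open>p > 0\<close> by (intro powr_less_mono2) auto
    also have "\<dots> = r" using \<open>p > 0\<close> \<open>r > 0\<close> by (simp add: powr_powr)
    finally show "ennroot p (I t) < ennreal r" using fin \<open>r > 0\<close> by (simp add: ennroot_def ennreal_less_iff)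
  qed
qed

lemma ennroot_finite: "ennroot p I < \<infinity> \<longleftrightarrow> I < \<infinity>"
  by (auto simp: ennroot_def less_top)

definition zero_extension :: "(real^'n \<Rightarrow> 'b::zero) \<Rightarrow> real^'n \<Rightarrow> 'b"
  where "zero_extension u x = (if x \<in> ball 0 1 then u x else 0)"

lemma measurable_zero_extension:
  fixes u :: "real^'n \<Rightarrow> 'b::euclidean_space"
  assumes "continuous_on (ball 0 1) u"
  shows "zero_extension u \<in> borel_measurable borel"
  unfolding zero_extension_def using assms by (intro borel_measurable_continuous_on_if) auto

lemma shift_ball_in_ball:
  assumes "0 < t" "t < 1" "norm z \<le> 1/2" "x \<in> ball 0 1"
  shows "shift_ball t z x \<in> ball 0 1"
proof -
  have "norm (shift_ball t z x) \<le> (1 - t) * norm x + t * norm z"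
    unfolding slide_def using norm_triangle_ineq[of "(1 - t) *\<^sub>R x" "t *\<^sub>R z"] assms by simp
  also have "t * norm z \<le> t * (1/2)" using assms by (intro mult_left_mono) auto
  also have "(1 - t) * norm x \<le> (1 - t) * 1" using assms by (intro mult_left_mono) auto
  finally have "norm (shift_ball t z x) \<le> (1 - t) * 1 + t * (1/2)" by simp
  also have "\<dots> < 1" using assms by simp
  finally show ?thesis by simp
qed

lemma nn_integral_powr_finite_imp_integrable:
  fixes f :: "'a::euclidean_space \<Rightarrow> 'b::euclidean_space"
  assumes [measurable]: "f \<in> borel_measurable borel" "\<Omega> \<in> sets borel" and "bounded \<Omega>"
    and p: "1 \<le> p" and zero: "\<And>x. x \<notin> \<Omega> \<Longrightarrow> f x = 0"
    and fin: "(\<integral>\<^sup>+x. indicator \<Omega> x * ennreal (norm (f x) powr p) \<partial>lborel) < \<infinity>"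
  shows "integrable lborel f"
proof (rule integrableI_bounded)
  have "(\<integral>\<^sup>+x. ennreal (norm (f x)) \<partial>lborel)
      \<le> (\<integral>\<^sup>+x. indicator \<Omega> x + indicator \<Omega> x * ennreal (norm (f x) powr p) \<partial>lborel)"
  proof (rule nn_integral_mono)
    fix x
    show "ennreal (norm (f x)) \<le> indicator \<Omega> x + indicator \<Omega> x * ennreal (norm (f x) powr p)"
    proof (cases "x \<in> \<Omega>")
      case True
      have "norm (f x) \<le> 1 + norm (f x) powr p"
        using le_one_add_powr[of "norm (f x)" p] p by simp
      then have "ennreal (norm (f x)) \<le> ennreal (1 + norm (f x) powr p)" by (rule ennreal_leI)
      then show ?thesis using True by simp
    qed (simp add: zero)
  qed
  also have "\<dots> = emeasure lborel \<Omega> + (\<integral>\<^sup>+x. indicator \<Omega> x * ennreal (norm (f x) powr p) \<partial>lborel)"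
    by (subst nn_integral_add) auto
  also have "\<dots> < \<infinity>" using fin emeasure_bounded_finite[OF \<open>bounded \<Omega>\<close>] by auto
  finally show "(\<integral>\<^sup>+x. ennreal (norm (f x)) \<partial>lborel) < \<infinity>" .
qed simp

lemma Lp_norm_ball:
  fixes f :: "real^'n \<Rightarrow> 'b::euclidean_space"
  shows "Lp_norm p (ball 0 1) f = ennroot p (\<integral>\<^sup>+x. indicator (ball 0 1) x * ennreal (norm (f x) powr p) \<partial>lborel)"
  unfolding Lp_norm_def by (subst nn_integral_lebesgue_on) auto

lemma zero_extension_finite:
  fixes u :: "real^'n \<Rightarrow> 'b::euclidean_space"
  assumes "Lp_norm p (ball 0 1) u < \<infinity>"
  shows "(\<integral>\<^sup>+x. indicator (ball 0 1) x * ennreal (norm (zero_extension u x) powr p) \<partial>lborel) < \<infinity>"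
proof -
  have "(\<integral>\<^sup>+x. indicator (ball 0 1) x * ennreal (norm (zero_extension u x) powr p) \<partial>lborel)
      = (\<integral>\<^sup>+x. indicator (ball 0 1) x * ennreal (norm (u x) powr p) \<partial>lborel)"
    by (rule nn_integral_cong) (auto simp: zero_extension_def indicator_def)
  then show ?thesis using assms by (simp add: Lp_norm_ball ennroot_finite[unfolded infinity_ennreal_def])
qed

lemma integrable_zero_extension:
  fixes u :: "real^'n \<Rightarrow> 'b::euclidean_space"
  assumes "continuous_on (ball 0 1) u" "Lp_norm p (ball 0 1) u < \<infinity>" "1 \<le> p"
  shows "integrable lborel (zero_extension u)"
  by (rule nn_integral_powr_finite_imp_integrable[OF measurable_zero_extension[OF assms(1)] _ bounded_ball assms(3) _
        zero_extension_finite[OF assms(2)]]) (auto simp: zero_extension_def)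

lemma smoothen_tendsto_Lp:
  fixes u :: "real^'n \<Rightarrow> real^'m"
  assumes u: "continuous_on (ball 0 1) u" "Lp_norm p (ball 0 1) u < \<infinity>" and p: "1 < p"
  shows "((\<lambda>t. Lp_norm p (ball 0 1) (\<lambda>x. smoothen t (zero_extension u) x - u x)) \<longlongrightarrow> 0) (at_right 0)"
  unfolding Lp_norm_ball
proof (rule ennroot_tendsto_0)
  have i: "integrable lborel (zero_extension u)" using u p by (intro integrable_zero_extension) auto
  let ?I = "\<lambda>t. \<integral>\<^sup>+x. indicator (ball 0 1) x * ennreal (norm (1 *\<^sub>R (\<integral>z. zero_extension u (shift_ball t z x) \<partial>moll) - zero_extension u x) powr p) \<partial>lborel"
  have "(?I \<longlongrightarrow> 0) (at_right 0)"
  proof (rule mollify_tendsto_Lp)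
    show "zero_extension u \<in> borel_measurable borel" by (rule measurable_zero_extension[OF u(1)])
    show "(\<integral>\<^sup>+x. indicator (ball 0 1) x * ennreal (norm (zero_extension u x) powr p) \<partial>lborel) < \<infinity>"
      by (rule zero_extension_finite[OF u(2)])
    show "integrable moll (\<lambda>z. zero_extension u (shift_ball t z x))" if "0 < t" for t x
      by (rule smoothen_eq_average(2)[OF that i])
    show "shift_ball t z x \<in> ball 0 1" if "0 < t" "t < 1" "norm z \<le> 1/2" "x \<in> ball 0 1" for t z and x :: "real^'n"
      by (rule shift_ball_in_ball[OF that])
  qed (use p in \<open>auto intro: bounded_linear_ident\<close>)
  then show "((\<lambda>t. \<integral>\<^sup>+x. indicator (ball 0 1) x * ennreal (norm (smoothen t (zero_extension u) x - u x) powr p) \<partial>lborel) \<longlongrightarrow> 0) (at_right 0)"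
  proof (rule Lim_transform_eventually)
    show "\<forall>\<^sub>F t in at_right 0. ?I t = (\<integral>\<^sup>+x. indicator (ball 0 1) x * ennreal (norm (smoothen t (zero_extension u) x - u x) powr p) \<partial>lborel)"
      using eventually_at_right_less[of "0::real"]
      by (rule eventually_mono) (auto intro!: nn_integral_cong simp: smoothen_eq_average[OF _ i] zero_extension_def indicator_def)
  qed
qed (use p in simp)

lemma nn_integral_ball_ball:
  fixes h :: "real^'n \<Rightarrow> real^'n \<Rightarrow> ennreal"
  assumes [measurable]: "(\<lambda>(x, y). indicator (ball 0 1 \<times> ball 0 1) (x, y) * h x y) \<in> borel_measurable borel"
  shows "(\<integral>\<^sup>+y. (\<integral>\<^sup>+x. h x y \<partial>lebesgue_on (ball 0 1)) \<partial>lebesgue_on (ball 0 1))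
    = (\<integral>\<^sup>+\<xi>. indicator (ball 0 1 \<times> ball 0 1) \<xi> * h (fst \<xi>) (snd \<xi>) \<partial>lborel)"
proof -
  let ?k = "\<lambda>\<xi>. indicator (ball 0 1 \<times> ball 0 1) \<xi> * h (fst \<xi>) (snd \<xi>)"
  have m: "?k \<in> borel_measurable (lborel \<Otimes>\<^sub>M lborel)"
    using assms by (simp add: lborel_prod case_prod_unfold)
  have "(\<integral>\<^sup>+y. (\<integral>\<^sup>+x. h x y \<partial>lebesgue_on (ball 0 1)) \<partial>lebesgue_on (ball 0 1))
      = (\<integral>\<^sup>+y. indicator (ball 0 1) y * (\<integral>\<^sup>+x. indicator (ball 0 1) x * h x y \<partial>lborel) \<partial>lborel)"
    by (simp add: nn_integral_lebesgue_on)
  also have "\<dots> = (\<integral>\<^sup>+y. (\<integral>\<^sup>+x. ?k (x, y) \<partial>lborel) \<partial>lborel)"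
    by (intro nn_integral_cong) (auto simp: indicator_def intro!: nn_integral_cong)
  also have "\<dots> = (\<integral>\<^sup>+\<xi>. ?k \<xi> \<partial>(lborel \<Otimes>\<^sub>M lborel))"
    by (rule lborel_pair.nn_integral_snd[OF m])
  finally show ?thesis by (simp add: lborel_prod)
qed

text \<open>The function whose \<open>L\<^sup>p\<close> norm on the product of two balls is the Gagliardo seminorm.\<close>

definition gagliardo_quotient :: "real \<Rightarrow> (real^'n \<Rightarrow> real^'m) \<Rightarrow> (real^'n) \<times> (real^'n) \<Rightarrow> real^'m"
  where "gagliardo_quotient \<gamma> f \<xi> = inverse (norm (fst \<xi> - snd \<xi>) powr \<gamma>) *\<^sub>R (f (fst \<xi>) - f (snd \<xi>))"

lemma norm_gagliardo_quotient:
  assumes "0 < p"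
  shows "norm (gagliardo_quotient (\<gamma> / p) f (x, y)) powr p = norm (f x - f y) powr p / norm (x - y) powr \<gamma>"
proof -
  have "inverse (norm (x - y) powr (\<gamma> / p)) powr p = inverse (norm (x - y) powr \<gamma>)"
    using assms by (simp add: inverse_powr powr_powr)
  then show ?thesis
    by (simp add: gagliardo_quotient_def powr_mult divide_inverse mult.commute)
qed

lemma measurable_gagliardo_quotient:
  fixes f :: "real^'n \<Rightarrow> real^'m"
  assumes "f \<in> borel_measurable borel"
  shows "gagliardo_quotient \<gamma> f \<in> borel_measurable borel"
proof -
  have "(\<lambda>\<xi>::(real^'n) \<times> (real^'n). f (fst \<xi>)) \<in> borel_measurable borel"
    "(\<lambda>\<xi>::(real^'n) \<times> (real^'n). f (snd \<xi>)) \<in> borel_measurable borel"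
    using assms by (auto simp: borel_prod[symmetric])
  moreover have "(\<lambda>\<xi>::(real^'n) \<times> (real^'n). norm (fst \<xi> - snd \<xi>) powr \<gamma>) \<in> borel_measurable borel"
  proof -
    have "(\<lambda>\<xi>::(real^'n) \<times> (real^'n). norm (fst \<xi> - snd \<xi>)) \<in> borel_measurable borel"
      by (intro borel_measurable_continuous_onI continuous_intros)
    moreover have "(\<lambda>r::real. r powr \<gamma>) \<in> borel_measurable borel" by measurable
    ultimately show ?thesis by (rule measurable_compose)
  qed
  ultimately show ?thesis unfolding gagliardo_quotient_def[abs_def]
    by (intro borel_measurable_scaleR borel_measurable_inverse borel_measurable_diff)
qed

lemma gagliardo_seminorm_eq:
  fixes f :: "real^'n \<Rightarrow> real^'m"
  assumes p: "0 < p" and f: "g \<in> borel_measurable borel" "\<And>x. x \<in> ball 0 1 \<Longrightarrow> f x = g x"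
  shows "gagliardo_seminorm s p (ball 0 1) f = ennroot p (\<integral>\<^sup>+\<xi>. indicator (ball 0 1 \<times> ball 0 1) \<xi> *
    ennreal (norm (gagliardo_quotient ((real CARD('n) + s * p) / p) g \<xi>) powr p) \<partial>lborel)"
proof -
  note gm = measurable_gagliardo_quotient[OF f(1), of "(real CARD('n) + s * p) / p", measurable]
  have [measurable]: "(ball 0 1 \<times> ball 0 1 :: ((real^'n) \<times> (real^'n)) set) \<in> sets borel"
    by (intro borel_open open_Times) auto
  let ?h = "\<lambda>x y. ennreal (norm (g x - g y) powr p / norm (x - y) powr (real CARD('n) + s * p))"
  have "gagliardo_seminorm s p (ball 0 1) f = ennroot p (\<integral>\<^sup>+y. (\<integral>\<^sup>+x. ?h x y \<partial>lebesgue_on (ball 0 1)) \<partial>lebesgue_on (ball 0 1))"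
    unfolding gagliardo_seminorm_def
    by (intro arg_cong[where f = "ennroot p"] nn_integral_cong) (auto simp: f(2))
  also have "(\<integral>\<^sup>+y. (\<integral>\<^sup>+x. ?h x y \<partial>lebesgue_on (ball 0 1)) \<partial>lebesgue_on (ball 0 1))
      = (\<integral>\<^sup>+\<xi>. indicator (ball 0 1 \<times> ball 0 1) \<xi> * ?h (fst \<xi>) (snd \<xi>) \<partial>lborel)"
  proof (rule nn_integral_ball_ball)
    have "(\<lambda>(x, y). indicator (ball 0 1 \<times> ball 0 1) (x, y) * ?h x y)
        = (\<lambda>\<xi>. indicator (ball 0 1 \<times> ball 0 1) \<xi> * ennreal (norm (gagliardo_quotient ((real CARD('n) + s * p) / p) g \<xi>) powr p))"
      by (rule ext) (clarify, simp only: norm_gagliardo_quotient[OF p] prod.case)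
    then show "(\<lambda>(x, y). indicator (ball 0 1 \<times> ball 0 1) (x, y) * ?h x y) \<in> borel_measurable borel"
      using gm by simp
  qed
  also have "(\<lambda>\<xi>. ?h (fst \<xi>) (snd \<xi>)) = (\<lambda>\<xi>. ennreal (norm (gagliardo_quotient ((real CARD('n) + s * p) / p) g \<xi>) powr p))"
    using norm_gagliardo_quotient[OF p, of "real CARD('n) + s * p" g] by (auto simp: fun_eq_iff)
  finally show ?thesis .
qed

text \<open>The difference quotient of the smoothened map at \<open>(x, y)\<close> is, up to a power of \<open>1 - t\<close>, the average of the difference
  quotient of \<open>u\<close> over the pairs obtained by moving \<open>x\<close> and \<open>y\<close> in parallel. So this is convergence of averages in
  \<open>L\<^sup>p\<close> of the product of two balls.\<close>

lemma smoothen_tendsto_gagliardo: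
  fixes u :: "real^'n \<Rightarrow> real^'m"
  assumes u: "continuous_on (ball 0 1) u" "Lp_norm p (ball 0 1) u < \<infinity>" and p: "1 < p"
    and fin: "gagliardo_seminorm s p (ball 0 1) u < \<infinity>"
  shows "((\<lambda>t. gagliardo_seminorm s p (ball 0 1) (\<lambda>x. smoothen t (zero_extension u) x - u x)) \<longlongrightarrow> 0) (at_right 0)"
proof -
  let ?\<gamma> = "(real CARD('n) + s * p) / p"
  let ?u = "zero_extension u"
  let ?w = "gagliardo_quotient ?\<gamma> ?u"
  let ?L = "\<lambda>z :: real^'n. (z, z)"
  let ?c = "\<lambda>t. (1 - t) powr ?\<gamma>"
  have i: "integrable lborel ?u" using u p by (intro integrable_zero_extension) auto
  have um: "?u \<in> borel_measurable borel" using u by (intro measurable_zero_extension)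
  let ?I = "\<lambda>t. \<integral>\<^sup>+\<xi>. indicator (ball 0 1 \<times> ball 0 1) \<xi> * ennreal (norm (?c t *\<^sub>R (\<integral>z. ?w (slide ?L t z \<xi>) \<partial>moll) - ?w \<xi>) powr p) \<partial>lborel"
  have sl: "slide ?L t z (x, y) = (shift_ball t z x, shift_ball t z y)" for t z x y
    by (simp add: slide_def)
  have diff: "shift_ball t z x - shift_ball t z y = (1 - t) *\<^sub>R (x - y)" for t z and x y :: "real^'n"
    by (simp add: slide_def algebra_simps)
  have ws: "?w (slide ?L t z (x, y)) = (inverse (?c t) * inverse (norm (x - y) powr ?\<gamma>)) *\<^sub>R (?u (shift_ball t z x) - ?u (shift_ball t z y))"
    if "0 < t" "t \<le> 1/2" for t z x y
    using that by (simp add: sl gagliardo_quotient_def diff powr_mult)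
  have "(?I \<longlongrightarrow> 0) (at_right 0)"
  proof (rule mollify_tendsto_Lp)
    show "?w \<in> borel_measurable borel" by (rule measurable_gagliardo_quotient[OF um])
    show "open (ball 0 1 \<times> ball 0 1 :: ((real^'n) \<times> (real^'n)) set)" by (intro open_Times) auto
    show "bounded (ball 0 1 \<times> ball 0 1 :: ((real^'n) \<times> (real^'n)) set)" by (intro bounded_Times) auto
    show "bounded_linear ?L" by (intro bounded_linear_Pair bounded_linear_ident)
    show "1 < p" by (rule p)
    show "(\<integral>\<^sup>+\<xi>. indicator (ball 0 1 \<times> ball 0 1) \<xi> * ennreal (norm (?w \<xi>) powr p) \<partial>lborel) < \<infinity>"
    proof -
      have "gagliardo_seminorm s p (ball 0 1) u = ennroot p (\<integral>\<^sup>+\<xi>. indicator (ball 0 1 \<times> ball 0 1) \<xi> * ennreal (norm (?w \<xi>) powr p) \<partial>lborel)"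
        using p by (intro gagliardo_seminorm_eq um) (auto simp: zero_extension_def)
      then show ?thesis using fin by (simp only: ennroot_finite)
    qed
    show "slide ?L t z \<xi> \<in> ball 0 1 \<times> ball 0 1"
      if "0 < t" "t < 1" "norm z \<le> 1/2" "\<xi> \<in> ball 0 1 \<times> ball 0 1" for t z \<xi>
      using that shift_ball_in_ball[OF that(1-3)] by (cases \<xi>) (auto simp del: mem_ball_0 simp: sl)
    show "integrable moll (\<lambda>z. ?w (slide ?L t z \<xi>))" if "0 < t" "t \<le> 1/2" for t \<xi>
    proof (cases \<xi>)
      case (Pair x y)
      show ?thesis unfolding Pair ws[OF that]
        by (intro integrable_scaleR_right Bochner_Integration.integrable_diff smoothen_eq_average(2)[OF that(1) i])
    qed
    have "((\<lambda>t. (1 - t) powr ?\<gamma>) \<longlongrightarrow> (1 - 0) powr ?\<gamma>) (at_right 0)"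
      by (intro tendsto_intros) auto
    then show "(?c \<longlongrightarrow> 1) (at_right 0)" by simp
  qed
  then have "((\<lambda>t. ennroot p (?I t)) \<longlongrightarrow> 0) (at_right 0)" using p by (intro ennroot_tendsto_0) auto
  then show ?thesis
  proof (rule Lim_transform_eventually)
    have "\<forall>\<^sub>F t in at_right 0. (0::real) < t" by (rule eventually_at_right_less)
    moreover have "\<forall>\<^sub>F t in at_right (0::real). t < 1/2" by (intro eventually_at_rightI[of 0 "1/2"]) auto
    ultimately show "\<forall>\<^sub>F t in at_right 0. ennroot p (?I t) = gagliardo_seminorm s p (ball 0 1) (\<lambda>x. smoothen t ?u x - u x)"
    proof eventually_elim
      case (elim t)
      have sm: "smoothen t ?u \<in> borel_measurable borel"
        by (intro borel_measurable_continuous_onI smooth_on_continuous smooth_smoothen i elim)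
      have "gagliardo_seminorm s p (ball 0 1) (\<lambda>x. smoothen t ?u x - u x) = ennroot p (\<integral>\<^sup>+\<xi>. indicator (ball 0 1 \<times> ball 0 1) \<xi> *
          ennreal (norm (gagliardo_quotient ?\<gamma> (\<lambda>x. smoothen t ?u x - ?u x) \<xi>) powr p) \<partial>lborel)"
        by (rule gagliardo_seminorm_eq[OF _ borel_measurable_diff[OF sm um]]) (use p in \<open>auto simp: zero_extension_def\<close>)
      moreover have "gagliardo_quotient ?\<gamma> (\<lambda>x. smoothen t ?u x - ?u x) \<xi> = ?c t *\<^sub>R (\<integral>z. ?w (slide ?L t z \<xi>) \<partial>moll) - ?w \<xi>" for \<xi>
      proof (cases \<xi>)
        case (Pair x y)
        define K where "K = inverse (norm (x - y) powr ?\<gamma>)"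
        have "(\<integral>z. ?w (slide ?L t z (x, y)) \<partial>moll)
            = (\<integral>z. (inverse (?c t) * K) *\<^sub>R (?u (shift_ball t z x) - ?u (shift_ball t z y)) \<partial>moll)"
          unfolding K_def ws[OF elim(1) less_imp_le[OF elim(2)]] ..
        also have "\<dots> = (inverse (?c t) * K) *\<^sub>R (smoothen t ?u x - smoothen t ?u y)"
          using smoothen_eq_average[OF elim(1) i]
          by (simp only: integral_scaleR_right Bochner_Integration.integral_diff)
        finally have 1: "?c t *\<^sub>R (\<integral>z. ?w (slide ?L t z (x, y)) \<partial>moll) = K *\<^sub>R (smoothen t ?u x - smoothen t ?u y)"
          using elim(1,2) by (simp only: scaleR_scaleR) simp
        have 2: "?w (x, y) = K *\<^sub>R (?u x - ?u y)" by (simp only: gagliardo_quotient_def K_def fst_conv snd_conv)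
        have 3: "(a - b) - (c - d) = (a - c) - (b - d)" for a b c d :: "real^'m" by simp
        show ?thesis unfolding Pair 1 2
          by (simp only: gagliardo_quotient_def K_def[symmetric] fst_conv snd_conv scaleR_diff_right[symmetric] 3)
      qed
      ultimately show ?case by (simp only:)
    qed
  qed
qed

section \<open>Smooth approximation in first-order Sobolev spaces\<close>

lemma test_functionD:
  assumes "\<phi> \<in> test_functions (ball 0 1)"
  shows "smooth_on UNIV \<phi>" "zero_beyond 1 \<phi>" "\<And>x. x \<notin> ball 0 1 \<Longrightarrow> \<phi> x = 0"
    "\<And>x a. x \<notin> ball 0 1 \<Longrightarrow> partial a \<phi> x = 0"
proof -
  show "smooth_on UNIV \<phi>" using assms by (simp add: test_functions_def)
  have sub: "closure {x. \<phi> x \<noteq> 0} \<subseteq> ball 0 1" using assms by (simp add: test_functions_def)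
  show z: "\<phi> x = 0" if "x \<notin> ball 0 1" for x
    using that sub closure_subset[of "{x. \<phi> x \<noteq> 0}"] by blast
  show "zero_beyond 1 \<phi>" using z by (auto simp: zero_beyond_def)
  show "partial a \<phi> x = 0" if "x \<notin> ball 0 1" for x a
  proof -
    have "(\<phi> has_derivative (\<lambda>h. 0)) (at x)"
    proof (rule has_derivative_transform_within_open[OF has_derivative_const[of 0]])
      show "open (- closure {x. \<phi> x \<noteq> 0})" by (rule open_Compl[OF closed_closure])
      show "x \<in> - closure {x. \<phi> x \<noteq> 0}" using that sub by blast
      show "0 = \<phi> y" if "y \<in> - closure {x. \<phi> x \<noteq> 0}" for y
      proof -
        have "\<phi> y = 0" using that closure_subset[of "{x. \<phi> x \<noteq> 0}"] by blast
        then show ?thesis by simp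
      qed
    qed
    from partial_has_derivative[OF this] show ?thesis .
  qed
qed

lemma test_functionI:
  assumes "smooth_on UNIV \<phi>" "\<And>x. \<phi> x \<noteq> 0 \<Longrightarrow> x \<in> K" "compact K" "K \<subseteq> ball 0 1"
  shows "\<phi> \<in> test_functions (ball 0 1)"
proof -
  have "closure {x. \<phi> x \<noteq> 0} \<subseteq> K"
    using assms(2) compact_imp_closed[OF assms(3)] by (intro closure_minimal) auto
  moreover from this have "compact (closure {x. \<phi> x \<noteq> 0})"
    using assms(3) by (metis closed_closure compact_Int_closed inf.absorb_iff2)
  ultimately show ?thesis using assms(1,4) by (auto simp: test_functions_def)
qed

lemma integral_lebesgue_on_ball:
  fixes f :: "real^'n \<Rightarrow> real"
  assumes g: "g \<in> borel_measurable borel" "\<And>x. x \<notin> ball 0 1 \<Longrightarrow> g x = 0"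
    and eq: "AE x in lborel. x \<in> ball 0 1 \<longrightarrow> f x = g x"
  shows "(\<integral>x. f x \<partial>lebesgue_on (ball 0 1)) = (\<integral>x. g x \<partial>lborel)"
proof -
  have ae: "AE x in lebesgue. x \<in> ball 0 1 \<longrightarrow> f x = g x" using eq by (rule AE_completion)
  have gl: "g \<in> borel_measurable lebesgue" using g(1) by (simp add: measurable_completion)
  have e: "AE x in lebesgue. indicator (ball 0 1) x *\<^sub>R f x = g x"
    using ae by (rule eventually_mono) (use g(2) in \<open>auto simp: indicator_def\<close>)
  have "(\<integral>x. f x \<partial>lebesgue_on (ball 0 1)) = (\<integral>x. indicator (ball 0 1) x *\<^sub>R f x \<partial>lebesgue)"
    by (subst integral_restrict_space) auto
  also have "\<dots> = (\<integral>x. g x \<partial>lebesgue)"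
  proof (rule integral_cong_AE[OF _ gl e])
    have e': "AE x in lebesgue. g x = indicator (ball 0 1) x *\<^sub>R f x" using e by (rule eventually_mono) simp
    show "(\<lambda>x. indicator (ball 0 1) x *\<^sub>R f x) \<in> borel_measurable lebesgue"
      by (rule borel_measurable_AE[OF gl e'])
  qed
  also have "\<dots> = (\<integral>x. g x \<partial>lborel)" using g(1) by (simp add: integral_completion)
  finally show ?thesis .
qed

lemma integral_lebesgue_on_ball_eq:
  fixes f :: "real^'n \<Rightarrow> real"
  assumes "g \<in> borel_measurable borel" "\<And>x. x \<notin> ball 0 1 \<Longrightarrow> g x = 0" "\<And>x. x \<in> ball 0 1 \<Longrightarrow> f x = g x"
  shows "(\<integral>x. f x \<partial>lebesgue_on (ball 0 1)) = (\<integral>x. g x \<partial>lborel)"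
proof (rule integral_lebesgue_on_ball[OF assms(1)])
  show "AE x in lborel. x \<in> ball 0 1 \<longrightarrow> f x = g x"
    by (rule AE_I2) (use assms(3) in blast)
qed (rule assms(2))

lemma partial_translate:
  fixes f :: "real^'n \<Rightarrow> real"
  assumes "smooth_on UNIV f"
  shows "partial a (\<lambda>y. f (y - z)) y = partial a f (y - z)" "smooth_on UNIV (\<lambda>y. f (y - z))"
proof -
  have "((\<lambda>y. y - z) has_derivative (\<lambda>h. h)) (at y)" by (auto intro!: derivative_eq_intros)
  from partial_has_derivative[OF has_derivative_compose[OF this has_derivative_partials[OF smooth_on_differentiable[OF assms]]]]
  show "partial a (\<lambda>y. f (y - z)) y = partial a f (y - z)" by (simp add: sum_axis_mult)
  show "smooth_on UNIV (\<lambda>y. f (y - z))"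
    by (rule smooth_on_compose[OF assms])
      (simp add: smooth_on_diff[OF smooth_on_component smooth_on_const])
qed

definition grad :: "(real^'n \<Rightarrow> real^'m) \<Rightarrow> real^'n \<Rightarrow> real^'n^'m"
  where "grad F x = (\<chi> j a. partial a (\<lambda>x. F x $ j) x)"

lemma measurable_vec_nth:
  fixes f :: "'a \<Rightarrow> ('b::euclidean_space)^'m"
  assumes "f \<in> borel_measurable M"
  shows "(\<lambda>x. f x $ i) \<in> borel_measurable M"
proof -
  have "(\<lambda>y :: 'b^'m. y $ i) \<in> borel_measurable borel"
    by (intro borel_measurable_continuous_onI continuous_intros)
  with assms show ?thesis by (rule measurable_compose)
qed

lemma measurable_vecI:
  fixes f :: "'a \<Rightarrow> ('b::euclidean_space)^'m"
  assumes "\<And>i. (\<lambda>x. f x $ i) \<in> borel_measurable M"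
  shows "f \<in> borel_measurable M"
proof -
  have "(\<lambda>x. axis i (f x $ i) :: 'b^'m) \<in> borel_measurable M" for i
    by (rule measurable_compose[OF assms])
      (intro borel_measurable_continuous_onI linear_continuous_on bounded_linear_axis)
  then have "(\<lambda>x. \<Sum>i\<in>UNIV. axis i (f x $ i)) \<in> borel_measurable M"
    by (rule borel_measurable_sum)
  moreover have "(\<Sum>i\<in>UNIV. axis i (y $ i)) = y" for y :: "'b^'m"
    by (simp add: vec_eq_iff axis_def if_distrib sum.delta cong: if_cong)
  ultimately show ?thesis by simp
qed

text \<open>Averaging a function needs joint measurability in the point and the translation, which is available for Borel
  functions; a weak gradient is only Lebesgue measurable.\<close>

lemma borel_representative:
  fixes G :: "real^'n \<Rightarrow> real^'k^'m"
  assumes "G \<in> borel_measurable (lebesgue_on (ball 0 1))"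
  obtains G0 where "G0 \<in> borel_measurable borel" "\<And>x. x \<notin> ball 0 1 \<Longrightarrow> G0 x = 0"
    "AE x in lborel. x \<in> ball 0 1 \<longrightarrow> G x = G0 x"
proof -
  let ?H = "\<lambda>x. indicator (ball 0 1) x *\<^sub>R G x"
  have "?H \<in> borel_measurable lebesgue"
    using assms by (subst (asm) borel_measurable_restrict_space_iff) auto
  then have "(\<lambda>x. ?H x $ j $ a) \<in> borel_measurable lebesgue" for j a
    by (intro measurable_vec_nth)
  then have ex: "\<exists>g\<in>borel_measurable lborel. AE x in lborel. ?H x $ j $ a = g x" for j a
    by (rule completion_ex_borel_measurable_real)
  define g where "g j a = (SOME g. g \<in> borel_measurable lborel \<and> (AE x in lborel. ?H x $ j $ a = g x))" for j a
  have "g j a \<in> borel_measurable lborel \<and> (AE x in lborel. ?H x $ j $ a = g j a x)" for j a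
    using someI_ex[OF ex[of j a, unfolded Bex_def]] unfolding g_def .
  then have g: "g j a \<in> borel_measurable lborel" "AE x in lborel. ?H x $ j $ a = g j a x" for j a
    by blast+
  define G0 where "G0 x = indicator (ball 0 1) x *\<^sub>R (\<chi> j a. g j a x)" for x
  have m: "(\<lambda>x. \<chi> j a. g j a x) \<in> borel_measurable borel"
    by (intro measurable_vecI) (use g(1) in simp)
  have ae: "AE x in lborel. \<forall>j\<in>UNIV. \<forall>a\<in>UNIV. ?H x $ j $ a = g j a x"
    by (intro eventually_ball_finite ballI finite g(2))
  show ?thesis
  proof (rule that)
    show "G0 \<in> borel_measurable borel" unfolding G0_def[abs_def]
      by (intro borel_measurable_scaleR borel_measurable_indicator m) auto
    show "AE x in lborel. x \<in> ball 0 1 \<longrightarrow> G x = G0 x"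
      using ae by (rule eventually_mono) (auto simp: G0_def vec_eq_iff)
  qed (simp add: G0_def)
qed

text \<open>For \<open>x\<close> in the ball the kernel centred at \<open>(1 - t) x\<close> is a test function. Inserted in the definition of the weak
  gradient, it shows that the gradient of the smoothened map is \<open>1 - t\<close> times the average of the weak gradient. So the
  gradients converge in \<open>L\<^sup>p\<close> by the same principle as the maps.\<close>

lemma W1p_smooth_approximation:
  fixes u :: "real^'n \<Rightarrow> real^'m"
  assumes u: "u \<in> sobolev_space 1 p (ball 0 1)" "continuous_on (ball 0 1) u" and p: "1 < p"
  defines "F \<equiv> \<lambda>t. smoothen t (zero_extension u)"
  obtains G0 :: "real^'n \<Rightarrow> real^'n^'m" where
    "G0 \<in> borel_measurable borel"
    "(\<integral>\<^sup>+x. indicator (ball 0 1) x * ennreal (norm (G0 x) powr p) \<partial>lborel) < \<infinity>"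
    "((\<lambda>t. \<integral>\<^sup>+x. indicator (ball 0 1) x * ennreal (norm (grad (F t) x - G0 x) powr p) \<partial>lborel) \<longlongrightarrow> 0) (at_right 0)"
    "\<And>t. 0 < t \<Longrightarrow> t < 1 \<Longrightarrow> sobolev_seminorm 1 p (ball 0 1) (\<lambda>x. F t x - u x) \<le> Lp_norm p (ball 0 1) (\<lambda>x. grad (F t) x - G0 x)"
proof -
  let ?u = "zero_extension u"
  have up: "Lp_norm p (ball 0 1) u < \<infinity>" using u by (simp add: sobolev_space_def)
  have "(INF G\<in>{G. weak_gradient (ball 0 1) u G}. Lp_norm p (ball 0 1) G) < \<infinity>"
    using u by (simp add: sobolev_space_def sobolev_seminorm_def)
  then obtain G where G: "weak_gradient (ball 0 1) u G" "Lp_norm p (ball 0 1) G < \<infinity>"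
    by (auto simp: INF_less_iff)
  have Gm: "G \<in> borel_measurable (lebesgue_on (ball 0 1))"
    using G(1) unfolding weak_gradient_def by (elim conjE)
  obtain G0 where G0: "G0 \<in> borel_measurable borel" "\<And>x. x \<notin> ball 0 1 \<Longrightarrow> G0 x = 0"
    "AE x in lborel. x \<in> ball 0 1 \<longrightarrow> G x = G0 x"
    by (rule borel_representative[OF Gm]) (rule that)
  have "(\<integral>\<^sup>+x. indicator (ball 0 1) x * ennreal (norm (G0 x) powr p) \<partial>lborel)
      = (\<integral>\<^sup>+x. indicator (ball 0 1) x * ennreal (norm (G x) powr p) \<partial>lborel)"
    by (rule nn_integral_cong_AE, rule eventually_mono[OF G0(3)]) (simp add: indicator_def)
  then have G0fin: "(\<integral>\<^sup>+x. indicator (ball 0 1) x * ennreal (norm (G0 x) powr p) \<partial>lborel) < \<infinity>"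
    using G(2) by (simp add: Lp_norm_ball ennroot_finite[unfolded infinity_ennreal_def])
  have iG: "integrable lborel G0"
    by (rule nn_integral_powr_finite_imp_integrable[OF G0(1) _ bounded_ball _ G0(2) G0fin]) (use p in auto)
  have iGc: "integrable lborel (\<lambda>x. G0 x $ j $ a)" for j a
    by (intro integrable_vec_nth iG)
  have iu: "integrable lborel ?u" using u up p by (intro integrable_zero_extension) auto
  have iuc: "integrable lborel (\<lambda>x. ?u x $ j)" for j by (rule integrable_vec_nth[OF iu])
  have wg: "(\<integral>x. ?u x $ j * partial a \<phi> x \<partial>lborel) = - (\<integral>x. G0 x $ j $ a * \<phi> x \<partial>lborel)"
    if \<phi>: "\<phi> \<in> test_functions (ball 0 1)" for \<phi> j a
  proof -
    note T = test_functionD[OF \<phi>]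
    have m: "\<phi> \<in> borel_measurable borel" "partial a \<phi> \<in> borel_measurable borel"
      by (intro borel_measurable_continuous_onI smooth_on_continuous smooth_on_partial T)+
    have "(\<integral>x. u x $ j * partial a \<phi> x \<partial>lebesgue_on (ball 0 1)) = (\<integral>x. ?u x $ j * partial a \<phi> x \<partial>lborel)"
    proof (rule integral_lebesgue_on_ball_eq)
      show "(\<lambda>x. ?u x $ j * partial a \<phi> x) \<in> borel_measurable borel"
        using m iuc[of j] by (intro borel_measurable_times) auto
    qed (simp_all add: zero_extension_def)
    moreover have "(\<integral>x. G x $ j $ a * \<phi> x \<partial>lebesgue_on (ball 0 1)) = (\<integral>x. G0 x $ j $ a * \<phi> x \<partial>lborel)"
    proof (rule integral_lebesgue_on_ball)
      show "(\<lambda>x. G0 x $ j $ a * \<phi> x) \<in> borel_measurable borel"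
        using m iGc[of j a] by (intro borel_measurable_times) auto
      show "AE x in lborel. x \<in> ball 0 1 \<longrightarrow> G x $ j $ a * \<phi> x = G0 x $ j $ a * \<phi> x"
        by (rule eventually_mono[OF G0(3)]) simp
    qed (simp add: G0(2))
    ultimately show ?thesis using G(1) \<phi> by (simp add: weak_gradient_def)
  qed
  have grad_eq: "grad (F t) x = (1 - t) *\<^sub>R (\<integral>z. G0 (shift_ball t z x) \<partial>moll)"
    if t: "0 < t" "t < 1" and x: "x \<in> ball 0 1" for t x
  proof -
    let ?\<phi> = "\<lambda>y. scaled_mollifier t (y - (1 - t) *\<^sub>R x)"
    note zb = zero_beyond_scaled_mollifier[OF t(1)]
    have test: "?\<phi> \<in> test_functions (ball 0 1)"
    proof (rule test_functionI[of _ "cball ((1 - t) *\<^sub>R x) (t / 2)"])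
      show "smooth_on UNIV ?\<phi>" by (rule partial_translate(2)[OF smooth_scaled_mollifier])
      show "y \<in> cball ((1 - t) *\<^sub>R x) (t / 2)" if "?\<phi> y \<noteq> 0" for y
        using that zero_beyondD[OF zb] by (force simp: dist_norm norm_minus_commute)
      have "norm y < 1" if "norm (y - (1 - t) *\<^sub>R x) \<le> t / 2" for y
      proof -
        have "norm y \<le> norm (y - (1 - t) *\<^sub>R x) + norm ((1 - t) *\<^sub>R x)"
          using norm_triangle_ineq[of "y - (1 - t) *\<^sub>R x" "(1 - t) *\<^sub>R x"] by simp
        also have "norm ((1 - t) *\<^sub>R x) \<le> (1 - t) * 1" using t x by (simp add: mult_left_mono)
        finally show ?thesis using that t by simp
      qed
      then show "cball ((1 - t) *\<^sub>R x) (t / 2) \<subseteq> ball 0 1" by (auto simp: dist_norm norm_minus_commute)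
    qed auto
    have "partial a (\<lambda>x. F t x $ j) x = (1 - t) * (\<integral>z. G0 (shift_ball t z x) $ j $ a \<partial>moll)" for j a
    proof -
      have "partial a (\<lambda>x. F t x $ j) x = partial a (dconv (scaled_mollifier t) (1 - t) (\<lambda>y. ?u y $ j)) x"
        by (simp add: F_def smoothen_def)
      also have "\<dots> = - (1 - t) * (\<integral>y. partial a (scaled_mollifier t) (y - (1 - t) *\<^sub>R x) * ?u y $ j \<partial>lborel)"
        by (subst partial_dconv[OF smooth_scaled_mollifier zb iuc]) (simp add: dconv_def)
      also have "(\<integral>y. partial a (scaled_mollifier t) (y - (1 - t) *\<^sub>R x) * ?u y $ j \<partial>lborel) = (\<integral>y. ?u y $ j * partial a ?\<phi> y \<partial>lborel)"
        by (simp add: partial_translate[OF smooth_scaled_mollifier] mult.commute)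
      also have "\<dots> = - (\<integral>y. G0 y $ j $ a * ?\<phi> y \<partial>lborel)" by (rule wg[OF test])
      also have "(\<integral>y. G0 y $ j $ a * ?\<phi> y \<partial>lborel) = (\<integral>z. G0 (shift_ball t z x) $ j $ a \<partial>moll)"
        using dconv_scaled_mollifier(1)[OF t(1) iGc[of j a], of x] by (simp add: dconv_def mult.commute)
      finally show ?thesis by (simp only: minus_mult_minus)
    qed
    moreover have "(\<integral>z. G0 (shift_ball t z x) $ j $ a \<partial>moll) = (\<integral>z. G0 (shift_ball t z x) \<partial>moll) $ j $ a" for j a
    proof -
      have "integrable moll (\<lambda>z. G0 (shift_ball t z x))"
        by (intro integrable_vecI dconv_scaled_mollifier(2)[OF t(1)] iGc)
      then show ?thesis
        by (simp add: integral_bounded_linear[OF bounded_linear_vec_nth] integrable_vec_nth)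
    qed
    ultimately show ?thesis by (simp add: grad_def vec_eq_iff)
  qed
  show ?thesis
  proof (rule that[OF G0(1) G0fin])
    let ?I = "\<lambda>t. \<integral>\<^sup>+x. indicator (ball 0 1) x * ennreal (norm ((1 - t) *\<^sub>R (\<integral>z. G0 (shift_ball t z x) \<partial>moll) - G0 x) powr p) \<partial>lborel"
    have "(?I \<longlongrightarrow> 0) (at_right 0)"
    proof (rule mollify_tendsto_Lp)
      show "shift_ball t z x \<in> ball 0 1" if "0 < t" "t < 1" "norm z \<le> 1/2" "x \<in> ball 0 1" for t z and x :: "real^'n"
        by (rule shift_ball_in_ball[OF that])
      show "integrable moll (\<lambda>z. G0 (shift_ball t z x))" if "0 < t" for t x
        by (intro integrable_vecI dconv_scaled_mollifier(2)[OF that] iGc)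
      have "((\<lambda>t::real. 1 - t) \<longlongrightarrow> 1 - 0) (at_right 0)" by (intro tendsto_intros)
      then show "((\<lambda>t::real. 1 - t) \<longlongrightarrow> 1) (at_right 0)" by simp
    qed (use p G0 G0fin in \<open>auto intro: bounded_linear_ident\<close>)
    then show "((\<lambda>t. \<integral>\<^sup>+x. indicator (ball 0 1) x * ennreal (norm (grad (F t) x - G0 x) powr p) \<partial>lborel) \<longlongrightarrow> 0) (at_right 0)"
    proof (rule Lim_transform_eventually)
      have "\<forall>\<^sub>F t in at_right 0. (0::real) < t" by (rule eventually_at_right_less)
      moreover have "\<forall>\<^sub>F t in at_right (0::real). t < 1" by (intro eventually_at_rightI[of 0 1]) auto
      ultimately show "\<forall>\<^sub>F t in at_right 0. ?I t = (\<integral>\<^sup>+x. indicator (ball 0 1) x * ennreal (norm (grad (F t) x - G0 x) powr p) \<partial>lborel)"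
        by eventually_elim (auto intro!: nn_integral_cong simp: grad_eq indicator_def simp del: mem_ball_0)
    qed
    fix t :: real assume t: "0 < t" "t < 1"
    have Fs: "smooth_on UNIV (\<lambda>x. F t x $ j)" for j
      unfolding F_def by (rule smooth_smoothen_component[OF t(1) iu])
    have gc: "continuous_on UNIV (grad (F t))"
      unfolding grad_def by (intro continuous_on_vec_lambda smooth_on_continuous smooth_on_partial Fs)
    have Fc: "continuous_on UNIV (F t)"
      unfolding F_def by (intro smooth_on_continuous smooth_smoothen t iu)
    have gm: "grad (F t) \<in> borel_measurable borel" using gc by (rule borel_measurable_continuous_onI)
    have li: "locally_integrable (ball 0 1) (\<lambda>x. h x - w x)"
      if h: "continuous_on UNIV h" and w': "integrable lborel w'" "\<And>x. x \<in> ball 0 1 \<Longrightarrow> w x = w' x"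
      for h w w' :: "real^'n \<Rightarrow> 'e::euclidean_space"
      unfolding locally_integrable_def
    proof (intro allI impI)
      fix K :: "(real^'n) set" assume K: "compact K \<and> K \<subseteq> ball 0 1"
      have "integrable lborel (\<lambda>x. indicator K x *\<^sub>R h x - indicator K x *\<^sub>R w' x)"
        using K w' by (intro Bochner_Integration.integrable_diff borel_integrable_compact continuous_on_subset[OF h]
            integrable_mult_indicator) (auto simp: compact_imp_closed)
      then have "integrable lebesgue (\<lambda>x. indicator K x *\<^sub>R h x - indicator K x *\<^sub>R w' x)"
        by (simp add: integrable_completion)
      moreover have "(\<lambda>x. indicator K x *\<^sub>R h x - indicator K x *\<^sub>R w' x) = (\<lambda>x. indicator K x *\<^sub>R (h x - w x))"
        using K w'(2) by (auto simp: indicator_def fun_eq_iff subset_eq)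
      ultimately show "(\<lambda>x. h x - w x) absolutely_integrable_on K" by (simp add: set_integrable_def)
    qed
    have "weak_gradient (ball 0 1) (\<lambda>x. F t x - u x) (\<lambda>x. grad (F t) x - G0 x)"
      unfolding weak_gradient_def
    proof (intro conjI ballI allI)
      show "(\<lambda>x. grad (F t) x - G0 x) \<in> borel_measurable (lebesgue_on (ball 0 1))"
        using gm G0(1) by (intro measurable_restrict_space1 measurable_completion) auto
      show "locally_integrable (ball 0 1) (\<lambda>x. F t x - u x)"
        by (rule li[OF Fc iu]) (simp add: zero_extension_def)
      show "locally_integrable (ball 0 1) (\<lambda>x. grad (F t) x - G0 x)"
        by (rule li[OF gc iG]) simp
      fix \<phi> :: "real^'n \<Rightarrow> real" and a j assume \<phi>: "\<phi> \<in> test_functions (ball 0 1)"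
      note T = test_functionD[OF \<phi>]
      have c: "continuous_on UNIV \<phi>" "continuous_on UNIV (partial a \<phi>)"
        by (intro smooth_on_continuous smooth_on_partial T)+
      then have m: "\<phi> \<in> borel_measurable borel" "partial a \<phi> \<in> borel_measurable borel"
        by (auto intro: borel_measurable_continuous_onI)
      have cF: "continuous_on UNIV (\<lambda>x. F t x $ j)" "continuous_on UNIV (partial a (\<lambda>x. F t x $ j))"
        by (intro smooth_on_continuous smooth_on_partial Fs)+
      have i1: "integrable lborel (\<lambda>x. ?u x $ j * partial a \<phi> x)" "integrable lborel (\<lambda>x. G0 x $ j $ a * \<phi> x)"
        using integrable_dconv[OF c(2) zero_beyond_partial[OF T(2)] iuc[of j], of 0] integrable_dconv[OF c(1) T(2) iGc[of j a], of 0]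
        by (simp_all add: mult.commute)
      have i2: "integrable lborel (\<lambda>x. F t x $ j * partial a \<phi> x)" "integrable lborel (\<lambda>x. partial a (\<lambda>x. F t x $ j) x * \<phi> x)"
        using T(2) zero_beyond_partial[OF T(2), of a] c cF
        by (auto intro!: integrable_continuous_bounded_support[of _ 1] continuous_intros simp: zero_beyond_def)
      have "(\<integral>x. partial a (\<lambda>x. F t x $ j * \<phi> x) x \<partial>lborel) = 0"
        by (rule integral_partial_eq_0[of _ 1]) (use T Fs in \<open>auto intro: smooth_on_mult simp: zero_beyond_def\<close>)
      then have ibp: "(\<integral>x. F t x $ j * partial a \<phi> x \<partial>lborel) = - (\<integral>x. partial a (\<lambda>x. F t x $ j) x * \<phi> x \<partial>lborel)"
        using i2 by (simp add: partial_mult smooth_on_differentiable Fs T(1))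
      have "(\<integral>x. (F t x - u x) $ j * partial a \<phi> x \<partial>lebesgue_on (ball 0 1)) = (\<integral>x. F t x $ j * partial a \<phi> x - ?u x $ j * partial a \<phi> x \<partial>lborel)"
        by (rule integral_lebesgue_on_ball_eq[OF borel_measurable_diff[OF borel_measurable_integrable[OF i2(1), simplified] borel_measurable_integrable[OF i1(1), simplified]]])
          (simp_all add: zero_extension_def left_diff_distrib T(4))
      also have "\<dots> = - (\<integral>x. partial a (\<lambda>x. F t x $ j) x * \<phi> x - G0 x $ j $ a * \<phi> x \<partial>lborel)"
        using i1 i2 by (simp add: ibp wg[OF \<phi>])
      also have "(\<integral>x. partial a (\<lambda>x. F t x $ j) x * \<phi> x - G0 x $ j $ a * \<phi> x \<partial>lborel)
          = (\<integral>x. (grad (F t) x - G0 x) $ j $ a * \<phi> x \<partial>lebesgue_on (ball 0 1))"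
        by (rule integral_lebesgue_on_ball_eq[OF borel_measurable_diff[OF borel_measurable_integrable[OF i2(2), simplified] borel_measurable_integrable[OF i1(2), simplified]], symmetric])
          (simp_all add: grad_def left_diff_distrib T(3))
      finally show "(\<integral>x. (F t x - u x) $ j * partial a \<phi> x \<partial>lebesgue_on (ball 0 1))
          = - (\<integral>x. (grad (F t) x - G0 x) $ j $ a * \<phi> x \<partial>lebesgue_on (ball 0 1))" .
    qed
    then have "(INF G\<in>{G. weak_gradient (ball 0 1) (\<lambda>x. F t x - u x) G}. Lp_norm p (ball 0 1) G)
        \<le> Lp_norm p (ball 0 1) (\<lambda>x. grad (F t) x - G0 x)"
      by (intro INF_lower CollectI)
    then show "sobolev_seminorm 1 p (ball 0 1) (\<lambda>x. F t x - u x) \<le> Lp_norm p (ball 0 1) (\<lambda>x. grad (F t) x - G0 x)"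
      unfolding sobolev_seminorm_def by simp
  qed
qed

section \<open>The approximations are admissible in the definition of distributional rank\<close>

lemma smoothen_tendsto_sobolev:
  fixes u :: "real^'n \<Rightarrow> real^'m"
  assumes u: "u \<in> sobolev_space s p (ball 0 1)" "continuous_on (ball 0 1) u" and p: "1 < p"
  shows "((\<lambda>t. sobolev_norm s p (ball 0 1) (\<lambda>x. smoothen t (zero_extension u) x - u x)) \<longlongrightarrow> 0) (at_right 0)"
proof -
  have up: "Lp_norm p (ball 0 1) u < \<infinity>" using u by (simp add: sobolev_space_def)
  have "((\<lambda>t. sobolev_seminorm s p (ball 0 1) (\<lambda>x. smoothen t (zero_extension u) x - u x)) \<longlongrightarrow> 0) (at_right 0)"
  proof (cases "s = 1")
    case True
    obtain G0 :: "real^'n \<Rightarrow> real^'n^'m" where G0: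
      "((\<lambda>t. \<integral>\<^sup>+x. indicator (ball 0 1) x * ennreal (norm (grad (smoothen t (zero_extension u)) x - G0 x) powr p) \<partial>lborel) \<longlongrightarrow> 0) (at_right 0)"
      "\<And>t. 0 < t \<Longrightarrow> t < 1 \<Longrightarrow> sobolev_seminorm 1 p (ball 0 1) (\<lambda>x. smoothen t (zero_extension u) x - u x) \<le> Lp_norm p (ball 0 1) (\<lambda>x. grad (smoothen t (zero_extension u)) x - G0 x)"
      by (rule W1p_smooth_approximation[OF u(1)[unfolded True] u(2) p]) (rule that)
    show ?thesis unfolding True
    proof (rule tendsto_sandwich[OF _ _ tendsto_const])
      show "((\<lambda>t. Lp_norm p (ball 0 1) (\<lambda>x. grad (smoothen t (zero_extension u)) x - G0 x)) \<longlongrightarrow> 0) (at_right 0)"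
        unfolding Lp_norm_ball by (rule ennroot_tendsto_0[OF _ G0(1)]) (use p in simp)
      have "\<forall>\<^sub>F t in at_right 0. (0::real) < t" by (rule eventually_at_right_less)
      moreover have "\<forall>\<^sub>F t in at_right (0::real). t < 1" by (intro eventually_at_rightI[of 0 1]) auto
      ultimately show "\<forall>\<^sub>F t in at_right 0. sobolev_seminorm 1 p (ball 0 1) (\<lambda>x. smoothen t (zero_extension u) x - u x)
          \<le> Lp_norm p (ball 0 1) (\<lambda>x. grad (smoothen t (zero_extension u)) x - G0 x)"
        by eventually_elim (rule G0(2))
    qed auto
  next
    case False
    have "sobolev_seminorm s p (ball 0 1) u < \<infinity>" using u(1) by (simp add: sobolev_space_def)
    with False have "gagliardo_seminorm s p (ball 0 1) u < \<infinity>" by (simp only: sobolev_seminorm_def if_False)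
    from smoothen_tendsto_gagliardo[OF u(2) up p this] False show ?thesis
      by (simp only: sobolev_seminorm_def if_False)
  qed
  from tendsto_add[OF smoothen_tendsto_Lp[OF u(2) up p] this]
  show ?thesis by (simp only: sobolev_norm_def add_0)
qed

section \<open>Oscillation at a fixed scale\<close>

text \<open>The normalisation is such that the integrand is at most a constant times \<open>|v y - v x|\<^bsup>k + 1\<^esup> / |x - y|\<^bsup>n + k\<^esup>\<close>, the
  integrand of a Gagliardo seminorm with \<open>s p = k\<close>.\<close>

definition osc_energy :: "nat \<Rightarrow> (real^'n \<Rightarrow> real^'m) \<Rightarrow> real \<Rightarrow> real^'n \<Rightarrow> real"
  where "osc_energy k v t x =
    (1 / t ^ (CARD('n) + k)) * (\<integral>y. indicator (cball x (2 * t)) y * norm (v y - v x) ^ Suc k \<partial>lborel)"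

lemma osc_energy_nonneg: "0 < t \<Longrightarrow> 0 \<le> osc_energy k v t x"
  unfolding osc_energy_def by (intro mult_nonneg_nonneg Bochner_Integration.integral_nonneg) auto

text \<open>The graph of \<open>x \<mapsto> x\<^bsup>k + 1\<^esup>\<close> lies above its tangent at \<open>m\<close>.\<close>

lemma power_tangent_le:
  fixes x m :: real
  assumes "0 \<le> x" "0 \<le> m"
  shows "real (Suc k) * (x * m ^ k) \<le> x ^ Suc k + real k * m ^ Suc k"
proof (cases "m = 0")
  case True
  then show ?thesis using assms by (cases k) auto
next
  case False
  then have m: "m > 0" using assms by simp
  have "1 + real (Suc k) * (x / m - 1) \<le> (1 + (x / m - 1)) ^ Suc k"
    by (rule Bernoulli_inequality) (use assms m in simp)
  then have "1 + real (Suc k) * (x / m - 1) \<le> (x / m) ^ Suc k" by simp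
  then have "m ^ Suc k * (1 + real (Suc k) * (x / m - 1)) \<le> m ^ Suc k * (x / m) ^ Suc k"
    using m by (intro mult_left_mono) auto
  also have "\<dots> = x ^ Suc k" using m by (simp add: power_divide del: power_Suc)
  also have "m ^ Suc k * (1 + real (Suc k) * (x / m - 1)) = real (Suc k) * (x * m ^ k) - real k * m ^ Suc k"
    using m by (simp add: field_simps)
  finally show ?thesis by simp
qed

text \<open>Jensen's inequality on a set of measure at most \<open>V\<close>: integrate the tangent inequality at the mean \<open>m\<close>.\<close>

lemma power_integral_le:
  fixes h :: "'a::euclidean_space \<Rightarrow> real"
  assumes A: "A \<in> sets lborel" "emeasure lborel A < \<infinity>" and V: "measure lborel A \<le> V" "0 < V"
    and h: "\<And>y. 0 \<le> h y" and i1: "integrable lborel (\<lambda>y. indicator A y * h y)"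
    and i2: "integrable lborel (\<lambda>y. indicator A y * h y ^ Suc k)"
  shows "(\<integral>y. indicator A y * h y \<partial>lborel) ^ Suc k \<le> V ^ k * (\<integral>y. indicator A y * h y ^ Suc k \<partial>lborel)"
proof -
  define I where "I = (\<integral>y. indicator A y * h y \<partial>lborel)"
  define m where "m = I / V"
  have I0: "I \<ge> 0" unfolding I_def by (intro Bochner_Integration.integral_nonneg) (auto simp: h)
  have m0: "m \<ge> 0" using I0 V by (simp add: m_def)
  have iA: "integrable lborel (indicator A :: 'a \<Rightarrow> real)"
    using A by (intro integrable_real_indicator) auto
  have "(\<integral>y. real (Suc k) * m ^ k * (indicator A y * h y) \<partial>lborel)
      \<le> (\<integral>y. indicator A y * h y ^ Suc k + real k * m ^ Suc k * indicator A y \<partial>lborel)"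
  proof (rule integral_mono)
    show "real (Suc k) * m ^ k * (indicator A y * h y) \<le> indicator A y * h y ^ Suc k + real k * m ^ Suc k * indicator A y" for y
      using power_tangent_le[OF h m0, of k y] by (simp add: indicator_def mult_ac)
  qed (use i1 i2 iA in auto)
  then have "real (Suc k) * m ^ k * I \<le> (\<integral>y. indicator A y * h y ^ Suc k \<partial>lborel) + real k * m ^ Suc k * measure lborel A"
    using i2 iA by (simp add: I_def)
  also have "\<dots> \<le> (\<integral>y. indicator A y * h y ^ Suc k \<partial>lborel) + real k * m ^ Suc k * V"
    using m0 V by (intro add_left_mono mult_left_mono) auto
  finally have "real (Suc k) * m ^ k * I \<le> (\<integral>y. indicator A y * h y ^ Suc k \<partial>lborel) + real k * m ^ Suc k * V" .
  moreover have "I = m * V" using V by (simp add: m_def)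
  ultimately have "m ^ Suc k * V \<le> (\<integral>y. indicator A y * h y ^ Suc k \<partial>lborel)"
    by (simp add: algebra_simps)
  then have "V ^ k * (m ^ Suc k * V) \<le> V ^ k * (\<integral>y. indicator A y * h y ^ Suc k \<partial>lborel)"
    using V by (intro mult_left_mono) auto
  moreover have "V ^ k * (m ^ Suc k * V) = I ^ Suc k"
    using V by (simp add: m_def power_divide)
  ultimately show ?thesis by (simp add: I_def)
qed

lemma local_bound_zero_extension:
  fixes u :: "real^'n \<Rightarrow> real^'m"
  assumes "continuous_on (ball 0 1) u"
  obtains M where "M > 0" "\<And>x. norm x \<le> 3/4 \<Longrightarrow> norm (zero_extension u x) \<le> M"
proof -
  have "bounded (u ` cball 0 (3/4))"
    by (intro compact_imp_bounded compact_continuous_image continuous_on_subset[OF assms]) auto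
  then obtain M where "M > 0" "\<forall>x\<in>cball 0 (3/4). norm (u x) \<le> M" by (auto simp: bounded_pos)
  then show ?thesis by (intro that[of M]) (auto simp: zero_extension_def)
qed

lemma integrable_osc:
  fixes v :: "real^'n \<Rightarrow> real^'m"
  assumes v: "v \<in> borel_measurable borel" and M: "\<And>x. norm x \<le> 3/4 \<Longrightarrow> norm (v x) \<le> M"
    and x: "norm x \<le> 1/2" and t: "t \<le> 1/8"
  shows "integrable lborel (\<lambda>y. indicator (cball x (2 * t)) y * norm (v y - v x) ^ q)"
proof -
  note v[measurable]
  have "integrable lborel (\<lambda>y. (2 * M) ^ q * indicator (cball x (2 * t)) y)"
    using emeasure_bounded_finite[OF bounded_cball] by (intro integrable_mult_right integrable_real_indicator) auto
  then show ?thesis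
  proof (rule Bochner_Integration.integrable_bound)
    show "(\<lambda>y. indicator (cball x (2 * t)) y * norm (v y - v x) ^ q) \<in> borel_measurable lborel"
      using v by (intro borel_measurable_times borel_measurable_indicator borel_measurable_power borel_measurable_norm
          borel_measurable_diff borel_measurable_const) auto
    show "AE y in lborel. norm (indicator (cball x (2 * t)) y * norm (v y - v x) ^ q) \<le> norm ((2 * M) ^ q * indicator (cball x (2 * t)) y)"
    proof (rule AE_I2)
      fix y
      show "norm (indicator (cball x (2 * t)) y * norm (v y - v x) ^ q) \<le> norm ((2 * M) ^ q * indicator (cball x (2 * t)) y)"
      proof (cases "y \<in> cball x (2 * t)")
        case True
        have "norm y \<le> 3/4"
          using norm_triangle_ineq[of x "y - x"] True x t by (simp add: dist_norm norm_minus_commute)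
        then have "norm (v y - v x) \<le> 2 * M"
          using norm_triangle_ineq4[of "v y" "v x"] M[of y] M[of x] x by simp
        then have "norm (v y - v x) ^ q \<le> (2 * M) ^ q" by (intro power_mono) auto
        then show ?thesis using True by simp
      qed simp
    qed
  qed
qed

text \<open>The ball of radius \<open>t / 2\<close> around \<open>(1 - t) x\<close> is contained in the ball of radius \<open>2 t\<close> around \<open>x\<close>, and on the latter Jensen's
  inequality bounds the mean oscillation by a root of the energy. With \<open>t = \<tau>\<^bsup>k + 1\<^esup>\<close> the power \<open>t\<^bsup>k / (k + 1)\<^esup>\<close>
  that comes out is \<open>\<tau>\<^sup>k\<close>.\<close>

lemma kernel_oscillation_bound:
  fixes v :: "real^'n \<Rightarrow> real^'m"
  assumes v: "integrable lborel v" and M: "\<And>x. norm x \<le> 3/4 \<Longrightarrow> norm (v x) \<le> M"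
    and x: "norm x \<le> 1/2" and \<tau>: "0 < \<tau>" "t = \<tau> ^ Suc k" "t \<le> 1/8"
    and \<kappa>: "continuous_on UNIV \<kappa>" "zero_beyond (t/2) \<kappa>" "\<And>w. \<bar>\<kappa> w\<bar> \<le> B"
  shows "\<bar>\<integral>y. \<kappa> (y - (1 - t) *\<^sub>R x) * (v y $ i - v x $ i) \<partial>lborel\<bar>
    \<le> B * t ^ CARD('n) * ((1 + unit_ball_vol (CARD('n)) * 2 ^ CARD('n)) * (\<tau> ^ k * root (Suc k) (osc_energy k v t x)))"
proof -
  have t0: "t > 0" using \<tau> by simp
  have B0: "B \<ge> 0" using \<kappa>(3)[of 0] by (meson abs_ge_zero order_trans)
  have vm [measurable]: "v \<in> borel_measurable borel" using v by auto
  let ?h = "\<lambda>y. norm (v y - v x)"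
  let ?A = "cball x (2 * t)"
  define n where "n = CARD('n)"
  define w where "w = unit_ball_vol (real n) * 2 ^ n"
  have w0: "w > 0" by (simp add: w_def)
  have i1: "integrable lborel (\<lambda>y. indicator ?A y * ?h y)"
    using integrable_osc[OF vm M x \<tau>(3), of 1] by simp
  have i2: "integrable lborel (\<lambda>y. indicator ?A y * ?h y ^ Suc k)"
    by (rule integrable_osc[OF vm M x \<tau>(3)])
  define I where "I = (\<integral>y. indicator ?A y * ?h y \<partial>lborel)"
  have I0: "I \<ge> 0" unfolding I_def by (intro Bochner_Integration.integral_nonneg) auto
  have pt: "norm (\<kappa> (y - (1 - t) *\<^sub>R x) * (v y $ i - v x $ i)) \<le> B * (indicator ?A y * ?h y)" for y
  proof (cases "t / 2 < norm (y - (1 - t) *\<^sub>R x)")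
    case True
    then show ?thesis using zero_beyondD[OF \<kappa>(2) True] B0 by simp
  next
    case False
    have "y - x = (y - (1 - t) *\<^sub>R x) - t *\<^sub>R x" by (simp add: algebra_simps)
    then have "norm (y - x) \<le> norm (y - (1 - t) *\<^sub>R x) + norm (t *\<^sub>R x)" by (metis norm_triangle_ineq4)
    also have "norm (t *\<^sub>R x) \<le> t * (1/2)" using t0 x by (simp add: mult_left_mono)
    finally have "y \<in> ?A" using False t0 by (simp add: dist_norm norm_minus_commute)
    moreover have "\<bar>v y $ i - v x $ i\<bar> \<le> ?h y" using component_le_norm_cart[of "v y - v x" i] by simp
    ultimately show ?thesis using \<kappa>(3) B0 by (simp add: abs_mult mult_mono)
  qed
  have "\<bar>\<integral>y. \<kappa> (y - (1 - t) *\<^sub>R x) * (v y $ i - v x $ i) \<partial>lborel\<bar> \<le> (\<integral>y. B * (indicator ?A y * ?h y) \<partial>lborel)"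
  proof -
    have "norm (\<integral>y. \<kappa> (y - (1 - t) *\<^sub>R x) * (v y $ i - v x $ i) \<partial>lborel) \<le> (\<integral>y. B * (indicator ?A y * ?h y) \<partial>lborel)"
    proof (rule Bochner_Integration.integral_norm_bound_integral)
      have [measurable]: "\<kappa> \<in> borel_measurable borel" using \<kappa>(1) by (rule borel_measurable_continuous_onI)
      have [measurable]: "(\<lambda>y. v y $ i) \<in> borel_measurable borel" by (rule measurable_vec_nth[OF vm])
      show "integrable lborel (\<lambda>y. B * (indicator ?A y * ?h y))" using i1 by simp
      then show "integrable lborel (\<lambda>y. \<kappa> (y - (1 - t) *\<^sub>R x) * (v y $ i - v x $ i))"
        by (rule Bochner_Integration.integrable_bound) (use pt B0 in \<open>auto intro!: AE_I2\<close>)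
    qed (rule pt)
    then show ?thesis by simp
  qed
  also have "\<dots> = B * I" by (simp add: I_def)
  also have "I \<le> t ^ n * ((1 + w) * (\<tau> ^ k * root (Suc k) (osc_energy k v t x)))" (is "I \<le> ?R")
  proof -
    have oe: "(\<integral>y. indicator ?A y * ?h y ^ Suc k \<partial>lborel) = t ^ (n + k) * osc_energy k v t x"
      using t0 by (simp add: osc_energy_def n_def)
    have vol: "measure lborel ?A = w * t ^ n"
      using content_cball[of "2 * t" x] t0 by (simp add: w_def n_def power_mult_distrib)
    have "I ^ Suc k \<le> (w * t ^ n) ^ k * (\<integral>y. indicator ?A y * ?h y ^ Suc k \<partial>lborel)"
      unfolding I_def
      by (rule power_integral_le[OF _ _ _ _ _ i1 i2]) (use vol w0 t0 emeasure_bounded_finite[OF bounded_cball] in auto)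
    also have "\<dots> = w ^ k * (t ^ n * \<tau> ^ k) ^ Suc k * osc_energy k v t x"
    proof -
      have tk: "t ^ k = (\<tau> ^ k) ^ Suc k" unfolding \<tau>(2) by (metis mult.commute power_mult)
      have "(w * t ^ n) ^ k * (t ^ (n + k) * E) = w ^ k * ((t ^ n) ^ Suc k * t ^ k) * E" for E
        by (simp add: power_mult_distrib power_add)
      also have "(t ^ n) ^ Suc k * t ^ k = (t ^ n * \<tau> ^ k) ^ Suc k" unfolding tk power_mult_distrib ..
      finally show ?thesis unfolding oe .
    qed
    also have "\<dots> \<le> (1 + w) ^ Suc k * (t ^ n * \<tau> ^ k) ^ Suc k * osc_energy k v t x"
    proof (intro mult_right_mono)
      have "w ^ k \<le> (1 + w) ^ k" using w0 by (intro power_mono) auto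
      also have "\<dots> \<le> (1 + w) ^ Suc k" using w0 by (intro power_increasing) auto
      finally show "w ^ k \<le> (1 + w) ^ Suc k" .
    qed (use t0 \<tau> osc_energy_nonneg[OF t0] in auto)
    also have "\<dots> = ?R ^ Suc k"
      using osc_energy_nonneg[OF t0, of k v x] by (simp add: power_mult_distrib real_root_pow_pos2 del: power_Suc)
    finally have "I ^ Suc k \<le> ?R ^ Suc k" .
    moreover have "0 \<le> ?R"
      using t0 \<tau> w0 osc_energy_nonneg[OF t0, of k v x] by (intro mult_nonneg_nonneg) auto
    ultimately show ?thesis using power_le_imp_le_base by blast
  qed
  finally show ?thesis using B0 by (simp add: n_def w_def mult.assoc mult_left_mono)
qed

lemma mollifier_bounds:
  obtains C0 where "C0 > 0" "\<And>w. \<bar>mollifier (w :: real^'n)\<bar> \<le> C0" "\<And>a w. \<bar>partial a (mollifier :: real^'n \<Rightarrow> real) w\<bar> \<le> C0"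
proof -
  obtain C1 where C1: "C1 > 0" "\<And>w. \<bar>mollifier (w :: real^'n)\<bar> \<le> C1"
    using bounded_continuous_bounded_support[OF smooth_on_continuous[OF smooth_mollifier] zero_beyond_mollifier] by blast
  have "\<exists>C. \<forall>w. \<bar>partial a (mollifier :: real^'n \<Rightarrow> real) w\<bar> \<le> C" for a
    using bounded_continuous_bounded_support[OF smooth_on_continuous[OF smooth_on_partial[OF smooth_mollifier]] zero_beyond_partial[OF zero_beyond_mollifier]]
    by metis
  then obtain C where C: "\<And>a w. \<bar>partial a (mollifier :: real^'n \<Rightarrow> real) w\<bar> \<le> C a" by metis
  have C0: "C a \<ge> 0" for a using C[of a 0] by linarith
  have "C a \<le> (\<Sum>a\<in>UNIV. C a)" for a using C0 by (intro member_le_sum) auto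
  note le = this
  have S: "0 \<le> (\<Sum>a\<in>UNIV. C a)" using C0 by (intro sum_nonneg) auto
  show ?thesis
  proof (rule that[of "C1 + (\<Sum>a\<in>UNIV. C a)"])
    show "0 < C1 + (\<Sum>a\<in>UNIV. C a)" using C1(1) S by linarith
    show "\<bar>mollifier w\<bar> \<le> C1 + (\<Sum>a\<in>UNIV. C a)" for w :: "real^'n" using C1(2)[of w] S by linarith
    show "\<bar>partial a mollifier w\<bar> \<le> C1 + (\<Sum>a\<in>UNIV. C a)" for a and w :: "real^'n"
      using C[of a w] le[of a] C1(1) by linarith
  qed
qed

lemma partial_scaled_mollifier:
  assumes "t > 0"
  shows "partial a (scaled_mollifier t :: real^'n \<Rightarrow> real) w = (1 / t ^ Suc (CARD('n))) * partial a mollifier ((1 / t) *\<^sub>R w)"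
proof -
  have d: "(\<lambda>w::real^'n. ((1 / t) *\<^sub>R w) $ i) differentiable (at w)" for w i
    using smooth_on_differentiable[OF smooth_on_mult[OF smooth_on_const[of "1 / t"] smooth_on_component[of i]]] by simp
  have p: "partial a (\<lambda>w::real^'n. ((1 / t) *\<^sub>R w) $ i) w = (if a = i then 1 / t else 0)" for i
    using partial_cmult[of "\<lambda>w::real^'n. w $ i" w a "1 / t", OF smooth_on_differentiable[OF smooth_on_component]]
    by (simp add: partial_component)
  note dm = smooth_on_differentiable[OF smooth_mollifier]
  have "partial a (scaled_mollifier t :: real^'n \<Rightarrow> real) w
      = (1 / t ^ CARD('n)) * partial a (\<lambda>w::real^'n. mollifier ((1 / t) *\<^sub>R w)) w"
    unfolding scaled_mollifier_def by (rule partial_cmult[OF partial_compose(1)[OF dm d]])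
  also have "partial a (\<lambda>w::real^'n. mollifier ((1 / t) *\<^sub>R w)) w = (1 / t) * partial a mollifier ((1 / t) *\<^sub>R w)"
    unfolding partial_compose(2)[of mollifier "\<lambda>w. (1 / t) *\<^sub>R w", OF dm d] p
    by (simp add: if_distrib sum.delta cong: if_cong)
  finally show ?thesis by simp
qed

lemma integral_scaled_mollifier:
  fixes z :: "real^'n"
  assumes "t > 0"
  shows "(\<integral>y. scaled_mollifier t (y - z) \<partial>lborel) = 1"
    and "(\<integral>y. partial a (scaled_mollifier t) (y - z) \<partial>lborel) = 0"
    and "integrable lborel (\<lambda>y. scaled_mollifier t (y - z))"
    and "integrable lborel (\<lambda>y. partial a (scaled_mollifier t) (y - z))"
proof -
  note sm = smooth_scaled_mollifier[of t, where ?'n = 'n]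
  have zb: "zero_beyond (t / 2 + norm z) (\<lambda>y. f (y - z))" if "zero_beyond (t / 2) f" for f :: "real^'n \<Rightarrow> real"
    unfolding zero_beyond_def
  proof (intro allI impI)
    fix y :: "real^'n" assume "t / 2 + norm z < norm y"
    then have "t / 2 < norm (y - z)" using norm_triangle_ineq2[of y z] by simp
    then show "f (y - z) = 0" using that by (simp add: zero_beyond_def)
  qed
  note z0 = zb[OF zero_beyond_scaled_mollifier[OF assms]]
  note sz = partial_translate(2)[OF sm, of z]
  have eq: "(\<lambda>y. partial a (scaled_mollifier t) (y - z)) = partial a (\<lambda>y. scaled_mollifier t (y - z))"
    using partial_translate(1)[OF sm] by auto
  show "(\<integral>y. partial a (scaled_mollifier t) (y - z) \<partial>lborel) = 0"
    unfolding eq by (rule integral_partial_eq_0[OF sz z0])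
  show "integrable lborel (\<lambda>y. scaled_mollifier t (y - z))"
    by (rule integrable_continuous_bounded_support[OF smooth_on_continuous[OF sz] z0])
  show "integrable lborel (\<lambda>y. partial a (scaled_mollifier t) (y - z))"
    unfolding eq by (rule integrable_continuous_bounded_support[OF smooth_on_continuous[OF smooth_on_partial[OF sz]] zero_beyond_partial[OF z0]])
  have "(\<integral>y. scaled_mollifier t (y - z) \<partial>lborel) = (\<integral>w. t ^ DIM(real^'n) * scaled_mollifier t ((z + t *\<^sub>R w) - z) \<partial>lborel)"
    by (rule lborel_integral_affine(1)[OF borel_measurable_continuous_onI[OF smooth_on_continuous[OF sz]] assms])
  also have "\<dots> = (\<integral>w. mollifier (w :: real^'n) \<partial>lborel)"
    using assms by (intro Bochner_Integration.integral_cong) (auto simp: scaled_mollifier_def)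
  finally show "(\<integral>y. scaled_mollifier t (y - z) \<partial>lborel) = 1" by (simp add: integral_mollifier)
qed

text \<open>The kernel has integral \<open>1\<close> and its derivatives have integral \<open>0\<close>, so that in both cases the value \<open>v x\<close> may be
  subtracted under the integral.\<close>

lemma smoothen_oscillation_bounds:
  obtains C where "C > 0"
    "\<forall>(v :: real^'n \<Rightarrow> real^'m) M x t \<tau> i a. integrable lborel v \<longrightarrow> (\<forall>x. norm x \<le> 3/4 \<longrightarrow> norm (v x) \<le> M) \<longrightarrow>
      norm x \<le> 1/2 \<longrightarrow> 0 < \<tau> \<longrightarrow> t = \<tau> ^ Suc k \<longrightarrow> t \<le> 1/8 \<longrightarrow>
      \<bar>smoothen t v x $ i - v x $ i\<bar> \<le> C * (\<tau> ^ k * root (Suc k) (osc_energy k v t x)) \<and>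
      \<bar>partial a (\<lambda>x. smoothen t v x $ i) x\<bar> \<le> C * (root (Suc k) (osc_energy k v t x) / \<tau>)"
proof -
  obtain C0 where C0: "C0 > 0" "\<And>w. \<bar>mollifier (w :: real^'n)\<bar> \<le> C0" "\<And>a w. \<bar>partial a (mollifier :: real^'n \<Rightarrow> real) w\<bar> \<le> C0"
    by (rule mollifier_bounds) (rule that)
  let ?w = "1 + unit_ball_vol (CARD('n)) * 2 ^ CARD('n)"
  have w0: "?w > 0" by (intro add_pos_nonneg mult_nonneg_nonneg) auto
  define C where "C = C0 * ?w"
  have C: "C > 0" using C0 w0 by (simp add: C_def)
  have H: "\<bar>smoothen t v x $ i - v x $ i\<bar> \<le> C * (\<tau> ^ k * root (Suc k) (osc_energy k v t x)) \<and>
      \<bar>partial a (\<lambda>x. smoothen t v x $ i) x\<bar> \<le> C * (root (Suc k) (osc_energy k v t x) / \<tau>)"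
    if v: "integrable lborel v" and M: "\<And>x. norm x \<le> 3/4 \<Longrightarrow> norm (v x) \<le> M" and x: "norm x \<le> 1/2"
      and \<tau>: "0 < \<tau>" "t = \<tau> ^ Suc k" "t \<le> 1/8"
    for v :: "real^'n \<Rightarrow> real^'m" and M x t \<tau> i a
  proof
    have t0: "t > 0" using \<tau> by simp
    note sm = smooth_scaled_mollifier[of t, where ?'n = 'n]
    note zb = zero_beyond_scaled_mollifier[OF t0, where ?'n = 'n]
    let ?z = "(1 - t) *\<^sub>R x"
    define R where "R = root (Suc k) (osc_energy k v t x)"
    have R0: "R \<ge> 0" using osc_energy_nonneg[OF t0, of k v x] by (simp add: R_def)
    have vi: "integrable lborel (\<lambda>y. v y $ i)" by (rule integrable_vec_nth[OF v])
    have id: "integrable lborel (\<lambda>y. scaled_mollifier t (y - ?z) * v y $ i)"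
      by (rule integrable_dconv[OF smooth_on_continuous[OF sm] zb vi])
    have "smoothen t v x $ i - v x $ i = (\<integral>y. scaled_mollifier t (y - ?z) * v y $ i \<partial>lborel) - (\<integral>y. scaled_mollifier t (y - ?z) \<partial>lborel) * v x $ i"
      by (simp add: integral_scaled_mollifier(1)[OF t0] smoothen_def dconv_def)
    also have "\<dots> = (\<integral>y. scaled_mollifier t (y - ?z) * (v y $ i - v x $ i) \<partial>lborel)"
      using id integral_scaled_mollifier(3)[OF t0, of ?z] by (simp add: right_diff_distrib)
    finally have "\<bar>smoothen t v x $ i - v x $ i\<bar> = \<bar>\<integral>y. scaled_mollifier t (y - ?z) * (v y $ i - v x $ i) \<partial>lborel\<bar>" by simp
    also have "\<dots> \<le> (C0 / t ^ CARD('n)) * t ^ CARD('n) * (?w * (\<tau> ^ k * R))"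
      unfolding R_def
    proof (rule kernel_oscillation_bound[OF v M x \<tau> smooth_on_continuous[OF sm] zb])
      show "\<bar>scaled_mollifier t y\<bar> \<le> C0 / t ^ CARD('n)" for y :: "real^'n"
        using t0 C0(2)[of "(1/t) *\<^sub>R y"] by (simp add: scaled_mollifier_def abs_mult divide_right_mono)
    qed
    also have "\<dots> = C * (\<tau> ^ k * R)" using t0 by (simp add: C_def)
    finally show "\<bar>smoothen t v x $ i - v x $ i\<bar> \<le> C * (\<tau> ^ k * root (Suc k) (osc_energy k v t x))"
      by (simp add: R_def)
    have id': "integrable lborel (\<lambda>y. partial a (scaled_mollifier t) (y - ?z) * v y $ i)"
      by (rule integrable_dconv[OF smooth_on_continuous[OF smooth_on_partial[OF sm]] zero_beyond_partial[OF zb] vi])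
    have "partial a (\<lambda>x. smoothen t v x $ i) x = - (1 - t) * dconv (partial a (scaled_mollifier t)) (1 - t) (\<lambda>y. v y $ i) x"
      unfolding smoothen_def vec_lambda_beta by (rule partial_dconv[OF sm zb vi])
    also have "\<dots> = - (1 - t) * (\<integral>y. partial a (scaled_mollifier t) (y - ?z) * v y $ i \<partial>lborel)"
      by (simp only: dconv_def)
    also have "(\<integral>y. partial a (scaled_mollifier t) (y - ?z) * v y $ i \<partial>lborel)
        = (\<integral>y. partial a (scaled_mollifier t) (y - ?z) * v y $ i \<partial>lborel) - (\<integral>y. partial a (scaled_mollifier t) (y - ?z) \<partial>lborel) * v x $ i"
      by (simp add: integral_scaled_mollifier(2)[OF t0])
    also have "\<dots> = (\<integral>y. partial a (scaled_mollifier t) (y - ?z) * (v y $ i - v x $ i) \<partial>lborel)"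
      using id' integral_scaled_mollifier(4)[OF t0, of a ?z] by (simp add: right_diff_distrib)
    finally have "\<bar>partial a (\<lambda>x. smoothen t v x $ i) x\<bar> = (1 - t) * \<bar>\<integral>y. partial a (scaled_mollifier t) (y - ?z) * (v y $ i - v x $ i) \<partial>lborel\<bar>"
      using \<tau>(3) by (simp add: abs_mult)
    also have "\<dots> \<le> 1 * \<bar>\<integral>y. partial a (scaled_mollifier t) (y - ?z) * (v y $ i - v x $ i) \<partial>lborel\<bar>"
      using t0 by (intro mult_right_mono) auto
    also have "\<bar>\<integral>y. partial a (scaled_mollifier t) (y - ?z) * (v y $ i - v x $ i) \<partial>lborel\<bar>
        \<le> (C0 / t ^ Suc (CARD('n))) * t ^ CARD('n) * (?w * (\<tau> ^ k * R))"
      unfolding R_def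
    proof (rule kernel_oscillation_bound[OF v M x \<tau> smooth_on_continuous[OF smooth_on_partial[OF sm]] zero_beyond_partial[OF zb]])
      show "\<bar>partial a (scaled_mollifier t) y\<bar> \<le> C0 / t ^ Suc (CARD('n))" for y :: "real^'n"
        unfolding partial_scaled_mollifier[OF t0] using t0 C0(3)[of a "(1/t) *\<^sub>R y"] by (simp add: abs_mult divide_right_mono)
    qed
    also have "\<dots> = C * (\<tau> ^ k * R / t)" using t0 by (simp add: C_def)
    also have "\<tau> ^ k * R / t = R / \<tau>" using \<tau>(1) by (simp add: \<tau>(2))
    finally show "\<bar>partial a (\<lambda>x. smoothen t v x $ i) x\<bar> \<le> C * (root (Suc k) (osc_energy k v t x) / \<tau>)"
      by (simp add: R_def)
  qed
  show ?thesis by (rule that[OF C], intro allI impI, rule H) blast+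
qed

section \<open>The oscillation energy of a fractional Sobolev function\<close>

lemma measurable_osc_energy:
  fixes v :: "real^'n \<Rightarrow> real^'m"
  assumes v: "v \<in> borel_measurable borel"
  shows "osc_energy k v t \<in> borel_measurable borel"
proof -
  let ?S = "{\<xi> :: (real^'n) \<times> (real^'n). dist (fst \<xi>) (snd \<xi>) \<le> 2 * t}"
  have S: "?S \<in> sets borel" by (intro borel_closed closed_Collect_le continuous_intros)
  have c: "(\<lambda>\<xi>::(real^'n) \<times> (real^'n). v (fst \<xi>)) \<in> borel_measurable borel"
    "(\<lambda>\<xi>::(real^'n) \<times> (real^'n). v (snd \<xi>)) \<in> borel_measurable borel"
    using v by (auto simp: borel_prod[symmetric])
  have "(\<lambda>\<xi>. indicator ?S \<xi> * norm (v (snd \<xi>) - v (fst \<xi>)) ^ Suc k) \<in> borel_measurable borel"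
  proof (intro borel_measurable_times borel_measurable_indicator borel_measurable_power S)
    have "(\<lambda>\<xi>::(real^'n) \<times> (real^'n). v (snd \<xi>) - v (fst \<xi>)) \<in> borel_measurable borel"
      by (intro borel_measurable_diff c)
    then show "(\<lambda>\<xi>::(real^'n) \<times> (real^'n). norm (v (snd \<xi>) - v (fst \<xi>))) \<in> borel_measurable borel"
      by measurable
  qed
  moreover have "(\<lambda>\<xi>. indicator ?S \<xi> * norm (v (snd \<xi>) - v (fst \<xi>)) ^ Suc k)
      = (\<lambda>(x, y). indicator (cball x (2 * t)) y * norm (v y - v x) ^ Suc k)"
    by (auto simp: fun_eq_iff indicator_def)
  ultimately have "(\<lambda>(x, y). indicator (cball x (2 * t)) y * norm (v y - v x) ^ Suc k) \<in> borel_measurable (borel \<Otimes>\<^sub>M lborel)"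
    by (simp add: borel_prod[symmetric] measurable_cong_sets[OF sets_pair_measure_cong[OF refl sets_lborel] refl] del: power_Suc)
  from lborel.borel_measurable_lebesgue_integral[OF this]
  show ?thesis unfolding osc_energy_def[abs_def] by (intro borel_measurable_times borel_measurable_const)
qed

text \<open>On the ball of radius \<open>3/4\<close> the map is bounded by some \<open>M\<close>, and \<open>p \<le> k + 1\<close>; hence
  \<open>|u y - u x|\<^bsup>k + 1\<^esup> \<le> (2 M)\<^bsup>k + 1 - p\<^esup> |u y - u x|\<^sup>p\<close>. For \<open>|x - y| \<le> 2 t\<close> the factor \<open>t\<^bsup>- n - k\<^esup>\<close> is at most
  a constant times \<open>|x - y|\<^bsup>- n - k\<^esup>\<close>, and \<open>k = s p\<close>. So the energy is bounded by the Gagliardo integral over the pairs with \<open>|x - y| \<le> 2 t\<close>, a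
  neighbourhood of the diagonal that shrinks with \<open>t\<close>.\<close>

lemma osc_energy_tendsto_0:
  fixes u :: "real^'n \<Rightarrow> real^'m" and t :: "nat \<Rightarrow> real"
  assumes u: "continuous_on (ball 0 1) u" and fin: "gagliardo_seminorm s p (ball 0 1) u < \<infinity>"
    and sp: "s * p = real k" "0 < p" "p \<le> real k + 1"
    and t: "\<And>l. 0 < t l" "\<And>l. t l \<le> 1/8" "t \<longlonglongrightarrow> 0"
  defines "J \<equiv> \<lambda>l x. indicator (cball 0 (1/2)) x * osc_energy k (zero_extension u) (t l) x"
  shows "\<forall>\<^sub>F l in sequentially. integrable lborel (J l)" and "(\<lambda>l. \<integral>x. J l x \<partial>lborel) \<longlonglongrightarrow> 0"
proof -
  let ?u = "zero_extension u"
  let ?B = "ball 0 1 \<times> ball 0 1 :: ((real^'n) \<times> (real^'n)) set"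
  define n where "n = CARD('n)"
  let ?\<gamma> = "(real CARD('n) + s * p) / p"
  have um: "?u \<in> borel_measurable borel" by (rule measurable_zero_extension[OF u])
  obtain M where M: "M > 0" "\<And>x. norm x \<le> 3/4 \<Longrightarrow> norm (?u x) \<le> M" by (rule local_bound_zero_extension[OF u]) (rule that)
  define N where "N \<xi> = norm (gagliardo_quotient ?\<gamma> ?u \<xi>) powr p" for \<xi>
  have N: "N (x, y) = norm (?u x - ?u y) powr p / norm (x - y) powr real (n + k)" for x y
    unfolding N_def norm_gagliardo_quotient[OF sp(2)] by (simp add: n_def sp(1))
  have N0: "N \<xi> \<ge> 0" for \<xi> by (simp add: N_def)
  have Nm: "N \<in> borel_measurable borel"
    unfolding N_def using measurable_gagliardo_quotient[OF um] by measurable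
  have Bm: "?B \<in> sets borel" by (intro borel_open open_Times) auto
  have Nfin: "(\<integral>\<^sup>+\<xi>. indicator ?B \<xi> * ennreal (N \<xi>) \<partial>lborel) < \<infinity>"
  proof -
    have "gagliardo_seminorm s p (ball 0 1) u = ennroot p (\<integral>\<^sup>+\<xi>. indicator ?B \<xi> * ennreal (N \<xi>) \<partial>lborel)"
      unfolding N_def by (rule gagliardo_seminorm_eq[OF sp(2) um]) (simp add: zero_extension_def)
    then show ?thesis using fin by (simp only: ennroot_finite)
  qed
  let ?S = "\<lambda>l. {\<xi> :: (real^'n) \<times> (real^'n). dist (fst \<xi>) (snd \<xi>) \<le> 2 * t l}"
  have S: "?S l \<in> sets borel" for l by (intro borel_closed closed_Collect_le continuous_intros)
  define Q where "Q l \<xi> = indicator (?S l) \<xi> * (indicator ?B \<xi> * ennreal (N \<xi>))" for l \<xi>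
  have NBm: "(\<lambda>\<xi>. indicator ?B \<xi> * ennreal (N \<xi>)) \<in> borel_measurable lborel"
    using Nm Bm by auto
  have Qm: "Q l \<in> borel_measurable lborel" for l
    unfolding Q_def[abs_def] using S[of l] by (intro borel_measurable_times_ennreal borel_measurable_indicator NBm) auto
  have Qlim: "(\<lambda>l. integral\<^sup>N lborel (Q l)) \<longlonglongrightarrow> integral\<^sup>N lborel (\<lambda>\<xi>::(real^'n) \<times> (real^'n). 0)"
  proof (rule nn_integral_dominated_convergence[OF Qm _ NBm _ Nfin])
    show "AE \<xi> in lborel. Q l \<xi> \<le> indicator ?B \<xi> * ennreal (N \<xi>)" for l
      by (rule AE_I2) (simp add: Q_def indicator_def)
    show "AE \<xi> in lborel. (\<lambda>l. Q l \<xi>) \<longlonglongrightarrow> 0"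
    proof (rule AE_I2)
      fix \<xi> :: "(real^'n) \<times> (real^'n)"
      obtain x y where \<xi>: "\<xi> = (x, y)" by (cases \<xi>)
      show "(\<lambda>l. Q l \<xi>) \<longlonglongrightarrow> 0"
      proof (cases "x = y")
        case True
        then have "N \<xi> = 0" using sp(2) by (simp add: \<xi> N)
        then show ?thesis by (simp add: Q_def)
      next
        case False
        then have "\<forall>\<^sub>F l in sequentially. t l < dist x y / 2" using order_tendstoD(2)[OF t(3), of "dist x y / 2"] by simp
        then have "\<forall>\<^sub>F l in sequentially. Q l \<xi> = 0"
          by (rule eventually_mono) (simp add: Q_def \<xi> indicator_def)
        then show ?thesis by (rule tendsto_eventually)
      qed
    qed
  qed simp
  define c where "c = 2 ^ (n + k) * (2 * M) powr (real k + 1 - p)"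
  have c0: "c \<ge> 0" by (simp add: c_def)
  have point: "1 / t l ^ (n + k) * norm (?u y - ?u x) ^ Suc k \<le> c * N (y, x)"
    if x: "norm x \<le> 1/2" and y: "y \<in> cball x (2 * t l)" for l x y
  proof (cases "?u y = ?u x")
    case True
    then show ?thesis using c0 N0 by simp
  next
    case False
    then have ne: "y \<noteq> x" by auto
    define D where "D = norm (?u y - ?u x)"
    define d where "d = norm (y - x)"
    have D: "D > 0" and d: "d > 0" using False ne by (auto simp: D_def d_def)
    have "norm y \<le> 3/4"
      using norm_triangle_ineq[of x "y - x"] y x t(2)[of l] by (simp add: dist_norm norm_minus_commute)
    then have DM: "D \<le> 2 * M"
      unfolding D_def using norm_triangle_ineq4[of "?u y" "?u x"] M(2)[of y] M(2)[of x] x by simp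
    have "d \<le> 2 * t l" using y by (simp add: d_def dist_norm norm_minus_commute)
    then have "d ^ (n + k) \<le> (2 * t l) ^ (n + k)" using d by (intro power_mono) auto
    then have 1: "1 / t l ^ (n + k) \<le> 2 ^ (n + k) / d ^ (n + k)"
      using d t(1)[of l] by (simp add: field_simps power_mult_distrib)
    have "D ^ Suc k = D powr real (Suc k)" by (rule powr_realpow[OF D, symmetric])
    also have "\<dots> = D powr p * D powr (real k + 1 - p)" by (simp add: powr_add[symmetric] add.commute)
    also have "\<dots> \<le> D powr p * (2 * M) powr (real k + 1 - p)"
      using D DM sp(3) by (intro mult_left_mono powr_mono2) auto
    finally have 2: "D ^ Suc k \<le> D powr p * (2 * M) powr (real k + 1 - p)" .
    have "1 / t l ^ (n + k) * D ^ Suc k \<le> (2 ^ (n + k) / d ^ (n + k)) * (D powr p * (2 * M) powr (real k + 1 - p))"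
      using 1 2 D t(1)[of l] d by (intro mult_mono) auto
    also have "\<dots> = c * N (y, x)"
      unfolding N c_def D_def[symmetric] d_def[symmetric] powr_realpow[OF d] by (simp add: mult_ac)
    finally show ?thesis by (simp add: D_def)
  qed
  have bound: "(\<integral>\<^sup>+x. ennreal (J l x) \<partial>lborel) \<le> ennreal c * integral\<^sup>N lborel (Q l)" for l
  proof -
    have "ennreal (J l x) \<le> (\<integral>\<^sup>+y. ennreal c * Q l (y, x) \<partial>lborel)" for x
    proof (cases "norm x \<le> 1/2")
      case True
      let ?h = "\<lambda>y. 1 / t l ^ (n + k) * (indicator (cball x (2 * t l)) y * norm (?u y - ?u x) ^ Suc k)"
      have i: "integrable lborel ?h"
        by (intro integrable_mult_right integrable_osc[OF um M(2) True t(2)])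
      have "J l x = (\<integral>y. ?h y \<partial>lborel)"
        using True by (simp add: J_def osc_energy_def n_def)
      then have "ennreal (J l x) = (\<integral>\<^sup>+y. ennreal (?h y) \<partial>lborel)"
        using t(1)[of l] by (subst nn_integral_eq_integral[OF i]) (auto intro!: AE_I2)
      also have "\<dots> \<le> (\<integral>\<^sup>+y. ennreal c * Q l (y, x) \<partial>lborel)"
      proof (rule nn_integral_mono)
        fix y
        show "ennreal (?h y) \<le> ennreal c * Q l (y, x)"
        proof (cases "y \<in> cball x (2 * t l)")
          case in_ball: True
          have "norm y < 1"
            using norm_triangle_ineq[of x "y - x"] in_ball True t(2)[of l] by (simp add: dist_norm norm_minus_commute)
          then have "(y, x) \<in> ?B" "(y, x) \<in> ?S l" using True in_ball by (auto simp: dist_commute)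
          then have "ennreal c * Q l (y, x) = ennreal (c * N (y, x))"
            using c0 N0[of "(y, x)"] by (simp add: Q_def ennreal_mult)
          then show ?thesis using point[OF True in_ball] in_ball by (simp add: ennreal_leI)
        qed simp
      qed
      finally show ?thesis .
    qed (simp add: J_def)
    then have "(\<integral>\<^sup>+x. ennreal (J l x) \<partial>lborel) \<le> (\<integral>\<^sup>+x. (\<integral>\<^sup>+y. ennreal c * Q l (y, x) \<partial>lborel) \<partial>lborel)"
      by (rule nn_integral_mono)
    also have "\<dots> = (\<integral>\<^sup>+\<xi>. ennreal c * Q l \<xi> \<partial>(lborel \<Otimes>\<^sub>M lborel))"
      by (rule lborel_pair.nn_integral_snd) (use Qm[of l] in \<open>simp add: lborel_prod\<close>)
    also have "\<dots> = ennreal c * integral\<^sup>N lborel (Q l)"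
      unfolding lborel_prod by (rule nn_integral_cmult[OF Qm])
    finally show ?thesis .
  qed
  have Jm: "J l \<in> borel_measurable lborel" for l
    unfolding J_def[abs_def] using measurable_osc_energy[OF um] by (intro borel_measurable_times borel_measurable_indicator) auto
  have J0: "0 \<le> J l x" for l x
    unfolding J_def using osc_energy_nonneg[OF t(1)] by (intro mult_nonneg_nonneg) auto
  have lim: "(\<lambda>l. \<integral>\<^sup>+x. ennreal (J l x) \<partial>lborel) \<longlonglongrightarrow> 0"
  proof (rule tendsto_sandwich[OF _ _ tendsto_const])
    have "(\<lambda>l. ennreal c * integral\<^sup>N lborel (Q l)) \<longlonglongrightarrow> ennreal c * 0"
      using Qlim by (intro ennreal_tendsto_cmult) auto
    then show "(\<lambda>l. ennreal c * integral\<^sup>N lborel (Q l)) \<longlonglongrightarrow> 0" by simp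
  qed (use bound in auto)
  then have "\<forall>\<^sub>F l in sequentially. (\<integral>\<^sup>+x. ennreal (J l x) \<partial>lborel) < \<infinity>" by (intro order_tendstoD) auto
  then show ev: "\<forall>\<^sub>F l in sequentially. integrable lborel (J l)"
  proof (rule eventually_mono)
    fix l assume "(\<integral>\<^sup>+x. ennreal (J l x) \<partial>lborel) < \<infinity>"
    then show "integrable lborel (J l)"
      by (intro integrableI_nonneg[OF Jm]) (auto intro!: AE_I2 J0)
  qed
  have "(\<lambda>l. ennreal (\<integral>x. J l x \<partial>lborel)) \<longlonglongrightarrow> 0"
  proof (rule Lim_transform_eventually[OF lim])
    show "\<forall>\<^sub>F l in sequentially. (\<integral>\<^sup>+x. ennreal (J l x) \<partial>lborel) = ennreal (\<integral>x. J l x \<partial>lborel)"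
      using ev by (rule eventually_mono) (intro nn_integral_eq_integral AE_I2 J0)
  qed
  then show "(\<lambda>l. \<integral>x. J l x \<partial>lborel) \<longlonglongrightarrow> 0"
    by (subst (asm) ennreal_tendsto_0_iff) (intro Bochner_Integration.integral_nonneg J0)
qed

section \<open>Comparing minors at two scales\<close>

lemma zero_beyond_jac_upd:
  assumes "zero_beyond R \<psi>" "l < k"
  shows "zero_beyond R (jac k \<beta> (f(l := \<psi>)))"
  unfolding zero_beyond_def jac_upd
  using zero_beyond_partial[OF assms(1)] assms(2) by (auto intro!: minor_zero_row[of l] simp: zero_beyond_def)

text \<open>The functions are exchanged one at a time. Each step has the gradient of \<open>f l - g l\<close> as a row, and integration by
  parts trades it for the gradient of \<open>\<psi>\<close>.\<close>

lemma integral_jac_difference: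
  fixes f g :: "nat \<Rightarrow> real^'n \<Rightarrow> real"
  assumes f: "\<And>j. smooth_on UNIV (f j)" and g: "\<And>j. smooth_on UNIV (g j)"
    and \<psi>: "smooth_on UNIV \<psi>" "zero_beyond R \<psi>"
  shows "(\<integral>x. \<psi> x * jac k \<beta> f x \<partial>lborel) - (\<integral>x. \<psi> x * jac k \<beta> g x \<partial>lborel)
    = - (\<Sum>l<k. \<integral>x. (f l x - g l x) * jac k \<beta> ((\<lambda>j. if j < l then g j else f j)(l := \<psi>)) x \<partial>lborel)"
proof -
  let ?m = "\<lambda>l j. if j < l then g j else f j"
  have m: "smooth_on UNIV (?m l j)" for l j using f g by auto
  have D: "smooth_on UNIV (\<lambda>x. f l x - g l x)" for l by (intro smooth_on_diff f g)
  have int: "integrable lborel (\<lambda>x. \<psi> x * jac k \<beta> h x)" if "\<And>j. smooth_on UNIV (h j)" for h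
    by (rule integrable_continuous_bounded_support[of _ R])
      (use \<psi> that in \<open>auto intro!: smooth_on_continuous smooth_on_mult smooth_jac simp: zero_beyond_def\<close>)
  have up: "smooth_on UNIV (((?m l)(l := (\<lambda>x. f l x - g l x))) j)" for l j using m D by auto
  have e: "jac k \<beta> f x - jac k \<beta> g x = (\<Sum>l<k. jac k \<beta> ((?m l)(l := (\<lambda>x. f l x - g l x))) x)" for x
    unfolding jac_def[of k \<beta> f] jac_def[of k \<beta> g] minor_diff_telescope
  proof (rule sum.cong[OF refl])
    fix l
    have "(\<lambda>j. if j < l then \<lambda>a. partial (\<beta> a) (g j) x else (\<lambda>a. partial (\<beta> a) (f j) x))(l := \<lambda>a. partial (\<beta> a) (f l) x - partial (\<beta> a) (g l) x)
      = (\<lambda>j a. partial (\<beta> a) (?m l j) x)(l := (\<lambda>a. partial (\<beta> a) (\<lambda>x. f l x - g l x) x))"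
      by (auto simp: fun_eq_iff partial_diff smooth_on_differentiable f g)
    then show "minor k ((\<lambda>j. if j < l then \<lambda>a. partial (\<beta> a) (g j) x else (\<lambda>a. partial (\<beta> a) (f j) x))(l := \<lambda>a. partial (\<beta> a) (f l) x - partial (\<beta> a) (g l) x))
        = jac k \<beta> ((?m l)(l := (\<lambda>x. f l x - g l x))) x"
      unfolding jac_upd by simp
  qed
  have "(\<integral>x. \<psi> x * jac k \<beta> f x \<partial>lborel) - (\<integral>x. \<psi> x * jac k \<beta> g x \<partial>lborel)
      = (\<integral>x. (\<Sum>l<k. \<psi> x * jac k \<beta> ((?m l)(l := (\<lambda>x. f l x - g l x))) x) \<partial>lborel)"
    using int[OF f] int[OF g] by (simp add: right_diff_distrib[symmetric] e sum_distrib_left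
        flip: Bochner_Integration.integral_diff)
  also have "\<dots> = (\<Sum>l<k. \<integral>x. \<psi> x * jac k \<beta> ((?m l)(l := (\<lambda>x. f l x - g l x))) x \<partial>lborel)"
    by (rule Bochner_Integration.integral_sum) (rule int[OF up])
  also have "\<dots> = (\<Sum>l<k. - (\<integral>x. (f l x - g l x) * jac k \<beta> ((?m l)(l := \<psi>)) x \<partial>lborel))"
    by (rule sum.cong[OF refl]) (rule integral_jac_by_parts[OF m \<psi> D], simp)
  finally show ?thesis by (simp add: sum_negf)
qed

lemma integral_jac_difference_bound:
  fixes f g :: "nat \<Rightarrow> real^'n \<Rightarrow> real"
  assumes f: "\<And>j. smooth_on UNIV (f j)" and g: "\<And>j. smooth_on UNIV (g j)"
    and \<psi>: "smooth_on UNIV \<psi>" "zero_beyond R \<psi>"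
    and d: "\<And>j x. norm x \<le> R \<Longrightarrow> \<bar>f j x - g j x\<bar> \<le> d x"
    and r: "\<And>j a x. norm x \<le> R \<Longrightarrow> \<bar>partial a (f j) x\<bar> \<le> r x" "\<And>j a x. norm x \<le> R \<Longrightarrow> \<bar>partial a (g j) x\<bar> \<le> r x"
    and q: "\<And>a x. norm x \<le> R \<Longrightarrow> \<bar>partial a \<psi> x\<bar> \<le> q x"
    and W: "\<And>x. norm x \<le> R \<Longrightarrow> fact k * (d x * (q x * r x ^ (k - 1))) \<le> W x"
    and iW: "integrable lborel (\<lambda>x. indicator (cball 0 R) x * W x)"
  shows "\<bar>(\<integral>x. \<psi> x * jac k \<beta> f x \<partial>lborel) - (\<integral>x. \<psi> x * jac k \<beta> g x \<partial>lborel)\<bar>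
    \<le> real k * (\<integral>x. indicator (cball 0 R) x * W x \<partial>lborel)"
proof -
  let ?m = "\<lambda>l j. if j < l then g j else f j"
  let ?T = "\<lambda>l x. (f l x - g l x) * jac k \<beta> ((?m l)(l := \<psi>)) x"
  have each: "\<bar>\<integral>x. ?T l x \<partial>lborel\<bar> \<le> (\<integral>x. indicator (cball 0 R) x * W x \<partial>lborel)" if l: "l < k" for l
  proof -
    have sm: "smooth_on UNIV (((?m l)(l := \<psi>)) j)" for j using f g \<psi> by auto
    have z: "zero_beyond R (jac k \<beta> ((?m l)(l := \<psi>)))" by (rule zero_beyond_jac_upd[OF \<psi>(2) l])
    have iT: "integrable lborel (?T l)"
    proof (rule integrable_continuous_bounded_support[of _ R])
      show "continuous_on UNIV (?T l)"
        by (intro smooth_on_continuous smooth_on_mult smooth_on_diff f g smooth_jac sm)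
      show "zero_beyond R (?T l)" using z by (auto simp: zero_beyond_def)
    qed
    have "norm (\<integral>x. ?T l x \<partial>lborel) \<le> (\<integral>x. indicator (cball 0 R) x * W x \<partial>lborel)"
    proof (rule Bochner_Integration.integral_norm_bound_integral[OF iT iW])
      fix x
      show "norm (?T l x) \<le> indicator (cball 0 R) x * W x"
      proof (cases "norm x \<le> R")
        case True
        have r0: "r x \<ge> 0" using r(1)[OF True] by (meson abs_ge_zero order_trans)
        have d0: "d x \<ge> 0" using d[OF True] by (meson abs_ge_zero order_trans)
        have "\<bar>jac k \<beta> ((?m l)(l := \<psi>)) x\<bar> \<le> fact k * (\<Prod>j<k. if j = l then q x else r x)"
          unfolding jac_def by (rule minor_bound) (use r q True in auto)
        also have "(\<Prod>j<k. if j = l then q x else r x) = q x * (\<Prod>j\<in>{..<k} - {l}. if j = l then q x else r x)"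
          using l by (subst prod.remove[of _ l]) auto
        also have "(\<Prod>j\<in>{..<k} - {l}. if j = l then q x else r x) = (\<Prod>j\<in>{..<k} - {l}. r x)"
          by (rule prod.cong) auto
        also have "\<dots> = r x ^ (k - 1)" using l by simp
        finally have "\<bar>jac k \<beta> ((?m l)(l := \<psi>)) x\<bar> \<le> fact k * (q x * r x ^ (k - 1))" .
        then have "\<bar>?T l x\<bar> \<le> d x * (fact k * (q x * r x ^ (k - 1)))"
          unfolding abs_mult by (rule mult_mono[OF d[OF True]]) (use d0 in auto)
        also have "\<dots> \<le> W x" using W[OF True] by (simp add: mult.left_commute)
        finally show ?thesis using True by simp
      next
        case False
        then show ?thesis using zero_beyondD[OF z, of x] by simp
      qed
    qed
    then show ?thesis by simp
  qed
  have "\<bar>\<Sum>l<k. \<integral>x. ?T l x \<partial>lborel\<bar> \<le> (\<Sum>l<k. \<bar>\<integral>x. ?T l x \<partial>lborel\<bar>)" by (rule sum_abs)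
  also have "\<dots> \<le> (\<Sum>l<k. \<integral>x. indicator (cball 0 R) x * W x \<partial>lborel)"
    by (rule sum_mono) (simp add: each)
  finally show ?thesis
    unfolding integral_jac_difference[OF f g \<psi>] by simp
qed

section \<open>Minors against varying test functions: the fractional case\<close>

lemma smoothen_close:
  fixes v :: "real^'n \<Rightarrow> real^'m"
  assumes v: "integrable lborel v" and t: "0 < t"
    and r: "\<And>z. norm z \<le> 1/2 \<Longrightarrow> norm (v (shift_ball t z x) - c) \<le> r"
  shows "norm (smoothen t v x - c) \<le> r"
proof -
  have i: "integrable moll (\<lambda>z. v (shift_ball t z x))" by (rule smoothen_eq_average(2)[OF t v])
  have "smoothen t v x - c = (\<integral>z. v (shift_ball t z x) - c \<partial>moll)"
    using i by (simp add: smoothen_eq_average(1)[OF t v] moll.prob_space[unfolded space_moll])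
  also have "norm \<dots> \<le> (\<integral>z. norm (v (shift_ball t z x) - c) \<partial>moll)" by (rule integral_norm_bound)
  also have "\<dots> \<le> (\<integral>z. r \<partial>(moll :: (real^'n) measure))"
    by (rule integral_mono_AE) (use i AE_moll r in \<open>auto elim!: eventually_mono\<close>)
  also have "\<dots> = r" by (simp add: moll.prob_space[unfolded space_moll])
  finally show ?thesis .
qed

lemma norm_shift_ball_le:
  assumes "0 < t" "t \<le> 1/8" "norm x \<le> 1/2" "norm z \<le> 1/2"
  shows "norm (shift_ball t z x) \<le> 3/4" "norm (shift_ball t z x - x) \<le> t"
proof -
  have "shift_ball t z x - x = t *\<^sub>R (z - x)" by (simp add: slide_def algebra_simps)
  then have "norm (shift_ball t z x - x) = t * norm (z - x)" using assms(1) by simp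
  also have "norm (z - x) \<le> 1" using norm_triangle_ineq4[of z x] assms by simp
  finally show *: "norm (shift_ball t z x - x) \<le> t" using assms(1) by simp
  show "norm (shift_ball t z x) \<le> 3/4"
    using norm_triangle_ineq[of "shift_ball t z x - x" x] * assms by simp
qed

lemma smoothen_bounded:
  fixes v :: "real^'n \<Rightarrow> real^'m"
  assumes "integrable lborel v" "\<And>x. norm x \<le> 3/4 \<Longrightarrow> norm (v x) \<le> M" "0 < t" "t \<le> 1/8" "norm x \<le> 1/2"
  shows "norm (smoothen t v x) \<le> M"
  using smoothen_close[OF assms(1,3), of x 0 M] norm_shift_ball_le(1)[OF assms(3-5)] assms(2) by simp

lemma smoothen_uniform_limit:
  fixes u :: "real^'n \<Rightarrow> real^'m"
  assumes u: "continuous_on (ball 0 1) u" "integrable lborel (zero_extension u)" and "0 < e"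
  obtains t0 where "0 < t0" "t0 \<le> 1/8"
    "\<And>t x. 0 < t \<Longrightarrow> t < t0 \<Longrightarrow> norm x \<le> 1/2 \<Longrightarrow> norm (smoothen t (zero_extension u) x - u x) \<le> e"
proof -
  have "uniformly_continuous_on (cball 0 (3/4)) u"
    by (intro compact_uniformly_continuous continuous_on_subset[OF u(1)]) auto
  then obtain d where d: "d > 0"
    "\<And>x y. x \<in> cball 0 (3/4) \<Longrightarrow> y \<in> cball 0 (3/4) \<Longrightarrow> dist y x < d \<Longrightarrow> dist (u y) (u x) < e"
    using \<open>0 < e\<close> unfolding uniformly_continuous_on_def by meson
  show ?thesis
  proof (rule that[of "min d (1/8)"])
    fix t and x :: "real^'n" assume t: "0 < t" "t < min d (1/8)" and x: "norm x \<le> 1/2"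
    show "norm (smoothen t (zero_extension u) x - u x) \<le> e"
    proof (rule smoothen_close[OF u(2) t(1)])
      fix z :: "real^'n" assume z: "norm z \<le> 1/2"
      have n: "norm (shift_ball t z x) \<le> 3/4" "norm (shift_ball t z x - x) \<le> t"
        using norm_shift_ball_le[OF t(1) _ x z] t by auto
      have "dist (u (shift_ball t z x)) (u x) < e"
        by (rule d(2)) (use n x t in \<open>auto simp: dist_norm\<close>)
      then show "norm (zero_extension u (shift_ball t z x) - u x) \<le> e"
        using n(1) by (simp add: zero_extension_def dist_norm)
    qed
  qed (use d in auto)
qed

lemma smooth_bounds_on_cball:
  fixes H :: "real^'n \<Rightarrow> real"
  assumes "smooth_on UNIV H"
  obtains C where "C > 0" "\<And>y. norm y \<le> M \<Longrightarrow> \<bar>H y\<bar> \<le> C" "\<And>y i. norm y \<le> M \<Longrightarrow> \<bar>partial i H y\<bar> \<le> C"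
proof -
  have b: "\<exists>C>0. \<forall>y. norm y \<le> M \<longrightarrow> \<bar>h y\<bar> \<le> C" if "smooth_on UNIV h" for h :: "real^'n \<Rightarrow> real"
  proof -
    have "bounded (h ` cball 0 M)"
      by (intro compact_imp_bounded compact_continuous_image smooth_on_continuous that) auto
    then show ?thesis by (auto simp: bounded_pos)
  qed
  obtain C1 where C1: "C1 > 0" "\<forall>y. norm y \<le> M \<longrightarrow> \<bar>H y\<bar> \<le> C1" using b[OF assms] by blast
  have "\<forall>i. \<exists>C>0. \<forall>y. norm y \<le> M \<longrightarrow> \<bar>partial i H y\<bar> \<le> C" using b[OF smooth_on_partial[OF assms]] by blast
  then obtain C where C: "\<And>i. C i > 0" "\<And>i y. norm y \<le> M \<Longrightarrow> \<bar>partial i H y\<bar> \<le> C i" by metis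
  have le: "C i \<le> (\<Sum>i\<in>UNIV. C i)" for i using C(1) by (intro member_le_sum) (auto intro: less_imp_le)
  have S: "0 \<le> (\<Sum>i\<in>UNIV. C i)" using C(1) by (intro sum_nonneg) (auto intro: less_imp_le)
  show ?thesis
  proof (rule that[of "C1 + (\<Sum>i\<in>UNIV. C i)"])
    show "0 < C1 + (\<Sum>i\<in>UNIV. C i)" using C1(1) S by linarith
    show "\<bar>H y\<bar> \<le> C1 + (\<Sum>i\<in>UNIV. C i)" if "norm y \<le> M" for y using C1(2) that S by fastforce
    show "\<bar>partial i H y\<bar> \<le> C1 + (\<Sum>i\<in>UNIV. C i)" if "norm y \<le> M" for y i
      using C(2)[OF that, of i] le[of i] C1(1) by linarith
  qed
qed

text \<open>The scales of mollification are \<open>(k + 1)\<close>-st powers of these numbers, so that the roots in the oscillation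
  bounds are powers of \<open>1/2\<close>. The shift by \<open>3\<close> keeps every scale below \<open>1/8\<close>, where the bounds hold.\<close>

definition base_scale :: "nat \<Rightarrow> real"
  where "base_scale l = (1/2) ^ (l + 3)"

definition scale :: "nat \<Rightarrow> nat \<Rightarrow> real"
  where "scale k l = base_scale l ^ Suc k"

lemma base_scale: "0 < base_scale l" "base_scale l \<le> 1/8" "base_scale (Suc l) = base_scale l / 2"
proof -
  have "(1/2 :: real) ^ (l + 3) \<le> (1/2) ^ 3" by (rule power_decreasing) auto
  then show "base_scale l \<le> 1/8" by (simp add: base_scale_def power3_eq_cube)
  have "(1/2 :: real) ^ (Suc l + 3) = (1/2) * (1/2) ^ (l + 3)" by (simp only: add_Suc power_Suc)
  then show "base_scale (Suc l) = base_scale l / 2" unfolding base_scale_def by simp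
qed (simp add: base_scale_def)

lemma base_scale_tendsto: "base_scale \<longlonglongrightarrow> 0"
proof -
  have "(\<lambda>l. (1/2::real) ^ l * (1/2) ^ 3) \<longlonglongrightarrow> 0 * (1/2) ^ 3"
    by (intro tendsto_intros LIMSEQ_power_zero) auto
  then show ?thesis unfolding base_scale_def[abs_def] by (simp add: power_add)
qed

lemma scale: "0 < scale k l" "scale k l \<le> 1/8" "scale k \<longlonglongrightarrow> 0"
proof -
  show "0 < scale k l" using base_scale by (simp add: scale_def)
  have b: "scale k l \<le> base_scale l" for l
  proof -
    have "base_scale l ^ Suc k \<le> base_scale l ^ 1"
      using base_scale[of l] by (intro power_decreasing) auto
    then show ?thesis by (simp add: scale_def)
  qed
  show "scale k l \<le> 1/8" using b[of l] base_scale(2)[of l] by linarith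
  show "scale k \<longlonglongrightarrow> 0"
    by (rule tendsto_sandwich[OF _ _ tendsto_const base_scale_tendsto])
      (use b in \<open>auto simp: scale_def less_imp_le base_scale(1)\<close>)
qed

lemma power_mult_le_sum:
  fixes a b :: real
  assumes "0 \<le> a" "0 \<le> b"
  shows "a ^ k * b \<le> a ^ Suc k + b ^ Suc k"
proof (cases "a \<le> b")
  case True
  then have "a ^ k * b \<le> b ^ k * b" using assms by (intro mult_right_mono power_mono) auto
  then show ?thesis using assms by (simp add: mult.commute) (smt (verit) mult_nonneg_nonneg zero_le_power)
next
  case False
  then have "a ^ k * b \<le> a ^ k * a" using assms by (intro mult_left_mono) auto
  then show ?thesis using assms by (simp add: mult.commute) (smt (verit) mult_nonneg_nonneg zero_le_power)
qed

lemma power_add_le_power_sum: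
  fixes a b :: real
  assumes "0 \<le> a" "0 \<le> b"
  shows "(a + b) ^ q \<le> 2 ^ q * (a ^ q + b ^ q)"
proof -
  have "(a + b) ^ q \<le> (2 * max a b) ^ q" using assms by (intro power_mono) auto
  also have "\<dots> = 2 ^ q * max a b ^ q" by (simp add: power_mult_distrib)
  also have "max a b ^ q \<le> a ^ q + b ^ q" using assms by (auto simp: max_def)
  finally show ?thesis by simp
qed

text \<open>The pointwise bound behind one step of the telescoping argument, where \<open>x1\<close> and \<open>x2\<close> are roots of the energies at
  two consecutive fine scales and \<open>a\<close> is the one at the coarse scale. Young's inequality \<open>b\<^sup>k c \<le> b\<^bsup>k + 1\<^esup> + c\<^bsup>k + 1\<^esup>\<close>
  separates the factors, and the ratio \<open>\<tau> / \<sigma>\<close> that is left over makes the sum over \<open>\<tau>\<close> converge.\<close>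

lemma step_estimate:
  fixes x1 x2 a \<tau> \<sigma> :: real
  assumes nn: "0 \<le> x1" "0 \<le> x2" "0 \<le> a" and \<tau>: "0 < \<tau>" and \<sigma>: "0 < \<sigma>" "\<sigma> \<le> 1"
  shows "\<tau> * (x1 + x2) ^ k * (1 + a / \<sigma>) \<le> 2 ^ (k + 2) * (\<tau> + \<tau> / \<sigma> * (x1 ^ Suc k + x2 ^ Suc k + a ^ Suc k))"
proof -
  define A where "A = x1 + x2"
  define E where "E = x1 ^ Suc k + x2 ^ Suc k"
  have A0: "A \<ge> 0" and E0: "E \<ge> 0" and a0: "a ^ Suc k \<ge> 0"
    using nn by (auto simp: A_def E_def intro!: add_nonneg_nonneg)
  have AE: "A ^ Suc k \<le> 2 ^ Suc k * E" unfolding A_def E_def by (rule power_add_le_power_sum) (use nn in auto)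
  have 1: "A ^ k \<le> A ^ Suc k + 1" using power_mult_le_sum[OF A0, of 1 k] by simp
  have 2: "A ^ k * a \<le> A ^ Suc k + a ^ Suc k" by (rule power_mult_le_sum[OF A0 nn(3)])
  have ts: "\<tau> \<le> \<tau> / \<sigma>" using \<tau> \<sigma> by (simp add: field_simps)
  have "\<tau> * A ^ k * (1 + a / \<sigma>) = \<tau> * A ^ k + \<tau> / \<sigma> * (A ^ k * a)" by (simp add: algebra_simps)
  also have "\<dots> \<le> \<tau> * (A ^ Suc k + 1) + \<tau> / \<sigma> * (A ^ Suc k + a ^ Suc k)"
    using 1 2 \<tau> \<sigma> by (intro add_mono mult_left_mono) auto
  also have "\<dots> = \<tau> + (\<tau> * A ^ Suc k + \<tau> / \<sigma> * (A ^ Suc k + a ^ Suc k))" by (simp add: algebra_simps)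
  also have "\<dots> \<le> \<tau> + (\<tau> / \<sigma> * A ^ Suc k + \<tau> / \<sigma> * (A ^ Suc k + a ^ Suc k))"
    using ts A0 by (intro add_left_mono add_right_mono mult_right_mono) auto
  also have "\<dots> = \<tau> + \<tau> / \<sigma> * (2 * A ^ Suc k + a ^ Suc k)" by (simp add: algebra_simps)
  also have "\<dots> \<le> 2 ^ (k + 2) * \<tau> + \<tau> / \<sigma> * (2 ^ (k + 2) * (E + a ^ Suc k))"
  proof (intro add_mono mult_left_mono)
    have one: "(1::real) \<le> 2 ^ (k + 2)" by (rule one_le_power) simp
    show "\<tau> \<le> 2 ^ (k + 2) * \<tau>" using mult_right_mono[OF one, of \<tau>] \<tau> by simp
    have "a ^ Suc k \<le> 2 ^ (k + 2) * a ^ Suc k" using mult_right_mono[OF one a0] by simp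
    moreover have "2 * A ^ Suc k \<le> 2 ^ (k + 2) * E"
    proof -
      have "2 * (2 ^ Suc k * E) = 2 ^ (k + 2) * E" by simp
      then show ?thesis using AE by linarith
    qed
    ultimately show "2 * A ^ Suc k + a ^ Suc k \<le> 2 ^ (k + 2) * (E + a ^ Suc k)" by (simp only: distrib_left)
  qed (use \<tau> \<sigma> in auto)
  finally show ?thesis by (simp add: A_def E_def algebra_simps)
qed

lemma geometric_telescope:
  fixes b :: "nat \<Rightarrow> real"
  assumes step: "\<And>l. m \<le> l \<Longrightarrow> \<bar>b (Suc l) - b l\<bar> \<le> K * base_scale l" and "m \<le> j"
  shows "\<bar>b j - b m\<bar> \<le> 2 * K * (base_scale m - base_scale j)"
  using \<open>m \<le> j\<close>
proof (induction j rule: dec_induct)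
  case (step j)
  then show ?case using assms(1)[of j] base_scale(3)[of j] by (simp add: algebra_simps)
qed simp

text \<open>Here \<open>m\<close> is the scale of the weight and \<open>j \<ge> m\<close> that of the minor. Between the scales \<open>l\<close> and \<open>l + 1\<close> the exchange of functions
  leaves products of one increment of \<open>F\<close>, of order \<open>\<tau>\<^sub>l\<^sup>k A\<close>, with \<open>k - 1\<close> gradients of order \<open>A / \<tau>\<^sub>l\<close> and with one gradient of the
  weight, of order \<open>1 + A / \<tau>\<^sub>m\<close>, where \<open>A\<^bsup>k + 1\<^esup>\<close> is the energy at the respective scale. The integrals of these
  products add up to a multiple of \<open>\<tau>\<^sub>m\<close> plus the largest energy integral beyond \<open>m\<close>.\<close>

lemma minors_cauchy_fractional:
  fixes u :: "real^'n \<Rightarrow> real^'m" and i :: "nat \<Rightarrow> 'm" and \<beta> :: "nat \<Rightarrow> 'n"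
  assumes u: "continuous_on (ball 0 1) u" "integrable lborel (zero_extension u)"
    and fin: "gagliardo_seminorm s p (ball 0 1) u < \<infinity>"
    and sp: "s * p = real k" "0 < p" "p \<le> real k + 1" and k: "1 \<le> k"
    and \<phi>: "smooth_on UNIV \<phi>" "zero_beyond (1/2) \<phi>" and H: "smooth_on UNIV H" and "0 < e"
  defines "F \<equiv> \<lambda>l. smoothen (scale k l) (zero_extension u)"
  defines "b \<equiv> \<lambda>m j. \<integral>x. (\<phi> x * H (F m x)) * jac k \<beta> (\<lambda>q x. F j x $ i q) x \<partial>lborel"
  shows "\<exists>m0. \<forall>m\<ge>m0. \<forall>j\<ge>m. \<bar>b m j - b m m\<bar> \<le> e"
proof -
  let ?u = "zero_extension u"
  let ?\<tau> = base_scale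
  define J where "J l x = osc_energy k ?u (scale k l) x" for l x
  let ?K = "cball 0 (1/2) :: (real^'n) set"
  obtain M where M: "M > 0" "\<And>x. norm x \<le> 3/4 \<Longrightarrow> norm (?u x) \<le> M"
    by (rule local_bound_zero_extension[OF u(1)]) (rule that)
  obtain C where C: "C > 0"
    "\<forall>(v :: real^'n \<Rightarrow> real^'m) M x t \<tau> i a. integrable lborel v \<longrightarrow> (\<forall>x. norm x \<le> 3/4 \<longrightarrow> norm (v x) \<le> M) \<longrightarrow>
      norm x \<le> 1/2 \<longrightarrow> 0 < \<tau> \<longrightarrow> t = \<tau> ^ Suc k \<longrightarrow> t \<le> 1/8 \<longrightarrow>
      \<bar>smoothen t v x $ i - v x $ i\<bar> \<le> C * (\<tau> ^ k * root (Suc k) (osc_energy k v t x)) \<and>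
      \<bar>partial a (\<lambda>x. smoothen t v x $ i) x\<bar> \<le> C * (root (Suc k) (osc_energy k v t x) / \<tau>)"
    by (rule smoothen_oscillation_bounds[of k]) (rule that)
  define A where "A l x = root (Suc k) (J l x)" for l x
  have J0: "J l x \<ge> 0" for l x unfolding J_def by (rule osc_energy_nonneg[OF scale(1)])
  have A0: "A l x \<ge> 0" for l x using J0[of l x] by (simp add: A_def)
  have AJ: "A l x ^ Suc k = J l x" for l x unfolding A_def by (rule real_root_pow_pos2) (use J0 in auto)
  have FA: "\<bar>F l x $ q - ?u x $ q\<bar> \<le> C * (?\<tau> l ^ k * A l x)" "\<bar>partial a (\<lambda>x. F l x $ q) x\<bar> \<le> C * (A l x / ?\<tau> l)"
    if "norm x \<le> 1/2" for l x q a
    using C(2)[rule_format, OF u(2) M(2) that base_scale(1)[of l], of "scale k l" q a] scale(2)[of k l]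
    unfolding F_def A_def J_def by (simp_all add: scale_def)
  have Fs: "smooth_on UNIV (\<lambda>x. F l x $ q)" for l q
    unfolding F_def by (rule smooth_smoothen_component[OF scale(1) u(2)])
  have FM: "norm (F l x) \<le> M" if "norm x \<le> 1/2" for l x
    unfolding F_def by (rule smoothen_bounded[OF u(2) M(2) scale(1,2) that])
  obtain C\<phi> where C\<phi>: "C\<phi> > 0" "\<And>y. norm y \<le> 1/2 \<Longrightarrow> \<bar>\<phi> y\<bar> \<le> C\<phi>" "\<And>y i. norm y \<le> 1/2 \<Longrightarrow> \<bar>partial i \<phi> y\<bar> \<le> C\<phi>"
    by (rule smooth_bounds_on_cball[OF \<phi>(1), of "1/2"]) (rule that)
  obtain CH where CH: "CH > 0" "\<And>y. norm y \<le> M \<Longrightarrow> \<bar>H y\<bar> \<le> CH" "\<And>y i. norm y \<le> M \<Longrightarrow> \<bar>partial i H y\<bar> \<le> CH"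
    by (rule smooth_bounds_on_cball[OF H, of M]) (rule that)
  define N where "N = real CARD('m)"
  define C3 where "C3 = C\<phi> * CH * (1 + N * C)"
  have C3: "C3 > 0" using C\<phi> CH C by (auto simp: C3_def N_def intro!: mult_pos_pos add_pos_nonneg)
  have HFs: "smooth_on UNIV (\<lambda>x. H (F m x))" for m by (rule smooth_on_compose[OF H Fs])
  have \<psi>s: "smooth_on UNIV (\<lambda>x. \<phi> x * H (F m x))" for m by (intro smooth_on_mult \<phi> HFs)
  have \<psi>z: "zero_beyond (1/2) (\<lambda>x. \<phi> x * H (F m x))" for m using \<phi>(2) by (simp add: zero_beyond_def)
  have \<psi>b: "\<bar>partial a (\<lambda>x. \<phi> x * H (F m x)) x\<bar> \<le> C3 * (1 + A m x / ?\<tau> m)" if x: "norm x \<le> 1/2" for a m x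
  proof -
    have "partial a (\<lambda>x. H (F m x)) x = (\<Sum>q\<in>UNIV. partial q H (F m x) * partial a (\<lambda>x. F m x $ q) x)"
      by (rule partial_compose(2)) (intro smooth_on_differentiable H Fs)+
    also have "\<bar>\<dots>\<bar> \<le> (\<Sum>q\<in>(UNIV::'m set). CH * (C * (A m x / ?\<tau> m)))"
    proof (rule order_trans[OF sum_abs], rule sum_mono)
      fix q
      show "\<bar>partial q H (F m x) * partial a (\<lambda>x. F m x $ q) x\<bar> \<le> CH * (C * (A m x / ?\<tau> m))"
        unfolding abs_mult by (rule mult_mono[OF CH(3)[OF FM[OF x]] FA(2)[OF x]]) (use CH(1) in auto)
    qed
    also have "\<dots> = N * (CH * (C * (A m x / ?\<tau> m)))" by (simp add: N_def)
    finally have h: "\<bar>partial a (\<lambda>x. H (F m x)) x\<bar> \<le> N * (CH * (C * (A m x / ?\<tau> m)))" .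
    have At: "0 \<le> A m x / ?\<tau> m" using A0 base_scale(1)[of m] by (simp add: less_imp_le)
    have "partial a (\<lambda>x. \<phi> x * H (F m x)) x = \<phi> x * partial a (\<lambda>x. H (F m x)) x + partial a \<phi> x * H (F m x)"
      by (rule partial_mult) (intro smooth_on_differentiable \<phi> HFs)+
    also have "\<bar>\<dots>\<bar> \<le> C\<phi> * (N * (CH * (C * (A m x / ?\<tau> m)))) + C\<phi> * CH"
    proof (rule order_trans[OF abs_triangle_ineq])
      show "\<bar>\<phi> x * partial a (\<lambda>x. H (F m x)) x\<bar> + \<bar>partial a \<phi> x * H (F m x)\<bar> \<le> C\<phi> * (N * (CH * (C * (A m x / ?\<tau> m)))) + C\<phi> * CH"
        unfolding abs_mult using h C\<phi> CH FM[OF x] x by (intro add_mono mult_mono) auto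
    qed
    also have "\<dots> = C\<phi> * CH * (1 + N * C * (A m x / ?\<tau> m))" by (simp add: algebra_simps)
    also have "\<dots> \<le> C\<phi> * CH * ((1 + N * C) * (1 + A m x / ?\<tau> m))"
    proof (rule mult_left_mono)
      have "1 + P * Y \<le> (1 + P) * (1 + Y)" if "0 \<le> P" "0 \<le> Y" for P Y :: real
        using that by (simp add: algebra_simps)
      moreover have "0 \<le> N * C" using C(1) by (simp add: N_def)
      ultimately show "1 + N * C * (A m x / ?\<tau> m) \<le> (1 + N * C) * (1 + A m x / ?\<tau> m)"
        using At by blast
    qed (use C\<phi> CH in auto)
    finally show ?thesis by (simp add: C3_def mult.assoc)
  qed
  define S where "S l = (\<integral>x. indicator ?K x * J l x \<partial>lborel)" for l
  note E = osc_energy_tendsto_0[OF u(1) fin sp, of "scale k", OF scale, folded J_def]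
  define V where "V = measure lborel ?K"
  have V0: "V \<ge> 0" by (simp add: V_def)
  have iK: "integrable lborel (indicator ?K :: real^'n \<Rightarrow> real)"
    using emeasure_bounded_finite[OF bounded_cball, of "0::real^'n" "1/2"] by (intro integrable_real_indicator) auto
  define C4 where "C4 = fact k * (C ^ k * 2 ^ (k - 1) * C3) * 2 ^ (k + 2)"
  have C4: "C4 > 0" using C C3 by (simp add: C4_def)
  have step: "\<bar>b m (Suc l) - b m l\<bar> \<le> real k * (C4 * (?\<tau> l * V + ?\<tau> l / ?\<tau> m * (S l + S (Suc l) + S m)))"
    if i: "integrable lborel (\<lambda>x. indicator ?K x * J l x)" "integrable lborel (\<lambda>x. indicator ?K x * J (Suc l) x)"
      "integrable lborel (\<lambda>x. indicator ?K x * J m x)" for m l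
  proof -
    let ?W = "\<lambda>x. C4 * (?\<tau> l + ?\<tau> l / ?\<tau> m * (J l x + J (Suc l) x + J m x))"
    have t0: "?\<tau> l > 0" "?\<tau> m > 0" "?\<tau> m \<le> 1" using base_scale[of l] base_scale[of m] by auto
    have eW: "indicator ?K x * ?W x = C4 * (?\<tau> l * indicator ?K x + ?\<tau> l / ?\<tau> m * (indicator ?K x * J l x + indicator ?K x * J (Suc l) x + indicator ?K x * J m x))" for x
      by (simp add: algebra_simps)
    have iW: "integrable lborel (\<lambda>x. indicator ?K x * ?W x)"
      unfolding eW using i iK by (intro integrable_mult_right Bochner_Integration.integrable_add)
    have "\<bar>b m (Suc l) - b m l\<bar> \<le> real k * (\<integral>x. indicator ?K x * ?W x \<partial>lborel)"
      unfolding b_def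
    proof (rule integral_jac_difference_bound[OF Fs Fs \<psi>s \<psi>z _ _ _ \<psi>b _ iW])
      let ?A = "\<lambda>x. A l x + A (Suc l) x"
      fix x :: "real^'n" assume x: "norm x \<le> 1/2"
      have s: "?\<tau> (Suc l) ^ k \<le> ?\<tau> l ^ k" using base_scale[of l] base_scale[of "Suc l"] by (intro power_mono) auto
      show "\<bar>F (Suc l) x $ i q - F l x $ i q\<bar> \<le> C * (?\<tau> l ^ k * ?A x)" for q
      proof -
        have "\<bar>F (Suc l) x $ i q - F l x $ i q\<bar> \<le> C * (?\<tau> (Suc l) ^ k * A (Suc l) x) + C * (?\<tau> l ^ k * A l x)"
          using FA(1)[OF x, of "Suc l" "i q"] FA(1)[OF x, of l "i q"] by linarith
        also have "\<dots> \<le> C * (?\<tau> l ^ k * A (Suc l) x) + C * (?\<tau> l ^ k * A l x)"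
          using s A0 C(1) by (intro add_right_mono mult_left_mono mult_right_mono) auto
        finally show ?thesis by (simp add: algebra_simps)
      qed
      have r: "C * (A l x / ?\<tau> l) \<le> 2 * C * ?A x / ?\<tau> l" "C * (A (Suc l) x / ?\<tau> (Suc l)) \<le> 2 * C * ?A x / ?\<tau> l"
      proof -
        have "C * A l x \<le> 2 * C * ?A x" "2 * C * A (Suc l) x \<le> 2 * C * ?A x"
          using C(1) A0[of l x] A0[of "Suc l" x] by (auto simp: algebra_simps)
        then show "C * (A l x / ?\<tau> l) \<le> 2 * C * ?A x / ?\<tau> l" "C * (A (Suc l) x / ?\<tau> (Suc l)) \<le> 2 * C * ?A x / ?\<tau> l"
          using t0 by (auto simp: base_scale(3) divide_right_mono algebra_simps)
      qed
      show "\<bar>partial a (\<lambda>x. F (Suc l) x $ i q) x\<bar> \<le> 2 * C * ?A x / ?\<tau> l" for a q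
        using FA(2)[OF x] r(2) order_trans by blast
      show "\<bar>partial a (\<lambda>x. F l x $ i q) x\<bar> \<le> 2 * C * ?A x / ?\<tau> l" for a q
        using FA(2)[OF x] r(1) order_trans by blast
      show "fact k * (C * (?\<tau> l ^ k * ?A x) * (C3 * (1 + A m x / ?\<tau> m) * (2 * C * ?A x / ?\<tau> l) ^ (k - 1))) \<le> ?W x"
      proof -
        obtain k' where k': "k = Suc k'" using k by (cases k) auto
        have "C * (\<tau> ^ k * B) * (C3 * Y * (2 * C * B / \<tau>) ^ (k - 1)) = (C ^ k * 2 ^ (k - 1) * C3) * (\<tau> * B ^ k * Y)"
          if "\<tau> > 0" for \<tau> B Y
          using that unfolding k' by (simp add: power_mult_distrib power_divide)
        from this[OF t0(1), of "?A x" "1 + A m x / ?\<tau> m"]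
        have "fact k * (C * (?\<tau> l ^ k * ?A x) * (C3 * (1 + A m x / ?\<tau> m) * (2 * C * ?A x / ?\<tau> l) ^ (k - 1)))
            = fact k * ((C ^ k * 2 ^ (k - 1) * C3) * (?\<tau> l * ?A x ^ k * (1 + A m x / ?\<tau> m)))" by (simp only:)
        also have "\<dots> \<le> fact k * ((C ^ k * 2 ^ (k - 1) * C3) * (2 ^ (k + 2) * (?\<tau> l + ?\<tau> l / ?\<tau> m * (J l x + J (Suc l) x + J m x))))"
          using step_estimate[of "A l x" "A (Suc l) x" "A m x" "?\<tau> l" "?\<tau> m" k, OF A0 A0 A0 t0] C C3 unfolding AJ
          by (intro mult_left_mono) auto
        also have "\<dots> = ?W x" by (simp only: C4_def mult.assoc)
        finally show ?thesis .
      qed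
    qed
    also have "(\<integral>x. indicator ?K x * ?W x \<partial>lborel) = C4 * (?\<tau> l * V + ?\<tau> l / ?\<tau> m * (S l + S (Suc l) + S m))"
      unfolding eW S_def V_def using i iK by simp
    finally show ?thesis .
  qed
  define e' where "e' = e / (4 * (real k * C4 * (V + 3) + 1))"
  have kC: "real k * C4 * (V + 3) \<ge> 0" using C4 V0 by simp
  have e': "e' > 0" using \<open>0 < e\<close> kC by (simp add: e'_def)
  obtain m0 where m0: "\<And>l. l \<ge> m0 \<Longrightarrow> integrable lborel (\<lambda>x. indicator ?K x * J l x)"
    "\<And>l. l \<ge> m0 \<Longrightarrow> S l < e'" "\<And>l. l \<ge> m0 \<Longrightarrow> ?\<tau> l < e'"
  proof -
    have "\<forall>\<^sub>F l in sequentially. S l < e'" unfolding S_def using order_tendstoD(2)[OF E(2) e'] .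
    moreover have "\<forall>\<^sub>F l in sequentially. ?\<tau> l < e'" using order_tendstoD(2)[OF base_scale_tendsto e'] .
    ultimately have "\<forall>\<^sub>F l in sequentially. integrable lborel (\<lambda>x. indicator ?K x * J l x) \<and> S l < e' \<and> ?\<tau> l < e'"
      using E(1) by eventually_elim simp
    then show ?thesis using that unfolding eventually_sequentially by blast
  qed
  show ?thesis
  proof (intro exI[of _ m0] allI impI)
    fix m j assume m: "m0 \<le> m" and j: "m \<le> j"
    have t0: "?\<tau> m > 0" by (rule base_scale(1))
    define Kc where "Kc = real k * (C4 * (V + 3 * e' / ?\<tau> m))"
    have Kc0: "Kc \<ge> 0" using C4 V0 e' t0 by (simp add: Kc_def)
    have "\<bar>b m j - b m m\<bar> \<le> 2 * Kc * (?\<tau> m - ?\<tau> j)"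
    proof (rule geometric_telescope[OF _ j])
      fix l assume l: "m \<le> l"
      have "\<bar>b m (Suc l) - b m l\<bar> \<le> real k * (C4 * (?\<tau> l * V + ?\<tau> l / ?\<tau> m * (S l + S (Suc l) + S m)))"
        by (rule step) (use m0(1) m l in auto)
      also have "\<dots> \<le> real k * (C4 * (?\<tau> l * V + ?\<tau> l / ?\<tau> m * (3 * e')))"
        using m0(2)[of l] m0(2)[of "Suc l"] m0(2)[of m] m l C4 base_scale(1)[of l] t0
        by (intro mult_left_mono add_left_mono) auto
      also have "\<dots> = Kc * ?\<tau> l" by (simp add: Kc_def algebra_simps)
      finally show "\<bar>b m (Suc l) - b m l\<bar> \<le> Kc * ?\<tau> l" .
    qed
    also have "\<dots> \<le> 2 * Kc * ?\<tau> m"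
      using Kc0 base_scale(1)[of j] by (intro mult_left_mono) auto
    also have "\<dots> = 2 * (real k * C4 * (V * ?\<tau> m + 3 * e'))" using t0 by (simp add: Kc_def field_simps)
    also have "\<dots> \<le> 2 * (real k * C4 * (V * e' + 3 * e'))"
      using m0(3)[OF m] V0 C4 by (intro mult_left_mono add_right_mono) auto
    also have "\<dots> = 2 * (real k * C4 * (V + 3)) * e'" by (simp add: algebra_simps)
    also have "\<dots> \<le> (4 * (real k * C4 * (V + 3) + 1)) * e'"
    proof (rule mult_right_mono)
      have "2 * Z \<le> 4 * (Z + 1)" if "0 \<le> Z" for Z :: real using that by simp
      from this[OF kC] show "2 * (real k * C4 * (V + 3)) \<le> 4 * (real k * C4 * (V + 3) + 1)" .
    qed (use e' in simp)
    also have "\<dots> = e"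
    proof -
      have "(4 * (Z + 1)) * (e / (4 * (Z + 1))) = e" if "0 \<le> Z" for Z :: real using that by simp
      from this[OF kC] show ?thesis unfolding e'_def .
    qed
    finally show "\<bar>b m j - b m m\<bar> \<le> e" .
  qed
qed

section \<open>Minors against varying test functions: the first-order case\<close>

lemma young_power:
  fixes x y \<theta> :: real
  assumes "0 \<le> x" "0 \<le> y" "0 < \<theta>"
  shows "x * y ^ k \<le> \<theta> * y ^ Suc k + x ^ Suc k / \<theta> ^ k"
proof (cases "x \<le> \<theta> * y")
  case True
  then have "x * y ^ k \<le> (\<theta> * y) * y ^ k" using assms by (intro mult_right_mono) auto
  moreover have "0 \<le> x ^ Suc k / \<theta> ^ k" using assms by simp
  ultimately show ?thesis by (simp add: mult.assoc)
next
  case False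
  then have "y \<le> x / \<theta>" using assms by (simp add: field_simps)
  then have "x * y ^ k \<le> x * (x / \<theta>) ^ k" using assms by (intro mult_left_mono power_mono) auto
  moreover have "0 \<le> \<theta> * y ^ Suc k" using assms by simp
  ultimately show ?thesis by (simp add: power_divide)
qed

lemma minor_difference_bound:
  fixes A B :: "nat \<Rightarrow> nat \<Rightarrow> real"
  assumes "\<And>j a. \<bar>A j a\<bar> \<le> r" "\<And>j a. \<bar>B j a\<bar> \<le> r" "\<And>j a. \<bar>A j a - B j a\<bar> \<le> d"
  shows "\<bar>minor k A - minor k B\<bar> \<le> real k * (fact k * (d * r ^ (k - 1)))"
proof -
  let ?M = "\<lambda>l. (\<lambda>j. if j < l then B j else A j)(l := (\<lambda>a. A l a - B l a))"
  have "\<bar>minor k (?M l)\<bar> \<le> fact k * (d * r ^ (k - 1))" if "l < k" for l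
  proof -
    have "\<bar>minor k (?M l)\<bar> \<le> fact k * (\<Prod>j<k. if j = l then d else r)"
      by (rule minor_bound) (use assms in auto)
    also have "(\<Prod>j<k. if j = l then d else r) = d * (\<Prod>j\<in>{..<k} - {l}. if j = l then d else r)"
      using that by (subst prod.remove[of _ l]) auto
    also have "(\<Prod>j\<in>{..<k} - {l}. if j = l then d else r) = (\<Prod>j\<in>{..<k} - {l}. r)"
      by (rule prod.cong) auto
    also have "\<dots> = r ^ (k - 1)" using that by simp
    finally show ?thesis .
  qed
  then have "(\<Sum>l<k. \<bar>minor k (?M l)\<bar>) \<le> (\<Sum>l<k. fact k * (d * r ^ (k - 1)))" by (intro sum_mono) auto
  moreover have "\<bar>minor k A - minor k B\<bar> \<le> (\<Sum>l<k. \<bar>minor k (?M l)\<bar>)"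
    unfolding minor_diff_telescope by (rule sum_abs)
  ultimately show ?thesis by simp
qed

lemma abs_grad_entry_le: "\<bar>(A :: real^'n^'m) $ j $ a\<bar> \<le> norm A"
  using component_le_norm_cart[of "A $ j" a] Finite_Cartesian_Product.norm_nth_le[of A j] by linarith

text \<open>The weights are bounded, so it is enough that the minors are a Cauchy sequence in \<open>L\<^sup>1\<close>. A difference of minors is a sum of products of one difference of
  gradients with \<open>k - 1\<close> gradients; Young's inequality with a small parameter \<open>\<theta>\<close> bounds it by \<open>\<theta>\<close> times the \<open>k\<close>-th power of
  the weak gradient plus a large multiple of the \<open>k\<close>-th powers of the approximation errors.\<close>

lemma minors_cauchy_W1:
  fixes u :: "real^'n \<Rightarrow> real^'m" and i :: "nat \<Rightarrow> 'm" and \<beta> :: "nat \<Rightarrow> 'n"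
  assumes u: "u \<in> sobolev_space 1 (real k) (ball 0 1)" "continuous_on (ball 0 1) u" and k: "2 \<le> k"
    and \<phi>: "smooth_on UNIV \<phi>" "zero_beyond (1/2) \<phi>" and H: "smooth_on UNIV H" and "0 < e"
  defines "F \<equiv> \<lambda>l. smoothen (scale k l) (zero_extension u)"
  defines "b \<equiv> \<lambda>m j. \<integral>x. (\<phi> x * H (F m x)) * jac k \<beta> (\<lambda>q x. F j x $ i q) x \<partial>lborel"
  shows "\<exists>m0. \<forall>m\<ge>m0. \<forall>j\<ge>m. \<bar>b m j - b m m\<bar> \<le> e"
proof -
  let ?u = "zero_extension u"
  let ?K = "cball 0 (1/2) :: (real^'n) set"
  let ?B = "ball 0 1 :: (real^'n) set"
  have p: "1 < real k" using k by simp
  have iu: "integrable lborel ?u"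
    by (rule integrable_zero_extension[OF u(2), of "real k"]) (use u(1) p in \<open>auto simp: sobolev_space_def\<close>)
  obtain M where M: "M > 0" "\<And>x. norm x \<le> 3/4 \<Longrightarrow> norm (?u x) \<le> M"
    by (rule local_bound_zero_extension[OF u(2)]) (rule that)
  have Fs: "smooth_on UNIV (\<lambda>x. F l x $ q)" for l q
    unfolding F_def by (rule smooth_smoothen_component[OF scale(1) iu])
  have FM: "norm (F l x) \<le> M" if "norm x \<le> 1/2" for l x
    unfolding F_def by (rule smoothen_bounded[OF iu M(2) scale(1,2) that])
  obtain C\<phi> where C\<phi>: "C\<phi> > 0" "\<And>y. norm y \<le> 1/2 \<Longrightarrow> \<bar>\<phi> y\<bar> \<le> C\<phi>"
    by (rule smooth_bounds_on_cball[OF \<phi>(1), of "1/2"]) (rule that)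
  obtain CH where CH: "CH > 0" "\<And>y. norm y \<le> M \<Longrightarrow> \<bar>H y\<bar> \<le> CH"
    by (rule smooth_bounds_on_cball[OF H, of M]) (rule that)
  have HFs: "smooth_on UNIV (\<lambda>x. H (F m x))" for m by (rule smooth_on_compose[OF H Fs])
  have \<psi>s: "smooth_on UNIV (\<lambda>x. \<phi> x * H (F m x))" for m by (intro smooth_on_mult \<phi> HFs)
  obtain G0 :: "real^'n \<Rightarrow> real^'n^'m" where G0: "G0 \<in> borel_measurable borel"
    "(\<integral>\<^sup>+x. indicator ?B x * ennreal (norm (G0 x) powr real k) \<partial>lborel) < \<infinity>"
    "((\<lambda>t. \<integral>\<^sup>+x. indicator ?B x * ennreal (norm (grad (smoothen t ?u) x - G0 x) powr real k) \<partial>lborel) \<longlongrightarrow> 0) (at_right 0)"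
    by (rule W1p_smooth_approximation[OF u p]) (rule that)
  have pw: "norm y powr real k = norm y ^ k" for y :: "real^'n^'m"
    using k by (intro powr_realpow') auto
  define d where "d l x = norm (grad (F l) x - G0 x)" for l x
  define g where "g x = norm (G0 x)" for x
  define D where "D l = (\<integral>\<^sup>+x. indicator ?B x * ennreal (d l x ^ k) \<partial>lborel)" for l
  define \<gamma> where "\<gamma> = enn2real (\<integral>\<^sup>+x. indicator ?B x * ennreal (g x ^ k) \<partial>lborel)"
  have \<gamma>: "(\<integral>\<^sup>+x. indicator ?B x * ennreal (g x ^ k) \<partial>lborel) = ennreal \<gamma>"
    using G0(2) unfolding \<gamma>_def g_def pw by (simp add: less_top)
  have \<gamma>0: "\<gamma> \<ge> 0" by (simp add: \<gamma>_def)
  have "filterlim (scale k) (at_right 0) sequentially"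
    by (rule tendsto_imp_filterlim_at_right[OF scale(3)]) (simp add: scale(1))
  from filterlim_compose[OF G0(3) this] have D: "D \<longlonglongrightarrow> 0"
    unfolding D_def[abs_def] d_def F_def pw .
  have gc: "continuous_on UNIV (grad (F l))" for l
    unfolding grad_def by (intro continuous_on_vec_lambda smooth_on_continuous smooth_on_partial Fs)
  have dm: "d l \<in> borel_measurable borel" for l
    unfolding d_def[abs_def] using G0(1) gc[of l, THEN borel_measurable_continuous_onI] by measurable
  have gm: "g \<in> borel_measurable borel" unfolding g_def[abs_def] using G0(1) by measurable
  have d0: "0 \<le> d l x" and g0: "0 \<le> g x" for l x by (auto simp: d_def g_def)
  obtain k' where k': "k = Suc k'" using k by (cases k) auto
  define C6 where "C6 = C\<phi> * CH * (real k * fact k)"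
  have C6: "C6 > 0" using C\<phi> CH k by (simp add: C6_def)
  \<comment> \<open>makes the contribution of the weak gradient at most half of \<open>e\<close>\<close>
  define \<theta> where "\<theta> = e / (2 * (C6 * 2 ^ k * \<gamma> + 1))"
  have C\<gamma>: "C6 * 2 ^ k * \<gamma> \<ge> 0" using C6 \<gamma>0 by simp
  have \<theta>: "\<theta> > 0" using \<open>0 < e\<close> C\<gamma> by (simp add: \<theta>_def)
  define \<Lambda> where "\<Lambda> = (2 ^ k * \<theta> + 1 / \<theta> ^ k') * 2 ^ k"
  have \<Lambda>: "\<Lambda> > 0" using \<theta> by (simp add: \<Lambda>_def add_pos_pos)
  have pt: "\<bar>(\<phi> x * H (F m x)) * (jac k \<beta> (\<lambda>q x. F j x $ i q) x - jac k \<beta> (\<lambda>q x. F m x $ i q) x)\<bar>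
      \<le> C6 * (2 ^ k * \<theta> * g x ^ k + \<Lambda> * (d j x ^ k + d m x ^ k))" if x: "norm x \<le> 1/2" for x m j
  proof -
    define E where "E = d j x + d m x"
    have E0: "E \<ge> 0" using d0 by (simp add: E_def)
    have ent: "partial a (\<lambda>x. F l x $ q) x = grad (F l) x $ q $ a" for l q a by (simp add: grad_def)
    have r: "\<bar>partial a (\<lambda>x. F l x $ q) x\<bar> \<le> E + g x" if "l = j \<or> l = m" for l q a
    proof -
      have "\<bar>partial a (\<lambda>x. F l x $ q) x\<bar> \<le> norm (grad (F l) x)" unfolding ent by (rule abs_grad_entry_le)
      also have "\<dots> \<le> d l x + g x" unfolding d_def g_def
        using norm_triangle_ineq[of "grad (F l) x - G0 x" "G0 x"] by simp
      also have "\<dots> \<le> E + g x" using that d0 by (auto simp: E_def)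
      finally show ?thesis .
    qed
    have dd: "\<bar>partial a (\<lambda>x. F j x $ q) x - partial a (\<lambda>x. F m x $ q) x\<bar> \<le> E" for q a
    proof -
      have "\<bar>partial a (\<lambda>x. F j x $ q) x - partial a (\<lambda>x. F m x $ q) x\<bar> \<le> norm (grad (F j) x - grad (F m) x)"
        unfolding ent using abs_grad_entry_le[of "grad (F j) x - grad (F m) x" q a] by simp
      also have "\<dots> \<le> E" unfolding E_def d_def
        using norm_triangle_ineq4[of "grad (F j) x - G0 x" "grad (F m) x - G0 x"] by simp
      finally show ?thesis .
    qed
    have J1: "\<bar>jac k \<beta> (\<lambda>q x. F j x $ i q) x - jac k \<beta> (\<lambda>q x. F m x $ i q) x\<bar> \<le> real k * (fact k * (E * (E + g x) ^ (k - 1)))"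
      unfolding jac_def by (rule minor_difference_bound) (use r dd in auto)
    have "E * (E + g x) ^ (k - 1) \<le> \<theta> * (E + g x) ^ k + E ^ k / \<theta> ^ k'"
      using young_power[OF E0 _ \<theta>, of "E + g x" k'] E0 g0 by (simp add: k')
    also have "\<dots> \<le> \<theta> * (2 ^ k * (E ^ k + g x ^ k)) + E ^ k / \<theta> ^ k'"
      using \<theta> by (intro add_right_mono mult_left_mono power_add_le_power_sum E0 g0) auto
    also have "\<dots> = 2 ^ k * \<theta> * g x ^ k + (2 ^ k * \<theta> + 1 / \<theta> ^ k') * E ^ k" by (simp add: algebra_simps)
    also have "\<dots> \<le> 2 ^ k * \<theta> * g x ^ k + (2 ^ k * \<theta> + 1 / \<theta> ^ k') * (2 ^ k * (d j x ^ k + d m x ^ k))"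
      unfolding E_def using \<theta> by (intro add_left_mono mult_left_mono power_add_le_power_sum d0) auto
    also have "\<dots> = 2 ^ k * \<theta> * g x ^ k + \<Lambda> * (d j x ^ k + d m x ^ k)" by (simp only: \<Lambda>_def mult.assoc)
    finally have "real k * (fact k * (E * (E + g x) ^ (k - 1)))
        \<le> real k * (fact k * (2 ^ k * \<theta> * g x ^ k + \<Lambda> * (d j x ^ k + d m x ^ k)))"
      by (intro mult_left_mono) auto
    with J1 have J: "\<bar>jac k \<beta> (\<lambda>q x. F j x $ i q) x - jac k \<beta> (\<lambda>q x. F m x $ i q) x\<bar>
        \<le> real k * (fact k * (2 ^ k * \<theta> * g x ^ k + \<Lambda> * (d j x ^ k + d m x ^ k)))" by (rule order_trans)
    have "\<bar>\<phi> x * H (F m x)\<bar> \<le> C\<phi> * CH"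
      unfolding abs_mult using C\<phi> CH FM[OF x] x by (intro mult_mono) auto
    then have "\<bar>(\<phi> x * H (F m x)) * (jac k \<beta> (\<lambda>q x. F j x $ i q) x - jac k \<beta> (\<lambda>q x. F m x $ i q) x)\<bar>
        \<le> (C\<phi> * CH) * (real k * (fact k * (2 ^ k * \<theta> * g x ^ k + \<Lambda> * (d j x ^ k + d m x ^ k))))"
      unfolding abs_mult[of "\<phi> x * H (F m x)"] using J C\<phi> CH by (intro mult_mono) auto
    then show ?thesis by (simp only: C6_def mult.assoc)
  qed
  define e' where "e' = e / (4 * (C6 * \<Lambda> + 1))"
  have C\<Lambda>: "C6 * \<Lambda> > 0" using C6 \<Lambda> by simp
  have e': "e' > 0" using \<open>0 < e\<close> C\<Lambda> by (simp add: e'_def)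
  have "\<forall>\<^sub>F l in sequentially. D l < ennreal e'"
    using order_tendstoD(2)[OF D] e' by simp
  then obtain m0 where m0: "\<And>l. l \<ge> m0 \<Longrightarrow> D l < ennreal e'" unfolding eventually_sequentially by blast
  show ?thesis
  proof (intro exI[of _ m0] allI impI)
    fix m j assume m: "m0 \<le> m" and j: "m \<le> j"
    let ?h = "\<lambda>x. (\<phi> x * H (F m x)) * (jac k \<beta> (\<lambda>q x. F j x $ i q) x - jac k \<beta> (\<lambda>q x. F m x $ i q) x)"
    have sj: "smooth_on UNIV (jac k \<beta> (\<lambda>q x. F l x $ i q))" for l by (intro smooth_jac Fs)
    have int: "integrable lborel (\<lambda>x. (\<phi> x * H (F m x)) * jac k \<beta> (\<lambda>q x. F l x $ i q) x)" for l
      by (rule integrable_continuous_bounded_support[of _ "1/2"])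
        (use \<phi>(2) in \<open>auto intro!: smooth_on_continuous smooth_on_mult[OF \<psi>s sj] simp: zero_beyond_def\<close>)
    have "b m j - b m m = (\<integral>x. ?h x \<partial>lborel)"
      unfolding b_def using int[of j] int[of m] by (simp add: right_diff_distrib)
    moreover have "integrable lborel ?h" using int[of j] int[of m] by (simp add: right_diff_distrib)
    ultimately have "ennreal \<bar>b m j - b m m\<bar> \<le> (\<integral>\<^sup>+x. ennreal (norm (?h x)) \<partial>lborel)"
      using integral_norm_bound_ennreal[of lborel ?h] by simp
    also have "\<dots> \<le> (\<integral>\<^sup>+x. ennreal C6 * (ennreal (2 ^ k * \<theta>) * (indicator ?B x * ennreal (g x ^ k))
        + ennreal \<Lambda> * (indicator ?B x * ennreal (d j x ^ k) + indicator ?B x * ennreal (d m x ^ k))) \<partial>lborel)"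
    proof (rule nn_integral_mono)
      fix x
      show "ennreal (norm (?h x)) \<le> ennreal C6 * (ennreal (2 ^ k * \<theta>) * (indicator ?B x * ennreal (g x ^ k))
        + ennreal \<Lambda> * (indicator ?B x * ennreal (d j x ^ k) + indicator ?B x * ennreal (d m x ^ k)))"
      proof (cases "norm x \<le> 1/2")
        case True
        have "ennreal (norm (?h x)) \<le> ennreal (C6 * (2 ^ k * \<theta> * g x ^ k + \<Lambda> * (d j x ^ k + d m x ^ k)))"
          using pt[OF True] by (intro ennreal_leI) simp
        also have "\<dots> = ennreal C6 * (ennreal (2 ^ k * \<theta>) * ennreal (g x ^ k) + ennreal \<Lambda> * (ennreal (d j x ^ k) + ennreal (d m x ^ k)))"
        proof -
          have n: "0 \<le> g x ^ k" "0 \<le> d j x ^ k" "0 \<le> d m x ^ k" "0 \<le> 2 ^ k * \<theta>" "0 \<le> \<Lambda>" "0 \<le> C6"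
            using d0 g0 \<theta> \<Lambda> C6 by auto
          show ?thesis using n by (simp only: ennreal_plus[symmetric] ennreal_mult[symmetric] add_nonneg_nonneg mult_nonneg_nonneg)
        qed
        finally show ?thesis using True by simp
      next
        case False
        then have "\<phi> x = 0" using \<phi>(2) by (simp add: zero_beyond_def)
        then show ?thesis by simp
      qed
    qed
    also have "\<dots> = ennreal C6 * (ennreal (2 ^ k * \<theta>) * ennreal \<gamma> + ennreal \<Lambda> * (D j + D m))"
    proof -
      have m1: "(\<lambda>x. indicator ?B x * ennreal (g x ^ k)) \<in> borel_measurable lborel"
        using gm by (intro borel_measurable_times_ennreal borel_measurable_indicator measurable_compose[OF _ measurable_ennreal] borel_measurable_power) auto
      have m2: "(\<lambda>x. indicator ?B x * ennreal (d l x ^ k)) \<in> borel_measurable lborel" for l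
        using dm[of l] by (intro borel_measurable_times_ennreal borel_measurable_indicator measurable_compose[OF _ measurable_ennreal] borel_measurable_power) auto
      show ?thesis
        using m1 m2[of j] m2[of m] by (simp add: nn_integral_cmult nn_integral_add \<gamma> D_def)
    qed
    also have "\<dots> \<le> ennreal C6 * (ennreal (2 ^ k * \<theta>) * ennreal \<gamma> + ennreal \<Lambda> * (ennreal e' + ennreal e'))"
      using m0[of j] m0[of m] m j by (intro mult_left_mono add_left_mono add_mono) auto
    also have "\<dots> = ennreal (C6 * (2 ^ k * \<theta> * \<gamma> + \<Lambda> * (e' + e')))"
      using C6 \<theta> \<gamma>0 \<Lambda> e' by (simp only: ennreal_plus[symmetric] ennreal_mult[symmetric] add_nonneg_nonneg mult_nonneg_nonneg less_imp_le zero_le_power zero_le_numeral)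
    finally have le: "ennreal \<bar>b m j - b m m\<bar> \<le> ennreal (C6 * (2 ^ k * \<theta> * \<gamma> + \<Lambda> * (e' + e')))" .
    have "0 \<le> C6 * (2 ^ k * \<theta> * \<gamma> + \<Lambda> * (e' + e'))"
      using C6 \<theta> \<gamma>0 \<Lambda> e' by (intro mult_nonneg_nonneg add_nonneg_nonneg) auto
    from le[unfolded ennreal_le_iff[OF this]]
    have "\<bar>b m j - b m m\<bar> \<le> C6 * (2 ^ k * \<theta> * \<gamma> + \<Lambda> * (e' + e'))" .
    also have "C6 * (2 ^ k * \<theta> * \<gamma> + \<Lambda> * (e' + e')) = (C6 * 2 ^ k * \<gamma>) * \<theta> + 2 * (C6 * \<Lambda>) * e'" by (simp add: algebra_simps)
    also have "\<dots> \<le> (C6 * 2 ^ k * \<gamma> + 1) * \<theta> + 2 * (C6 * \<Lambda> + 1) * e'"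
      using \<theta> e' by (intro add_mono mult_right_mono) auto
    also have "\<dots> = e"
    proof -
      have h1: "X * (e / (2 * X)) = e / 2" "2 * X * (e / (4 * X)) = e / 2" if "X > 0" for X :: real using that by auto
      have "C6 * 2 ^ k * \<gamma> + 1 > 0" "C6 * \<Lambda> + 1 > 0" using C\<gamma> C\<Lambda> by auto
      then show ?thesis unfolding \<theta>_def e'_def h1(1)[OF \<open>C6 * 2 ^ k * \<gamma> + 1 > 0\<close>] h1(2)[OF \<open>C6 * \<Lambda> + 1 > 0\<close>] by simp
    qed
    finally show "\<bar>b m j - b m m\<bar> \<le> e" .
  qed
qed

section \<open>Consequences of the distributional rank condition\<close>

lemma exists_sorting_permutation:
  fixes i :: "nat \<Rightarrow> 'm::{finite,linorder}"
  assumes "inj_on i {..<k}"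
  obtains \<sigma> where "\<sigma> permutes {..<k}" "strict_mono_on {..<k} (i \<circ> \<sigma>)"
proof -
  define xs where "xs = sorted_list_of_set (i ` {..<k})"
  have len: "length xs = k" using assms by (simp add: xs_def card_image)
  have st: "sorted_wrt (<) xs" by (simp add: xs_def strict_sorted_iff)
  have set: "set xs = i ` {..<k}" by (simp add: xs_def)
  define \<sigma> where "\<sigma> j = (if j < k then inv_into {..<k} i (xs ! j) else j)" for j
  have mem: "xs ! j \<in> i ` {..<k}" if "j < k" for j using that len set nth_mem by metis
  have i\<sigma>: "i (\<sigma> j) = xs ! j" if "j < k" for j using that mem[OF that] by (simp add: \<sigma>_def f_inv_into_f)
  have in_k: "\<sigma> j < k" if "j < k" for j using that inv_into_into[OF mem[OF that]] by (simp add: \<sigma>_def)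
  have inj: "inj_on \<sigma> {..<k}"
  proof (rule inj_onI)
    fix a b assume ab: "a \<in> {..<k}" "b \<in> {..<k}" "\<sigma> a = \<sigma> b"
    then have "xs ! a = xs ! b" using i\<sigma>[of a] i\<sigma>[of b] by simp
    moreover have "distinct xs" by (simp add: xs_def)
    ultimately show "a = b" using ab len by (simp add: nth_eq_iff_index_eq)
  qed
  have "bij_betw \<sigma> {..<k} {..<k}"
    unfolding bij_betw_def using inj in_k by (metis endo_inj_surj finite_lessThan image_subsetI lessThan_iff)
  then have "\<sigma> permutes {..<k}" by (rule bij_imp_permutes) (simp add: \<sigma>_def)
  moreover have "strict_mono_on {..<k} (i \<circ> \<sigma>)"
    unfolding strict_mono_on_def using i\<sigma> sorted_wrt_nth_less[OF st] len by simp
  ultimately show ?thesis using that by blast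
qed

text \<open>For increasing \<open>i\<close> this is the rank condition for the maps \<open>smoothen t\<close>. Other multi-indices reduce to this
  case: with distinct entries they can be sorted, at the cost of a sign, and with a repeated entry the minor is zero.\<close>

lemma minors_vanish:
  fixes u :: "real^('n::{finite,linorder}) \<Rightarrow> real^('m::{finite,linorder})" and i :: "nat \<Rightarrow> 'm"
  assumes u: "u \<in> sobolev_space s p (ball 0 1)" "continuous_on (ball 0 1) u" and p: "1 < p"
    and rank: "rank_gradient_less s p k u"
    and \<phi>: "\<phi> \<in> test_functions (ball 0 1)" and \<beta>: "strict_mono_on {..<k} \<beta>"
  shows "((\<lambda>t. \<integral>x. \<phi> x * jac k \<beta> (\<lambda>q x. smoothen t (zero_extension u) x $ i q) x \<partial>lborel) \<longlongrightarrow> 0) (at_right 0)"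
proof -
  let ?F = "\<lambda>t. smoothen t (zero_extension u)"
  have iu: "integrable lborel (zero_extension u)"
    by (rule integrable_zero_extension[OF u(2), of p]) (use u(1) p in \<open>auto simp: sobolev_space_def\<close>)
  have mono: "((\<lambda>t. \<integral>x. \<phi> x * jac k \<beta> (\<lambda>q x. ?F t x $ i q) x \<partial>lborel) \<longlongrightarrow> 0) (at_right 0)"
    if i: "strict_mono_on {..<k} i" for i :: "nat \<Rightarrow> 'm"
  proof -
    have adm: "\<forall>t>0. ?F t \<in> smooth_closure (ball 0 1)"
      using smooth_smoothen[OF _ iu] unfolding smooth_closure_def by blast
    have "pullback_vanishes s p k i u" using rank i by (simp add: rank_gradient_less_def)
    from this[unfolded pullback_vanishes_def, rule_format, OF \<phi> conjI[OF adm smoothen_tendsto_sobolev[OF u p]] \<beta>]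
    have "((\<lambda>t. \<integral>x. form_component \<beta> (pullback k i (?F t) x) * \<phi> x \<partial>lebesgue_on (ball 0 1)) \<longlongrightarrow> 0) (at_right 0)" .
    then show ?thesis
    proof (rule Lim_transform_eventually)
      show "\<forall>\<^sub>F t in at_right 0. (\<integral>x. form_component \<beta> (pullback k i (?F t) x) * \<phi> x \<partial>lebesgue_on (ball 0 1))
          = (\<integral>x. \<phi> x * jac k \<beta> (\<lambda>q x. ?F t x $ i q) x \<partial>lborel)"
        using eventually_at_right_less[of "0::real"]
      proof (rule eventually_mono)
        fix t :: real assume "0 < t"
        show "(\<integral>x. form_component \<beta> (pullback k i (?F t) x) * \<phi> x \<partial>lebesgue_on (ball 0 1))
          = (\<integral>x. \<phi> x * jac k \<beta> (\<lambda>q x. ?F t x $ i q) x \<partial>lborel)"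
        proof (rule integral_lebesgue_on_ball_eq)
          have "smooth_on UNIV (\<lambda>x. \<phi> x * jac k \<beta> (\<lambda>q x. ?F t x $ i q) x)"
            by (intro smooth_on_mult test_functionD(1)[OF \<phi>] smooth_jac smooth_smoothen_component[OF \<open>0 < t\<close> iu])
          then show "(\<lambda>x. \<phi> x * jac k \<beta> (\<lambda>q x. ?F t x $ i q) x) \<in> borel_measurable borel"
            by (intro borel_measurable_continuous_onI smooth_on_continuous)
        qed (simp_all add: test_functionD(3)[OF \<phi>] form_component_pullback_jac)
      qed
    qed
  qed
  show ?thesis
  proof (cases "inj_on i {..<k}")
    case True
    then obtain \<sigma> where \<sigma>: "\<sigma> permutes {..<k}" "strict_mono_on {..<k} (i \<circ> \<sigma>)"
      by (rule exists_sorting_permutation)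
    have "jac k \<beta> (\<lambda>q x. ?F t x $ (i \<circ> \<sigma>) q) x = of_int (sign \<sigma>) * jac k \<beta> (\<lambda>q x. ?F t x $ i q) x" for t x
      unfolding jac_def o_def
      using minor_permute_rows[OF \<sigma>(1), of "\<lambda>q a. partial (\<beta> a) (\<lambda>x. ?F t x $ i q) x"] by simp
    moreover have "of_int (sign \<sigma>) * (of_int (sign \<sigma>) :: real) = 1" by (simp add: sign_def)
    ultimately have e: "jac k \<beta> (\<lambda>q x. ?F t x $ i q) x = of_int (sign \<sigma>) * jac k \<beta> (\<lambda>q x. ?F t x $ (i \<circ> \<sigma>) q) x" for t x
      by (metis mult.assoc mult_1)
    have "((\<lambda>t. of_int (sign \<sigma>) * (\<integral>x. \<phi> x * jac k \<beta> (\<lambda>q x. ?F t x $ (i \<circ> \<sigma>) q) x \<partial>lborel)) \<longlongrightarrow> of_int (sign \<sigma>) * 0) (at_right 0)"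
      by (intro tendsto_mult tendsto_const mono[OF \<sigma>(2)])
    moreover have "(\<integral>x. \<phi> x * jac k \<beta> (\<lambda>q x. ?F t x $ i q) x \<partial>lborel)
        = of_int (sign \<sigma>) * (\<integral>x. \<phi> x * jac k \<beta> (\<lambda>q x. ?F t x $ (i \<circ> \<sigma>) q) x \<partial>lborel)" for t
    proof -
      have "\<phi> x * jac k \<beta> (\<lambda>q x. ?F t x $ i q) x = of_int (sign \<sigma>) * (\<phi> x * jac k \<beta> (\<lambda>q x. ?F t x $ (i \<circ> \<sigma>) q) x)" for x
        unfolding e by (rule mult.left_commute)
      then show ?thesis by (simp only: integral_mult_right_zero)
    qed
    ultimately show ?thesis by (simp only: mult_zero_right)
  next
    case False
    then obtain q r where qr: "q < k" "r < k" "q \<noteq> r" "i q = i r" by (auto simp: inj_on_def)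
    have "jac k \<beta> (\<lambda>q x. ?F t x $ i q) x = 0" for t x
      unfolding jac_def by (rule minor_repeated_row[OF qr(1-3)]) (simp add: qr(4))
    then show ?thesis by simp
  qed
qed

text \<open>Let \<open>b m j\<close> be the integral with the weight at scale \<open>m\<close> and the minor at scale \<open>j\<close>. Each weight is a test function, so
  \<open>b m j\<close> tends to \<open>0\<close> as \<open>j\<close> grows, while \<open>b m j\<close> stays close to \<open>b m m\<close> if \<open>m\<close> is large.\<close>

lemma weighted_minors_vanish:
  fixes u :: "real^('n::{finite,linorder}) \<Rightarrow> real^('m::{finite,linorder})" and i :: "nat \<Rightarrow> 'm"
  assumes u: "u \<in> sobolev_space s (real k / s) (ball 0 1)" "continuous_on (ball 0 1) u"
    and k: "2 \<le> k" and s: "0 < s" "s \<le> 1" "real k / (real k + 1) \<le> s"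
    and rank: "rank_gradient_less s (real k / s) k u"
    and \<phi>: "smooth_on UNIV \<phi>" "zero_beyond (1/2) \<phi>" and H: "smooth_on UNIV H" and \<beta>: "strict_mono_on {..<k} \<beta>"
  defines "F \<equiv> \<lambda>l. smoothen (scale k l) (zero_extension u)"
  shows "(\<lambda>m. \<integral>x. (\<phi> x * H (F m x)) * jac k \<beta> (\<lambda>q x. F m x $ i q) x \<partial>lborel) \<longlonglongrightarrow> 0"
proof -
  let ?p = "real k / s"
  have p: "1 < ?p" using k s by (simp add: field_simps)
  have iu: "integrable lborel (zero_extension u)"
    by (rule integrable_zero_extension[OF u(2), of ?p]) (use u(1) p in \<open>auto simp: sobolev_space_def\<close>)
  define b where "b m j = (\<integral>x. (\<phi> x * H (F m x)) * jac k \<beta> (\<lambda>q x. F j x $ i q) x \<partial>lborel)" for m j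
  have cauchy: "\<exists>m0. \<forall>m\<ge>m0. \<forall>j\<ge>m. \<bar>b m j - b m m\<bar> \<le> e" if "0 < e" for e
  proof (cases "s = 1")
    case True
    have "u \<in> sobolev_space 1 (real k) (ball 0 1)" using u(1) True by simp
    from minors_cauchy_W1[OF this u(2) k \<phi> H that, of \<beta> i] show ?thesis unfolding b_def F_def .
  next
    case False
    have "sobolev_seminorm s ?p (ball 0 1) u < \<infinity>" using u(1) by (simp add: sobolev_space_def)
    with False have fin: "gagliardo_seminorm s ?p (ball 0 1) u < \<infinity>" by (simp only: sobolev_seminorm_def if_False)
    have sp: "s * ?p = real k" "0 < ?p" "?p \<le> real k + 1" using s p by (auto simp: field_simps)
    have "1 \<le> k" using k by simp
    from minors_cauchy_fractional[OF u(2) iu fin sp this \<phi> H that, of \<beta> i] show ?thesis unfolding b_def F_def .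
  qed
  have lim: "(\<lambda>j. b m j) \<longlonglongrightarrow> 0" for m
  proof -
    have Fs: "smooth_on UNIV (\<lambda>x. F m x $ q)" for q
      unfolding F_def by (rule smooth_smoothen_component[OF scale(1) iu])
    have test: "(\<lambda>x. \<phi> x * H (F m x)) \<in> test_functions (ball 0 1)"
    proof (rule test_functionI[of _ "cball 0 (1/2)"])
      show "smooth_on UNIV (\<lambda>x. \<phi> x * H (F m x))" by (intro smooth_on_mult \<phi> smooth_on_compose[OF H Fs])
      show "x \<in> cball 0 (1/2)" if "\<phi> x * H (F m x) \<noteq> 0" for x
        using that zero_beyondD[OF \<phi>(2), of x] by (cases "1/2 < norm x") auto
    qed auto
    have "filterlim (scale k) (at_right 0) sequentially"
      by (rule tendsto_imp_filterlim_at_right[OF scale(3)]) (simp add: scale(1))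
    from filterlim_compose[OF minors_vanish[OF u p rank test \<beta>, of i] this]
    show ?thesis unfolding b_def F_def .
  qed
  have "(\<lambda>m. b m m) \<longlonglongrightarrow> 0"
  proof (rule LIMSEQ_I)
    fix r :: real assume "0 < r"
    then obtain m0 where m0: "\<forall>m\<ge>m0. \<forall>j\<ge>m. \<bar>b m j - b m m\<bar> \<le> r / 2" using cauchy[of "r / 2"] by auto
    have "norm (b m m - 0) < r" if m: "m \<ge> m0" for m
    proof -
      have "(\<lambda>j. \<bar>b m j - b m m\<bar>) \<longlonglongrightarrow> \<bar>0 - b m m\<bar>" by (intro tendsto_intros lim)
      moreover have "\<forall>j\<ge>m. \<bar>b m j - b m m\<bar> \<le> r / 2" using m0 m by blast
      ultimately have "\<bar>0 - b m m\<bar> \<le> r / 2" using LIMSEQ_le_const2 by blast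
      then show ?thesis using \<open>0 < r\<close> by simp
    qed
    then show "\<exists>no. \<forall>m\<ge>no. norm (b m m - 0) < r" by blast
  qed
  then show ?thesis by (simp only: b_def)
qed

section \<open>Maps close to a coordinate projection\<close>

text \<open>Chain rule and multilinearity, as in the Cauchy--Binet formula before the multi-indices are sorted.\<close>

lemma jac_compose:
  fixes F :: "real^'n \<Rightarrow> real^'m" and h :: "nat \<Rightarrow> real^'m \<Rightarrow> real"
  assumes h: "\<And>j. smooth_on UNIV (h j)" and F: "\<And>i. smooth_on UNIV (\<lambda>x. F x $ i)"
  shows "jac k \<beta> (\<lambda>j x. h j (F x)) x
    = (\<Sum>f\<in>{..<k} \<rightarrow>\<^sub>E UNIV. (\<Prod>j<k. partial (f j) (h j) (F x)) * jac k \<beta> (\<lambda>j x. F x $ f j) x)"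
proof -
  have "partial (\<beta> a) (\<lambda>x. h j (F x)) x = (\<Sum>i\<in>UNIV. partial i (h j) (F x) * partial (\<beta> a) (\<lambda>x. F x $ i) x)" for j a
    by (rule partial_compose(2)) (intro smooth_on_differentiable h F)+
  then show ?thesis unfolding jac_def by (simp only: minor_expand_rows)
qed

lemma jac_diagonal:
  assumes "\<And>j a. j < k \<Longrightarrow> a < k \<Longrightarrow> j \<noteq> a \<Longrightarrow> partial (\<beta> a) (f j) x = 0"
  shows "jac k \<beta> f x = (\<Prod>j<k. partial (\<beta> j) (f j) x)"
proof -
  let ?t = "\<lambda>\<pi>. of_int (sign \<pi>) * (\<Prod>j<k. partial (\<beta> (\<pi> j)) (f j) x)"
  have fin: "finite {\<pi>. \<pi> permutes {..<k}}" by (rule finite_permutations) simp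
  have z: "?t \<pi> = 0" if \<pi>: "\<pi> permutes {..<k}" "\<pi> \<noteq> id" for \<pi>
  proof -
    obtain j where j: "\<pi> j \<noteq> j" using \<pi>(2) by (auto simp: fun_eq_iff)
    then have "j < k" using \<pi>(1) by (metis lessThan_iff permutes_not_in)
    moreover from this have "\<pi> j < k" using permutes_in_image[OF \<pi>(1), of j] by simp
    ultimately have "(\<Prod>j<k. partial (\<beta> (\<pi> j)) (f j) x) = 0"
      using j assms[of j "\<pi> j"] by (intro prod_zero) auto
    then show ?thesis by simp
  qed
  have "jac k \<beta> f x = sum ?t {\<pi>. \<pi> permutes {..<k}}" by (simp add: jac_def minor_def)
  also have "\<dots> = ?t id + sum ?t ({\<pi>. \<pi> permutes {..<k}} - {id})"
    using fin permutes_id by (intro sum.remove) auto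
  also have "sum ?t ({\<pi>. \<pi> permutes {..<k}} - {id}) = 0" using z by (intro sum.neutral) auto
  finally show ?thesis by simp
qed

text \<open>Write \<open>y\<^sub>j\<close> for the rescaled coordinate \<open>x $ \<beta> j / \<rho>\<close>. The step \<open>B\<close> is constant on each side of \<open>[-1, 1]\<close>, and \<open>\<phi>\<close> is a product of plateau functions
  of the rescaled coordinates, flat for arguments in \<open>[-2, 2]\<close>. Exchange the functions \<open>B (g j x)\<close> for \<open>B y\<^sub>j\<close> one at a time. The
  exchange of the \<open>l\<close>-th one costs the integral of the difference \<open>B (g l x) - B y\<^sub>l\<close> times a minor with the gradient of \<open>\<phi>\<close> as
  its \<open>l\<close>-th row, and this integrand vanishes at every point. If \<open>|y\<^sub>l| \<ge> 2\<close>, then \<open>g l x\<close> and \<open>y\<^sub>l\<close> lie on the same side of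
  \<open>[-1, 1]\<close> and the difference is \<open>0\<close>. If \<open>|y\<^sub>j| \<ge> 2\<close> for another \<open>j\<close>, then the \<open>j\<close>-th row is \<open>0\<close>. In the remaining case \<open>\<phi>\<close> is
  flat in all directions that enter the minor. For the coordinates themselves the minor is diagonal and nonnegative.\<close>

lemma minors_of_near_projection:
  fixes \<beta> :: "nat \<Rightarrow> 'n::finite"
  assumes \<beta>: "inj_on \<beta> {..<k}"
  obtains \<rho> B and \<phi> :: "real^'n \<Rightarrow> real" and c :: real where
    "0 < \<rho>" "smooth_real B" "smooth_on UNIV \<phi>" "zero_beyond (1/2) \<phi>" "0 < c"
    "\<forall>g :: nat \<Rightarrow> real^'n \<Rightarrow> real. (\<forall>j. smooth_on UNIV (g j)) \<longrightarrow>
      (\<forall>j<k. \<forall>x. norm x \<le> 1/2 \<longrightarrow> \<bar>g j x - x $ \<beta> j / \<rho>\<bar> < 1) \<longrightarrow>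
      (\<integral>x. \<phi> x * jac k \<beta> (\<lambda>j x. B (g j x)) x \<partial>lborel) = c"
proof -
  obtain B b where B: "smooth_real B" "smooth_real b" "\<And>t. (B has_real_derivative b t) (at t)"
    "\<And>t. t \<le> -1 \<Longrightarrow> B t = 0" "\<And>t. 1 \<le> t \<Longrightarrow> B t = 1" "\<And>t. 0 \<le> B t"
    "\<And>t. 1 \<le> \<bar>t\<bar> \<Longrightarrow> b t = 0" "\<And>t. 0 \<le> b t" "0 < b 0"
    by (rule smooth_step_exists) (rule that)
  obtain P p where P: "smooth_real P" "\<And>t. (P has_real_derivative p t) (at t)"
    "\<And>t. \<bar>t\<bar> \<le> 2 \<Longrightarrow> P t = 1" "\<And>t. 4 \<le> \<bar>t\<bar> \<Longrightarrow> P t = 0" "\<And>t. 0 \<le> P t"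
    "\<And>t. \<bar>t\<bar> \<le> 2 \<Longrightarrow> p t = 0" "\<And>t. 4 \<le> \<bar>t\<bar> \<Longrightarrow> p t = 0"
    by (rule smooth_plateau_exists) (rule that)
  \<comment> \<open>the cube \<open>\<bar>x $ a\<bar> \<le> 4 * \<rho>\<close>, outside of which \<open>\<phi>\<close> vanishes, lies in the ball of radius \<open>1/2\<close>\<close>
  define \<rho> where "\<rho> = 1 / (8 * real CARD('n))"
  have \<rho>: "\<rho> > 0" by (simp add: \<rho>_def)
  define y where "y a x = x $ a / \<rho>" for a and x :: "real^'n"
  have ye: "y a = (\<lambda>x. (1 / \<rho>) * x $ a)" for a by (simp add: y_def fun_eq_iff)
  have ys: "smooth_on UNIV (y a)" for a
    unfolding ye by (rule smooth_on_mult[OF smooth_on_const smooth_on_component])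
  have yp: "partial a (y a') x = (if a = a' then 1 / \<rho> else 0)" for a a' x
    unfolding ye using partial_cmult[of "\<lambda>x. x $ a'" x a "1 / \<rho>", OF smooth_on_differentiable[OF smooth_on_component]]
    by (simp add: partial_component)
  define \<phi> where "\<phi> x = (\<Prod>a\<in>UNIV. P (y a x))" for x
  have Ps: "smooth_on UNIV (\<lambda>x. P (y a x))" for a by (rule smooth_on_real_compose[OF P(1) ys])
  have \<phi>s: "smooth_on UNIV \<phi>" unfolding \<phi>_def[abs_def] by (rule smooth_on_prod) (rule Ps)
  have Pp: "partial a (\<lambda>x. P (y a' x)) x = p (y a' x) * (if a = a' then 1 / \<rho> else 0)" for a a' x
    using partial_real_compose[OF P(2) smooth_on_differentiable[OF ys]] by (simp only: yp)
  have \<phi>p: "partial a \<phi> x = (\<Sum>m\<in>UNIV. p (y m x) * (if a = m then 1 / \<rho> else 0) * (\<Prod>j\<in>UNIV - {m}. P (y j x)))" for a x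
    unfolding \<phi>_def[abs_def] using partial_prod[of UNIV "\<lambda>m x. P (y m x)" a x] Ps by (simp only: Pp finite)
  have \<phi>p': "partial a \<phi> x = p (y a x) * (1 / \<rho>) * (\<Prod>j\<in>UNIV - {a}. P (y j x))" for a x
  proof -
    have "partial a \<phi> x = (\<Sum>m\<in>UNIV. if m = a then p (y m x) * (1 / \<rho>) * (\<Prod>j\<in>UNIV - {m}. P (y j x)) else 0)"
      unfolding \<phi>p by (rule sum.cong) auto
    then show ?thesis by simp
  qed
  \<comment> \<open>outside of the ball some plateau function vanishes together with its derivative\<close>
  have big: "\<exists>a. 4 \<le> \<bar>y a x\<bar>" if large: "1/2 < norm x" for x
  proof -
    obtain a where "(1/2) / real CARD('n) \<le> \<bar>x $ a\<bar>" by (rule exists_large_component[OF large])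
    then have "4 \<le> \<bar>y a x\<bar>" by (simp add: y_def \<rho>_def abs_mult field_simps)
    then show ?thesis ..
  qed
  have \<phi>z: "zero_beyond (1/2) \<phi>"
    unfolding zero_beyond_def \<phi>_def
  proof (intro allI impI)
    fix x :: "real^'n" assume "1/2 < norm x"
    then obtain a where "4 \<le> \<bar>y a x\<bar>" using big by blast
    then show "(\<Prod>a\<in>UNIV. P (y a x)) = 0" using P(4) by (intro prod_zero) auto
  qed
  define X where "X j x = B (y (\<beta> j) x)" for j x
  have Xs: "smooth_on UNIV (X j)" for j unfolding X_def[abs_def] by (rule smooth_on_real_compose[OF B(1) ys])
  have Xp: "partial a (X j) x = b (y (\<beta> j) x) * (if a = \<beta> j then 1 / \<rho> else 0)" for a j x
    unfolding X_def[abs_def] using partial_real_compose[OF B(3) smooth_on_differentiable[OF ys]] by (simp only: yp)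
  have jacX: "jac k \<beta> X x = (\<Prod>j<k. b (y (\<beta> j) x) * (1 / \<rho>))" for x
  proof -
    have "jac k \<beta> X x = (\<Prod>j<k. partial (\<beta> j) (X j) x)"
      by (rule jac_diagonal) (use \<beta> in \<open>auto simp: Xp inj_on_def\<close>)
    then show ?thesis by (simp add: Xp)
  qed
  define c where "c = (\<integral>x. \<phi> x * jac k \<beta> X x \<partial>lborel)"
  have "c > 0"
    unfolding c_def
  proof (rule integral_pos_of_continuous[of _ "1/2" 0])
    show "continuous_on UNIV (\<lambda>x. \<phi> x * jac k \<beta> X x)"
      by (intro smooth_on_continuous smooth_on_mult \<phi>s smooth_jac Xs)
    show "zero_beyond (1/2) (\<lambda>x. \<phi> x * jac k \<beta> X x)" using \<phi>z by (simp add: zero_beyond_def)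
    show "0 \<le> \<phi> x * jac k \<beta> X x" for x
      unfolding jacX \<phi>_def using P(5) B(8) \<rho> by (intro mult_nonneg_nonneg prod_nonneg) auto
    have "jac k \<beta> X 0 > 0" unfolding jacX using B(9) \<rho> by (intro prod_pos) (auto simp: y_def)
    moreover have "\<phi> 0 = 1" using P(3)[of 0] by (simp add: \<phi>_def y_def)
    ultimately show "0 < \<phi> 0 * jac k \<beta> X 0" by simp
  qed
  have main: "(\<integral>x. \<phi> x * jac k \<beta> (\<lambda>j x. B (g j x)) x \<partial>lborel) = c"
    if gs: "\<And>j. smooth_on UNIV (g j)" and close: "\<And>j x. j < k \<Longrightarrow> norm x \<le> 1/2 \<Longrightarrow> \<bar>g j x - x $ \<beta> j / \<rho>\<bar> < 1"
    for g :: "nat \<Rightarrow> real^'n \<Rightarrow> real"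
  proof -
    define G where "G j x = B (g j x)" for j x
    have Gs: "smooth_on UNIV (G j)" for j unfolding G_def[abs_def] by (rule smooth_on_real_compose[OF B(1) gs])
    have Gp: "partial a (G j) x = b (g j x) * partial a (g j) x" for a j x
      unfolding G_def[abs_def] by (rule partial_real_compose[OF B(3) smooth_on_differentiable[OF gs]])
    have zero: "(G l x - X l x) * jac k \<beta> ((\<lambda>j. if j < l then X j else G j)(l := \<phi>)) x = 0" if l: "l < k" for l x
    proof (cases "\<exists>a. 4 \<le> \<bar>y a x\<bar>")
      case True
      then obtain a where a: "4 \<le> \<bar>y a x\<bar>" by blast
      have "partial a' \<phi> x = 0" for a'
      proof (cases "a' = a")
        case True
        then show ?thesis using P(7)[OF a] by (simp add: \<phi>p')
      next
        case False
        then have "(\<Prod>j\<in>UNIV - {a'}. P (y j x)) = 0" using P(4)[OF a] by (intro prod_zero) auto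
        then show ?thesis by (simp add: \<phi>p')
      qed
      then have "jac k \<beta> ((\<lambda>j. if j < l then X j else G j)(l := \<phi>)) x = 0"
        unfolding jac_def by (intro minor_zero_row[OF l]) simp
      then show ?thesis by simp
    next
      case False
      have x: "norm x \<le> 1/2"
      proof (rule ccontr)
        assume "\<not> norm x \<le> 1/2"
        then have "1/2 < norm x" by linarith
        from big[OF this] False show False by blast
      qed
      have cl: "\<bar>g j x - y (\<beta> j) x\<bar> < 1" if "j < k" for j using close[OF that x] by (simp add: y_def)
      consider "2 \<le> \<bar>y (\<beta> l) x\<bar>" | j where "j < k" "j \<noteq> l" "2 \<le> \<bar>y (\<beta> j) x\<bar>" | "\<forall>j<k. \<bar>y (\<beta> j) x\<bar> \<le> 2"
        by (metis linorder_le_cases)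
      then show ?thesis
      proof cases
        case 1
        have "G l x = X l x"
        proof (cases "y (\<beta> l) x \<ge> 0")
          case True
          then have "1 \<le> y (\<beta> l) x" "1 \<le> g l x" using 1 cl[OF l] by auto
          then show ?thesis by (simp add: G_def X_def B(5))
        next
          case False
          then have "y (\<beta> l) x \<le> -1" "g l x \<le> -1" using 1 cl[OF l] by auto
          then show ?thesis by (simp add: G_def X_def B(4))
        qed
        then show ?thesis by simp
      next
        case (2 j)
        have "1 \<le> \<bar>y (\<beta> j) x\<bar>" "1 \<le> \<bar>g j x\<bar>" using 2 cl[OF 2(1)] by auto
        then have "partial a (X j) x = 0" "partial a (G j) x = 0" for a
          using B(7) by (simp_all add: Xp Gp)
        then have "jac k \<beta> ((\<lambda>j. if j < l then X j else G j)(l := \<phi>)) x = 0"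
          unfolding jac_def using 2 by (intro minor_zero_row[OF 2(1)]) simp
        then show ?thesis by simp
      next
        case 3
        then have "partial (\<beta> a) \<phi> x = 0" if "a < k" for a
          using that P(6)[of "y (\<beta> a) x"] by (simp add: \<phi>p')
        then have "jac k \<beta> ((\<lambda>j. if j < l then X j else G j)(l := \<phi>)) x = 0"
          unfolding jac_def by (intro minor_zero_row[OF l]) simp
        then show ?thesis by simp
      qed
    qed
    have "(\<integral>x. \<phi> x * jac k \<beta> G x \<partial>lborel) - c = 0"
      unfolding c_def integral_jac_difference[OF Gs Xs \<phi>s \<phi>z] by (simp add: zero)
    then show ?thesis by (simp add: G_def[abs_def])
  qed
  show ?thesis
    by (rule that[OF \<rho> B(1) \<phi>s \<phi>z \<open>c > 0\<close>]) (intro allI impI, rule main, simp_all)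
qed

section \<open>Nonexistence of the homeomorphism\<close>

lemma exists_increasing_multi_index:
  assumes "k \<le> CARD('n::{finite,linorder})"
  obtains \<beta> :: "nat \<Rightarrow> 'n::{finite,linorder}" where "strict_mono_on {..<k} \<beta>"
proof -
  define xs where "xs = sorted_list_of_set (UNIV :: 'n::{finite,linorder} set)"
  have "sorted_wrt (<) xs" "length xs = CARD('n::{finite,linorder})" by (simp_all add: xs_def strict_sorted_iff)
  then have "strict_mono_on {..<k} (\<lambda>j. xs ! j)"
    using assms by (auto simp: strict_mono_on_def intro: sorted_wrt_nth_less)
  then show ?thesis by (rule that)
qed

theorem theorem1p1:
  fixes s :: real and k :: nat
  assumes "CARD('n::{finite,linorder}) \<ge> 2" and "CARD('N::{finite,linorder}) \<ge> 1"
    and "2 \<le> k" and "k \<le> CARD('n)"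
    and "0 < s" and "s \<le> 1" and "s \<ge> real k / (real k + 1)"
  shows "\<not> (\<exists>u :: real^('n::{finite,linorder}) \<Rightarrow> real^('N::{finite,linorder}).
    u \<in> sobolev_space s (real k / s) (ball 0 1) \<and>
    (\<exists>v. homeomorphism (ball 0 1) (u ` ball 0 1) u v) \<and>
    rank_gradient_less s (real k / s) k u)"
proof
  assume "\<exists>u :: real^('n::{finite,linorder}) \<Rightarrow> real^('N::{finite,linorder}).
    u \<in> sobolev_space s (real k / s) (ball 0 1) \<and>
    (\<exists>v. homeomorphism (ball 0 1) (u ` ball 0 1) u v) \<and>
    rank_gradient_less s (real k / s) k u"
  then obtain u :: "real^('n::{finite,linorder}) \<Rightarrow> real^('N::{finite,linorder})" and v where u: "u \<in> sobolev_space s (real k / s) (ball 0 1)"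
    and v: "homeomorphism (ball 0 1) (u ` ball 0 1) u v" and rank: "rank_gradient_less s (real k / s) k u"
    by blast
  have cu: "continuous_on (ball 0 1) u" and cv: "continuous_on (u ` ball 0 1) v"
    and vu: "\<And>x. x \<in> ball 0 1 \<Longrightarrow> v (u x) = x"
    using v by (auto simp: homeomorphism_def)
  have p: "1 < real k / s" using assms by (simp add: field_simps)
  have iu: "integrable lborel (zero_extension u)"
    by (rule integrable_zero_extension[OF cu, of "real k / s"]) (use u p in \<open>auto simp: sobolev_space_def\<close>)
  obtain \<beta> :: "nat \<Rightarrow> 'n::{finite,linorder}" where \<beta>: "strict_mono_on {..<k} \<beta>"
    by (rule exists_increasing_multi_index[OF assms(4)])
  have inj: "inj_on \<beta> {..<k}" using \<beta> by (rule strict_mono_on_imp_inj_on)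
  obtain \<rho> B and \<phi> :: "real^('n::{finite,linorder}) \<Rightarrow> real" and c :: real where
    \<rho>: "0 < \<rho>" and B: "smooth_real B" and \<phi>: "smooth_on UNIV \<phi>" "zero_beyond (1/2) \<phi>" and c: "0 < c"
    and proj: "\<forall>g :: nat \<Rightarrow> real^('n::{finite,linorder}) \<Rightarrow> real. (\<forall>j. smooth_on UNIV (g j)) \<longrightarrow>
      (\<forall>j<k. \<forall>x. norm x \<le> 1/2 \<longrightarrow> \<bar>g j x - x $ \<beta> j / \<rho>\<bar> < 1) \<longrightarrow>
      (\<integral>x. \<phi> x * jac k \<beta> (\<lambda>j x. B (g j x)) x \<partial>lborel) = c"
    by (rule minors_of_near_projection[OF inj]) (rule that)
  let ?K = "cball 0 (1/2) :: (real^('n::{finite,linorder})) set"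
  have KB: "?K \<subseteq> ball 0 1" by auto
  have cuK: "continuous_on ?K u" by (rule continuous_on_subset[OF cu KB])
  have comp: "compact (u ` ?K)" by (rule compact_continuous_image[OF cuK]) auto
  \<comment> \<open>the coordinates are continuous functions of \<open>u x\<close>, because \<open>u\<close> has a continuous inverse\<close>
  have "\<exists>h. real_polynomial_function h \<and> (\<forall>y\<in>u ` ?K. \<bar>v y $ \<beta> j / \<rho> - h y\<bar> < 1/2)" for j
  proof -
    have "continuous_on (u ` ?K) (\<lambda>y. v y $ \<beta> j / \<rho>)"
      using \<rho> by (intro continuous_intros continuous_on_subset[OF cv]) auto
    from Stone_Weierstrass_real_polynomial_function[OF comp this, of "1/2"] show ?thesis by (metis half_gt_zero_iff zero_less_one)
  qed
  then obtain h where h: "\<And>j. real_polynomial_function (h j)" "\<And>j y. y \<in> u ` ?K \<Longrightarrow> \<bar>v y $ \<beta> j / \<rho> - h j y\<bar> < 1/2"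
    by metis
  have hs: "smooth_on UNIV (h j)" for j using Ck_on_polynomial[OF h(1)] by (simp add: smooth_on_def)
  have hu: "\<bar>h j (u x) - x $ \<beta> j / \<rho>\<bar> < 1/2" if "norm x \<le> 1/2" for j x
  proof -
    have x: "x \<in> ?K" using that by simp
    then have "v (u x) = x" using vu KB by blast
    then show ?thesis using h(2)[of "u x" j] x by (simp add: abs_minus_commute)
  qed
  define F where "F l = smoothen (scale k l) (zero_extension u)" for l
  have Fs: "smooth_on UNIV (\<lambda>x. F l x $ q)" for l q
    unfolding F_def by (rule smooth_smoothen_component[OF scale(1) iu])
  obtain M where M: "M > 0" "\<And>x. x \<in> ?K \<Longrightarrow> norm (u x) \<le> M"
    using compact_imp_bounded[OF comp] by (auto simp: bounded_pos)
  have "\<exists>d>0. \<forall>y z. norm z \<le> M \<longrightarrow> norm (y - z) < d \<longrightarrow> \<bar>h j y - h j z\<bar> < 1/2" for j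
  proof -
    have "uniformly_continuous_on (cball 0 (M + 1)) (h j)"
      by (intro compact_uniformly_continuous smooth_on_continuous hs) auto
    then obtain d where d: "d > 0" "\<And>y z. y \<in> cball 0 (M + 1) \<Longrightarrow> z \<in> cball 0 (M + 1) \<Longrightarrow> dist y z < d \<Longrightarrow> dist (h j y) (h j z) < 1/2"
      unfolding uniformly_continuous_on_def by (metis dist_commute half_gt_zero_iff zero_less_one)
    have "\<bar>h j y - h j z\<bar> < 1/2" if z: "norm z \<le> M" "norm (y - z) < min d 1" for y z
    proof -
      have "y \<in> cball 0 (M + 1)" "z \<in> cball 0 (M + 1)"
        using norm_triangle_sub[of y z] z by simp_all
      moreover have "dist y z < d" using z(2) by (simp add: dist_norm)
      ultimately have "dist (h j y) (h j z) < 1/2" by (rule d(2))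
      then show ?thesis by (simp only: dist_real_def)
    qed
    moreover have "0 < min d 1" using d(1) by simp
    ultimately show ?thesis by blast
  qed
  then obtain d where d: "\<And>j. d j > 0" "\<And>j y z. norm z \<le> M \<Longrightarrow> norm (y - z) < d j \<Longrightarrow> \<bar>h j y - h j z\<bar> < 1/2"
    by metis
  define d0 where "d0 = Min (d ` {..<k})"
  have "d ` {..<k} \<noteq> {}" using assms(3) by (auto simp: lessThan_empty_iff)
  then have d0: "d0 > 0" "\<And>j. j < k \<Longrightarrow> d0 \<le> d j"
    using d(1) by (auto simp: d0_def Min_gr_iff)
  obtain t0 where t0: "0 < t0" "t0 \<le> 1/8"
    "\<And>t x. 0 < t \<Longrightarrow> t < t0 \<Longrightarrow> norm x \<le> 1/2 \<Longrightarrow> norm (smoothen t (zero_extension u) x - u x) \<le> d0 / 2"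
    by (rule smoothen_uniform_limit[OF cu iu half_gt_zero[OF d0(1)]]) (rule that)
  have near: "(\<integral>x. \<phi> x * jac k \<beta> (\<lambda>j x. B (h j (F l x))) x \<partial>lborel) = c" if l: "scale k l < t0" for l
  proof -
    have near_j: "\<bar>h j (F l x) - x $ \<beta> j / \<rho>\<bar> < 1" if "j < k" "norm x \<le> 1/2" for j x
    proof -
      have "norm (F l x - u x) \<le> d0 / 2" unfolding F_def by (rule t0(3)[OF scale(1) l that(2)])
      then have "norm (F l x - u x) < d j" using d0(1) d0(2)[OF that(1)] by linarith
      then have "\<bar>h j (F l x) - h j (u x)\<bar> < 1/2" using d(2) M(2)[of x] that(2) by simp
      then show ?thesis using hu[OF that(2), of j] by linarith
    qed
    show ?thesis
    proof (rule proj[rule_format, of "\<lambda>j x. h j (F l x)"])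
      show "smooth_on UNIV (\<lambda>x. h j (F l x))" for j by (rule smooth_on_compose[OF hs Fs])
    qed (rule near_j)
  qed
  \<comment> \<open>the same integral, expanded by the chain rule into weighted minors of the approximations\<close>
  define q where "q j y = B (h j y)" for j y
  have qs: "smooth_on UNIV (q j)" for j unfolding q_def[abs_def] by (rule smooth_on_real_compose[OF B hs])
  let ?I = "{..<k} \<rightarrow>\<^sub>E (UNIV :: 'N::{finite,linorder} set)"
  define w where "w f y = (\<Prod>j<k. partial (f j) (q j) y)" for f and y :: "real^('N::{finite,linorder})"
  have ws: "smooth_on UNIV (w f)" for f
    unfolding w_def[abs_def] by (intro smooth_on_prod smooth_on_partial qs)
  have expand: "(\<integral>x. \<phi> x * jac k \<beta> (\<lambda>j x. B (h j (F l x))) x \<partial>lborel)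
      = (\<Sum>f\<in>?I. \<integral>x. (\<phi> x * w f (F l x)) * jac k \<beta> (\<lambda>j x. F l x $ f j) x \<partial>lborel)" for l
  proof -
    have "\<phi> x * jac k \<beta> (\<lambda>j x. B (h j (F l x))) x = (\<Sum>f\<in>?I. (\<phi> x * w f (F l x)) * jac k \<beta> (\<lambda>j x. F l x $ f j) x)" for x
      using jac_compose[of q "F l" k \<beta> x, OF qs Fs] by (simp add: q_def w_def sum_distrib_left mult.assoc)
    moreover have "integrable lborel (\<lambda>x. (\<phi> x * w f (F l x)) * jac k \<beta> (\<lambda>j x. F l x $ f j) x)" for f
    proof (rule integrable_continuous_bounded_support[of _ "1/2"])
      show "continuous_on UNIV (\<lambda>x. (\<phi> x * w f (F l x)) * jac k \<beta> (\<lambda>j x. F l x $ f j) x)"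
        by (intro smooth_on_continuous smooth_on_mult \<phi> smooth_on_compose[OF ws Fs] smooth_jac Fs)
      show "zero_beyond (1/2) (\<lambda>x. (\<phi> x * w f (F l x)) * jac k \<beta> (\<lambda>j x. F l x $ f j) x)"
        using \<phi>(2) by (simp add: zero_beyond_def)
    qed
    ultimately show ?thesis by (simp add: Bochner_Integration.integral_sum)
  qed
  have "(\<lambda>l. \<Sum>f\<in>?I. \<integral>x. (\<phi> x * w f (F l x)) * jac k \<beta> (\<lambda>j x. F l x $ f j) x \<partial>lborel) \<longlonglongrightarrow> (\<Sum>f\<in>?I. 0)"
    unfolding F_def
    by (intro tendsto_sum weighted_minors_vanish[OF u cu assms(3) assms(5,6,7) rank \<phi> ws \<beta>])
  then have "(\<lambda>l. \<integral>x. \<phi> x * jac k \<beta> (\<lambda>j x. B (h j (F l x))) x \<partial>lborel) \<longlonglongrightarrow> 0"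
    by (simp add: expand)
  moreover have "\<forall>\<^sub>F l in sequentially. scale k l < t0" using order_tendstoD(2)[OF scale(3) t0(1)] .
  then have "\<forall>\<^sub>F l in sequentially. (\<integral>x. \<phi> x * jac k \<beta> (\<lambda>j x. B (h j (F l x))) x \<partial>lborel) = c"
    by (rule eventually_mono) (rule near)
  then have "(\<lambda>l. \<integral>x. \<phi> x * jac k \<beta> (\<lambda>j x. B (h j (F l x))) x \<partial>lborel) \<longlonglongrightarrow> c"
    by (rule tendsto_eventually)
  ultimately have "c = 0" using LIMSEQ_unique by blast
  with c show False by simp
qed

end
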